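(* For every pair of integers $j,q>1$ of the same parity and every positive integer $p$ with $p/q<1/2$, the function $A_{p,q,j}(e)$ has the following expansion, where $y=\frac{|q-j|}{2}$: $$A_{p,q,j}(e)=\binom{j+y-1}{y}\frac{e^{2y}}{2^{4y}\cos^{2y}\frac{\pi p}{q}}+O(e^{2y+2}),\quad e\to0,\quad j\le q,$$ $$A_{p,q,j}(e)=(-1)^y\binom{j}{y}\frac{e^{2y}}{2^{4y}\cos^{2y}\frac{\pi p}{q}}+O(e^{2y+2}),\quad e\to0,\quad j>q.$$ Moreover, the following bound holds for small $e$ with some constant $C$: $$|A_{p,q,j}(e)|\le C^{3y+j+1}e^{2y}.$$ If $j$ and $q$ are of different parity, then $A_{p,q,j}=0$.
   Context: Let $F(\varphi,k)=\int_0^\varphi\frac{d\tau}{\sqrt{1-k^2\sin^2\tau}}$, $K(k)=F(\pi/2,k)$, and let $am(\cdot,k)$ be the Jacobi amplitude, the inverse of $F(\cdot,k)$. For an ellipse with semi-axes $1$ and $b=\sqrt{1-e^2}$ (eccentricity $e\in(0,1)$), the confocal ellipse $\frac{x^2}{1-\lambda^2}+\frac{y^2}{b^2-\lambda^2}=1$, $0<\lambda<b$ (here $x,y$ are Cartesian coordinates), is a caustic of the billiard in the ellipse, of eccentricity $k_\lambda=\frac{e}{\sqrt{1-\lambda^2}}$ and rotation number $\omega(\lambda,e)=\frac{F(\arcsin(\lambda/b),k_\lambda)}{2K(k_\lambda)}$, which is strictly increasing in $\lambda$ and takes each value in $(0,1/2)$ once. For $0<p/q<1/2$ ($p,q$ not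 necessarily coprime) let $k_{p/q}=k_{p/q}(e)$ be the value of $k_\lambda$ for the $\lambda$ with $\omega(\lambda,e)=p/q$. Define $$A_{p,q,j}(e)=\frac1\pi\int_0^{2\pi}\cos\bigl(j\,\varphi(\theta)\bigr)\cos(q\theta)\,d\theta,\qquad \varphi(\theta)=am\Bigl(\frac{2K(k_{p/q})}{\pi}\theta,\ k_{p/q}\Bigr).$$ *)

theory Defs
  imports "HOL-Analysis.Analysis" "HOL-Library.Landau_Symbols"
begin

(* The oriented integral makes ell_F an odd function of phi on the whole real line,
   so that its inverse am is defined on all of the reals when 0 <= k < 1. *)
definition ell_F :: "real \<Rightarrow> real \<Rightarrow> real" where
  "ell_F \<phi> k = (LBINT \<tau>=0..ereal \<phi>. 1 / sqrt (1 - k\<^sup>2 * (sin \<tau>)\<^sup>2))"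

definition ell_K :: "real \<Rightarrow> real" where
  "ell_K k = ell_F (pi / 2) k"

definition am :: "real \<Rightarrow> real \<Rightarrow> real" where
  "am u k = the_inv (\<lambda>\<phi>. ell_F \<phi> k) u"

definition semi_minor :: "real \<Rightarrow> real" where
  "semi_minor e = sqrt (1 - e\<^sup>2)"

definition caustic_ecc :: "real \<Rightarrow> real \<Rightarrow> real" where
  "caustic_ecc e lam = e / sqrt (1 - lam\<^sup>2)"

definition rotation_number :: "real \<Rightarrow> real \<Rightarrow> real" where
  "rotation_number lam e =
     ell_F (arcsin (lam / semi_minor e)) (caustic_ecc e lam) / (2 * ell_K (caustic_ecc e lam))"

definition caustic_param :: "real \<Rightarrow> real \<Rightarrow> real" where
  "caustic_param r e = (THE lam. 0 < lam \<and> lam < semi_minor e \<and> rotation_number lam e = r)"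

definition rational_ecc :: "nat \<Rightarrow> nat \<Rightarrow> real \<Rightarrow> real" where
  "rational_ecc p q e = caustic_ecc e (caustic_param (real p / real q) e)"

definition ell_angle :: "nat \<Rightarrow> nat \<Rightarrow> real \<Rightarrow> real \<Rightarrow> real" where
  "ell_angle p q e \<theta> =
     am (2 * ell_K (rational_ecc p q e) / pi * \<theta>) (rational_ecc p q e)"

definition A_coeff :: "nat \<Rightarrow> nat \<Rightarrow> nat \<Rightarrow> real \<Rightarrow> real" where
  "A_coeff p q j e =
     1 / pi * (LBINT \<theta>=0..ereal (2 * pi). cos (real j * ell_angle p q e \<theta>) * cos (real q * \<theta>))"

(* Only used when j and q have the same parity, where the division by 2 is exact. *)
definition half_diff :: "nat \<Rightarrow> nat \<Rightarrow> nat" where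
  "half_diff q j = nat \<bar>int q - int j\<bar> div 2"

end

theory Submission
  imports Defs
begin

text \<open>Write \<open>k\<close> for the eccentricity of the caustic and
\<open>\<theta>(\<phi>) = \<pi> F(\<phi>, k) / (2 K(k))\<close>. The amplitude \<open>\<phi>(\<theta>)\<close> in the definition of the
coefficient is the inverse of this function, which is explicit. Taking \<open>\<phi>\<close> as the variable
of integration and integrating by parts gives
\<open>A = (j / q) (1 / \<pi>) \<integral> sin (j \<phi>) sin (q \<theta>(\<phi>)) d\<phi>\<close> over a full period
(\<open>A_coeff_eq_integral\<close>). Since \<open>\<theta>(\<phi> + \<pi>) = \<theta>(\<phi>) + \<pi>\<close>, the integrand changes sign
under \<open>\<phi> \<mapsto> \<phi> + \<pi>\<close> when \<open>j\<close> and \<open>q\<close> have different parity, so the integral is zero.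

For equal parity the phase \<open>\<theta>(\<phi>) - \<phi>\<close> is expanded in \<open>w = exp (2 i \<phi>)\<close>. With
\<open>\<rho> = (1 - k') / (1 + k')\<close>, \<open>k'\<^sup>2 = 1 - k\<^sup>2\<close>, the radicand factors as a constant times
\<open>(1 + \<rho> w) (1 + \<rho> / w)\<close>, so \<open>\<theta>'\<close> is, up to a constant, a product of two binomial series of exponent
\<open>-1/2\<close>, one in \<open>- \<rho> w\<close> and one in \<open>- \<rho> / w\<close>. Integrating its Fourier series yields
\<open>2 i (\<theta> - \<phi>) = G(- \<rho> w) - G(- \<rho> / w)\<close>, where the \<open>n\<close>-th coefficient of the power
series \<open>G\<close> is at most \<open>1 / n\<close> uniformly in \<open>\<rho>\<close> (\<open>ell_time_expansion\<close>). Hence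
\<open>exp (- i q \<theta>)\<close> is \<open>exp (- i q \<phi>)\<close> times the product of the power series
\<open>exp (- (q / 2) G)\<close> at \<open>- \<rho> w\<close> and \<open>exp ((q / 2) G)\<close> at \<open>- \<rho> / w\<close>. Their \<open>n\<close>-th
coefficients are dominated by those of \<open>(1 - t)\<close> to the power \<open>- q\<close>, hence by \<open>2 ^ (n + q)\<close>.
The integral against \<open>exp (i j \<phi>)\<close> selects one frequency and equals a sum
\<open>\<Sum>m. P (m + y) Q m\<close> of products of the two coefficient sequences, each of whose terms carries
\<open>\<rho> ^ (y + 2 m)\<close> (\<open>A_coeff_eq_corr\<close>). The bound for small \<open>e\<close> follows at once, and the term
\<open>m = 0\<close> gives the leading order.

The leading coefficient is computed at \<open>\<rho> = 0\<close>, where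
\<open>G(t) = - 2 log ((1 + sqrt (1 - t)) / 2)\<close>: powers of this Catalan-type function satisfy a second
order differential equation, and their coefficients therefore a two-term recurrence, which is
solved by binomial coefficients (\<open>fps_exp_lag_0_pos\<close>, \<open>fps_exp_lag_0_neg\<close>).

It remains to compare \<open>\<rho>\<close> with \<open>e\<close>. The identity
\<open>F(arcsin (\<lambda> / b), k) + F(arcsin (e / k), k) = K(k)\<close> turns the equation for the rotation number
into \<open>F(arcsin (e / k), k) = (1 - 2 p / q) K(k)\<close>. As \<open>F(\<phi>, k) / K(k)\<close> decreases in \<open>k\<close>,
this determines \<open>k\<close> uniquely, and elementary bounds for \<open>F\<close> and \<open>K\<close> give
\<open>k = e / cos (\<pi> p / q) + O(e^3)\<close> (\<open>rational_ecc_bounds\<close>), so that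
\<open>\<rho> / 4 = e\<^sup>2 / (16 cos\<^sup>2 (\<pi> p / q)) + O(e^4)\<close>.\<close>

section \<open>Incomplete elliptic integrals\<close>

abbreviation ell_Delta :: "real \<Rightarrow> real \<Rightarrow> real" where
  "ell_Delta k \<phi> \<equiv> sqrt (1 - k\<^sup>2 * (sin \<phi>)\<^sup>2)"

lemma arcsin_unit_interval:
  fixes x :: real
  assumes "0 \<le> x" "x \<le> 1"
  shows "0 \<le> arcsin x" "arcsin x \<le> pi / 2" "sin (arcsin x) = x"
  using arcsin_le_arcsin[of 0 x] arcsin_ubound[of x] assms by auto

lemma ell_radicand_ge:
  fixes k \<phi> :: real
  shows "1 - k\<^sup>2 \<le> 1 - k\<^sup>2 * (sin \<phi>)\<^sup>2"
proof -
  have "k\<^sup>2 * (sin \<phi>)\<^sup>2 \<le> k\<^sup>2 * 1"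
    by (intro mult_left_mono) (auto simp: abs_square_le_1)
  then show ?thesis by simp
qed

lemma ell_radicand_pos:
  fixes k \<phi> :: real
  assumes "\<bar>k\<bar> < 1"
  shows "0 < 1 - k\<^sup>2 * (sin \<phi>)\<^sup>2"
proof -
  have "k\<^sup>2 < 1" using assms by (simp add: abs_square_less_1)
  then show ?thesis using ell_radicand_ge[of k \<phi>] by linarith
qed

lemma ell_Delta_pos: "\<bar>k\<bar> < 1 \<Longrightarrow> 0 < ell_Delta k \<phi>"
  using ell_radicand_pos by simp

lemma ell_Delta_le_1: "ell_Delta k \<phi> \<le> 1"
  by simp

lemma continuous_on_ell_integrand:
  assumes "\<bar>k\<bar> < 1"
  shows "continuous_on S (\<lambda>\<phi>. 1 / ell_Delta k \<phi>)"
  using ell_radicand_pos[OF assms] by (intro continuous_intros) (auto simp: less_imp_neq[symmetric])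

lemma DERIV_ell_F:
  assumes "\<bar>k\<bar> < 1"
  shows "((\<lambda>\<phi>. ell_F \<phi> k) has_real_derivative 1 / ell_Delta k x) (at x)"
proof -
  let ?a = "- \<bar>x\<bar> - 1" and ?b = "\<bar>x\<bar> + 1"
  have "((\<lambda>u. LBINT \<tau>=0..u. 1 / ell_Delta k \<tau>) has_vector_derivative (1 / ell_Delta k x))
          (at x within {?a..?b})"
    unfolding zero_ereal_def
    by (rule interval_integral_FTC2) (use continuous_on_ell_integrand[OF assms] in auto)
  moreover have "at x within {?a..?b} = at x"
    by (rule at_within_interior) (auto simp: abs_real_def)
  ultimately show ?thesis
    unfolding ell_F_def has_real_derivative_iff_has_vector_derivative by simp
qed

lemma ell_F_0 [simp]: "ell_F 0 k = 0"
  by (simp add: ell_F_def zero_ereal_def[symmetric] interval_integral_endpoints_same)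

lemma DERIV_ell_F_comp [derivative_intros]:
  assumes "\<bar>k\<bar> < 1" "(g has_real_derivative g') (at x within S)"
  shows "((\<lambda>x. ell_F (g x) k) has_real_derivative 1 / ell_Delta k (g x) * g') (at x within S)"
  using DERIV_chain2[OF DERIV_ell_F[OF assms(1)] assms(2)] .

lemma continuous_on_ell_F:
  assumes "\<bar>k\<bar> < 1" "continuous_on S g"
  shows "continuous_on S (\<lambda>x. ell_F (g x) k)"
proof -
  have "continuous_on UNIV (\<lambda>\<phi>. ell_F \<phi> k)"
    using DERIV_ell_F[OF assms(1)] by (intro DERIV_continuous_on) auto
  then show ?thesis
    using continuous_on_compose2[OF _ assms(2)] by blast
qed

lemma ell_F_strict_mono:
  assumes "\<bar>k\<bar> < 1" "x < y"
  shows "ell_F x k < ell_F y k"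
  by (rule DERIV_pos_imp_increasing[OF assms(2)])
     (use DERIV_ell_F[OF assms(1)] ell_Delta_pos[OF assms(1)] in \<open>blast intro: divide_pos_pos zero_less_one\<close>)

lemma ell_F_lower:
  assumes "\<bar>k\<bar> < 1" "0 \<le> \<phi>"
  shows "\<phi> \<le> ell_F \<phi> k"
proof -
  have "ell_F 0 k - 0 \<le> ell_F \<phi> k - \<phi>"
  proof (rule DERIV_nonneg_imp_nondecreasing[OF assms(2)], goal_cases)
    case (1 x)
    have "((\<lambda>x. ell_F x k - x) has_real_derivative 1 / ell_Delta k x - 1) (at x)"
      by (auto intro!: derivative_eq_intros assms(1))
    moreover have "1 / ell_Delta k x - 1 \<ge> 0"
      using ell_Delta_pos[OF assms(1), of x] ell_Delta_le_1[of k x] by (simp del: real_sqrt_le_1_iff)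
    ultimately show ?case by blast
  qed
  then show ?thesis by simp
qed

lemma ell_F_upper:
  assumes "\<bar>k\<bar> < 1" "0 \<le> \<phi>" "\<phi> \<le> \<psi>" "\<psi> \<le> pi / 2"
  shows "ell_F \<phi> k \<le> \<phi> / ell_Delta k \<psi>"
proof -
  define c where "c = 1 / ell_Delta k \<psi>"
  have "0 * c - ell_F 0 k \<le> \<phi> * c - ell_F \<phi> k"
  proof (rule DERIV_nonneg_imp_nondecreasing[OF assms(2)], goal_cases)
    case (1 x)
    have "((\<lambda>x. x * c - ell_F x k) has_real_derivative c - 1 / ell_Delta k x) (at x)"
      by (auto intro!: derivative_eq_intros assms(1))
    moreover have "ell_Delta k \<psi> \<le> ell_Delta k x"
    proof -
      have "sin x \<le> sin \<psi>" using 1 assms by (intro sin_monotone_2pi_le) auto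
      moreover have "0 \<le> sin x" using 1 assms by (intro sin_ge_zero) auto
      ultimately have "(sin x)\<^sup>2 \<le> (sin \<psi>)\<^sup>2" by (intro power_mono)
      then show ?thesis by (simp add: mult_left_mono)
    qed
    then have "c - 1 / ell_Delta k x \<ge> 0"
      unfolding c_def using ell_Delta_pos[OF assms(1), of \<psi>] by (simp add: frac_le)
    ultimately show ?case by blast
  qed
  then show ?thesis by (simp add: c_def)
qed

lemma ell_K_lower: "\<bar>k\<bar> < 1 \<Longrightarrow> pi / 2 \<le> ell_K k"
  unfolding ell_K_def by (rule ell_F_lower) auto

lemma ell_K_pos: "\<bar>k\<bar> < 1 \<Longrightarrow> 0 < ell_K k"
  using ell_K_lower[of k] pi_gt_zero by linarith

lemma ell_K_upper: "\<bar>k\<bar> < 1 \<Longrightarrow> ell_K k \<le> pi / 2 / sqrt (1 - k\<^sup>2)"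
  unfolding ell_K_def using ell_F_upper[of k "pi/2" "pi/2"] by simp

lemma ell_F_add_pi:
  assumes "\<bar>k\<bar> < 1"
  shows "ell_F (\<phi> + pi) k = ell_F \<phi> k + 2 * ell_K k"
proof -
  have const: "ell_F (x + pi) k - ell_F x k = ell_F (y + pi) k - ell_F y k" for x y
    by (rule DERIV_isconst_all[where f = "\<lambda>x. ell_F (x + pi) k - ell_F x k"])
       (auto intro!: derivative_eq_intros assms)
  have odd: "ell_F (- x) k + ell_F x k = 0" for x
  proof -
    have "ell_F (- x) k + ell_F x k = ell_F (- 0) k + ell_F 0 k"
      by (rule DERIV_isconst_all[where f = "\<lambda>x. ell_F (- x) k + ell_F x k"])
         (auto intro!: derivative_eq_intros assms)
    then show ?thesis by simp
  qed
  show ?thesis using const[of \<phi> "- (pi/2)"] odd[of "pi/2"] by (simp add: ell_K_def)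
qed

lemma am_eqI:
  assumes "\<bar>k\<bar> < 1" "ell_F \<phi> k = u"
  shows "am u k = \<phi>"
  unfolding am_def assms(2)[symmetric]
  by (rule the_inv_f_f) (metis injI ell_F_strict_mono[OF assms(1)] linorder_neqE_linordered_idom less_irrefl)

text \<open>Both sides agree at \<open>\<phi> = 0\<close>, and the left-hand side has derivative zero: if
\<open>sin \<psi> = cos \<phi> / \<Delta>(\<phi>)\<close>, then \<open>\<Delta>(\<psi>) = k' / \<Delta>(\<phi>)\<close> and
\<open>d\<psi> / d\<phi> = - k' / \<Delta>(\<phi>)\<^sup>2\<close>, so the two contributions cancel. The angles are related by
\<open>tan \<phi> tan \<psi> = 1 / k'\<close>.\<close>

lemma ell_F_complementary:
  assumes k: "0 \<le> k" "k < 1" and \<phi>: "0 \<le> \<phi>" "\<phi> \<le> pi / 2"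
  shows "ell_F \<phi> k + ell_F (arcsin (cos \<phi> / ell_Delta k \<phi>)) k = ell_K k"
proof -
  have k1: "\<bar>k\<bar> < 1" using k by simp
  define k' where "k' = sqrt (1 - k\<^sup>2)"
  have ksq: "k\<^sup>2 < 1" using k1 by (simp add: abs_square_less_1)
  have k': "0 < k'" "k'\<^sup>2 = 1 - k\<^sup>2" using ksq by (auto simp: k'_def)
  define h where "h = (\<lambda>x. cos x / ell_Delta k x)"
  have Dpos: "0 < ell_Delta k x" for x using ell_Delta_pos[OF k1] .
  have Dsq: "(ell_Delta k x)\<^sup>2 = 1 - k\<^sup>2 * (sin x)\<^sup>2" for x
    using ell_radicand_pos[OF k1, of x] by simp
  have h_sq: "1 - (h x)\<^sup>2 = (k' * sin x / ell_Delta k x)\<^sup>2" for x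
  proof -
    have "1 - (h x)\<^sup>2 = ((ell_Delta k x)\<^sup>2 - (cos x)\<^sup>2) / (ell_Delta k x)\<^sup>2"
      using Dpos[of x] by (simp add: h_def power_divide diff_divide_distrib del: real_sqrt_pow2_iff)
    also have "(ell_Delta k x)\<^sup>2 - (cos x)\<^sup>2 = (k' * sin x)\<^sup>2"
      unfolding Dsq power_mult_distrib k'(2) cos_squared_eq by (simp add: algebra_simps)
    finally show ?thesis by (simp add: power_divide)
  qed
  have h_le: "\<bar>h x\<bar> \<le> 1" for x
    using h_sq[of x] by (metis abs_square_le_1 diff_ge_0_iff_ge zero_le_power2)
  have cont: "continuous_on {0..pi/2} (\<lambda>x. ell_F x k + ell_F (arcsin (h x)) k)"
  proof (intro continuous_on_add continuous_on_ell_F k1 continuous_on_arcsin continuous_on_id)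
    show "continuous_on {0..pi/2} h"
      unfolding h_def using ell_radicand_pos[OF k1]
      by (intro continuous_intros) (auto simp: less_imp_neq[symmetric])
    show "\<forall>x\<in>{0..pi/2}. - 1 \<le> h x \<and> h x \<le> 1"
      using h_le abs_le_iff by (metis minus_le_iff)
  qed
  have der: "((\<lambda>x. ell_F x k + ell_F (arcsin (h x)) k) has_real_derivative 0) (at x)"
    if x: "0 < x" "x < pi / 2" for x
  proof -
    define D where "D = ell_Delta k x"
    have D: "0 < D" "D\<^sup>2 = 1 - k\<^sup>2 * (sin x)\<^sup>2" using Dpos Dsq by (auto simp: D_def)
    have s: "0 < sin x" using x by (intro sin_gt_zero) auto
    have c: "0 < cos x" using x by (intro cos_gt_zero) auto
    have dD: "(ell_Delta k has_real_derivative (- (k\<^sup>2 * sin x * cos x) / D)) (at x)"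
      unfolding D_def using ell_radicand_pos[OF k1, of x]
      by (auto intro!: derivative_eq_intros simp: field_simps)
    have "(h has_real_derivative ((- sin x * D - cos x * (- (k\<^sup>2 * sin x * cos x) / D)) / (D * D))) (at x)"
      unfolding h_def using DERIV_divide[OF DERIV_cos dD] D(1) by (simp add: D_def[symmetric])
    also have "(- sin x * D - cos x * (- (k\<^sup>2 * sin x * cos x) / D)) / (D * D)
             = sin x * (k\<^sup>2 * (cos x)\<^sup>2 - D\<^sup>2) / D ^ 3"
      using D(1) by (simp add: field_simps power2_eq_square power3_eq_cube)
    also have "k\<^sup>2 * (cos x)\<^sup>2 - D\<^sup>2 = - k'\<^sup>2"
      unfolding D(2) k'(2) cos_squared_eq by (simp add: algebra_simps)
    finally have dh: "(h has_real_derivative (- (k'\<^sup>2 * sin x) / D ^ 3)) (at x)"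
      by (simp add: mult.commute)
    have sq: "sqrt (1 - (h x)\<^sup>2) = k' * sin x / D"
      unfolding h_sq D_def[symmetric] using s k' D by simp
    have hlt: "- 1 < h x" "h x < 1"
    proof -
      have "0 < h x" using c D(1) by (simp add: h_def D_def)
      then show "- 1 < h x" by simp
      have "(h x)\<^sup>2 < 1\<^sup>2" using sq s k' D(1) real_sqrt_gt_0_iff[of "1 - (h x)\<^sup>2"] by simp
      then show "h x < 1" by (rule power2_less_imp_less) simp
    qed
    have "((\<lambda>x. arcsin (h x)) has_real_derivative inverse (sqrt (1 - (h x)\<^sup>2)) * (- (k'\<^sup>2 * sin x) / D ^ 3)) (at x)"
      by (rule DERIV_chain2[OF DERIV_arcsin dh]) (use hlt in auto)
    also have "inverse (sqrt (1 - (h x)\<^sup>2)) * (- (k'\<^sup>2 * sin x) / D ^ 3) = - k' / D\<^sup>2"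
      unfolding sq using s k'(1) D(1) by (simp add: field_simps power2_eq_square power3_eq_cube)
    finally have da: "((\<lambda>x. arcsin (h x)) has_real_derivative (- k' / D\<^sup>2)) (at x)" .
    have "ell_Delta k (arcsin (h x)) = k' / D"
    proof -
      have "1 - k\<^sup>2 * (h x)\<^sup>2 = (k' / D)\<^sup>2"
        unfolding h_def D_def[symmetric] power_divide using D k'
        by (simp add: field_simps) (simp add: cos_squared_eq algebra_simps)
      then show ?thesis using hlt k' D by simp
    qed
    then have "((\<lambda>x. ell_F x k + ell_F (arcsin (h x)) k) has_real_derivative 1 / D * 1 + 1 / (k' / D) * (- k' / D\<^sup>2)) (at x)"
      using DERIV_add[OF DERIV_ell_F_comp[OF k1 DERIV_ident] DERIV_ell_F_comp[OF k1 da]]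
      by (simp add: D_def)
    also have "1 / D * 1 + 1 / (k' / D) * (- k' / D\<^sup>2) = 0"
      using k'(1) D(1) by (simp add: field_simps power2_eq_square)
    finally show ?thesis .
  qed
  have "ell_F x k + ell_F (arcsin (h x)) k = ell_F 0 k + ell_F (arcsin (h 0)) k"
    if "0 \<le> x" "x \<le> pi/2" for x
    by (rule DERIV_isconst2[OF _ cont der that]) (use pi_gt_zero in auto)
  then have "ell_F \<phi> k + ell_F (arcsin (h \<phi>)) k = ell_F 0 k + ell_F (arcsin (h 0)) k"
    using \<phi> by blast
  then show ?thesis by (simp add: h_def ell_K_def)
qed

text \<open>The quotient \<open>g\<close> of the two integrands is increasing on \<open>[0, \<pi> / 2]\<close>. So on \<open>[0, \<phi>]\<close> the
integral for \<open>k2\<close> is at most \<open>g \<phi>\<close> times the one for \<open>k1\<close>, and on \<open>[\<phi>, \<pi> / 2]\<close> at least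
\<open>g \<phi>\<close> times it; comparing the two pieces gives the claim.\<close>

lemma ell_F_div_K_antimono:
  assumes k: "0 \<le> k1" "k1 \<le> k2" "k2 < 1" and \<phi>: "0 \<le> \<phi>" "\<phi> \<le> pi / 2"
  shows "ell_F \<phi> k2 / ell_K k2 \<le> ell_F \<phi> k1 / ell_K k1"
proof -
  have k1: "\<bar>k1\<bar> < 1" and k2: "\<bar>k2\<bar> < 1" using k by auto
  define g where "g = (\<lambda>x. ell_Delta k1 x / ell_Delta k2 x)"
  have gpos: "0 < g x" for x using ell_Delta_pos[OF k1] ell_Delta_pos[OF k2] by (simp add: g_def)
  have g_mono: "g x \<le> g y" if xy: "0 \<le> x" "x \<le> y" "y \<le> pi / 2" for x y
  proof -
    have "sin x \<le> sin y" using xy by (intro sin_monotone_2pi_le) auto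
    moreover have "0 \<le> sin x" using xy by (intro sin_ge_zero) auto
    ultimately have s: "(sin x)\<^sup>2 \<le> (sin y)\<^sup>2" by (intro power_mono)
    have kk: "k1\<^sup>2 \<le> k2\<^sup>2" using k by (intro power_mono) auto
    have "(1 - k1\<^sup>2 * (sin x)\<^sup>2) * (1 - k2\<^sup>2 * (sin y)\<^sup>2) \<le> (1 - k1\<^sup>2 * (sin y)\<^sup>2) * (1 - k2\<^sup>2 * (sin x)\<^sup>2)"
      using mult_nonneg_nonneg[of "k2\<^sup>2 - k1\<^sup>2" "(sin y)\<^sup>2 - (sin x)\<^sup>2"] s kk by (simp add: algebra_simps)
    then have "ell_Delta k1 x * ell_Delta k2 y \<le> ell_Delta k1 y * ell_Delta k2 x"
      by (metis real_sqrt_le_mono real_sqrt_mult)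
    then show ?thesis unfolding g_def using ell_Delta_pos[OF k2, of x] ell_Delta_pos[OF k2, of y]
      by (simp add: divide_le_eq le_divide_eq mult.commute del: real_sqrt_le_iff)
  qed
  have inv_eq: "1 / ell_Delta k2 x = g x / ell_Delta k1 x" for x
    using ell_Delta_pos[OF k1, of x] unfolding g_def
    by (metis divide_divide_eq_left div_self less_irrefl mult.commute)
  have "g \<phi> * ell_F 0 k1 - ell_F 0 k2 \<le> g \<phi> * ell_F \<phi> k1 - ell_F \<phi> k2"
  proof (rule DERIV_nonneg_imp_nondecreasing[OF \<phi>(1)], goal_cases)
    case (1 x)
    have "((\<lambda>x. g \<phi> * ell_F x k1 - ell_F x k2) has_real_derivative g \<phi> / ell_Delta k1 x - 1 / ell_Delta k2 x) (at x)"
      by (auto intro!: derivative_eq_intros k1 k2)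
    moreover have "g \<phi> / ell_Delta k1 x - 1 / ell_Delta k2 x \<ge> 0"
      unfolding inv_eq using g_mono[of x \<phi>] 1 \<phi> ell_Delta_pos[OF k1, of x] by (simp add: divide_right_mono)
    ultimately show ?case by blast
  qed
  then have a: "ell_F \<phi> k2 \<le> g \<phi> * ell_F \<phi> k1" by simp
  have "ell_F \<phi> k2 - g \<phi> * ell_F \<phi> k1 \<le> ell_F (pi/2) k2 - g \<phi> * ell_F (pi/2) k1"
  proof (rule DERIV_nonneg_imp_nondecreasing[OF \<phi>(2)], goal_cases)
    case (1 x)
    have "((\<lambda>x. ell_F x k2 - g \<phi> * ell_F x k1) has_real_derivative 1 / ell_Delta k2 x - g \<phi> / ell_Delta k1 x) (at x)"
      by (auto intro!: derivative_eq_intros k1 k2)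
    moreover have "1 / ell_Delta k2 x - g \<phi> / ell_Delta k1 x \<ge> 0"
      unfolding inv_eq using g_mono[of \<phi> x] 1 \<phi> ell_Delta_pos[OF k1, of x] by (simp add: divide_right_mono)
    ultimately show ?case by blast
  qed
  then have b: "g \<phi> * (ell_K k1 - ell_F \<phi> k1) \<le> ell_K k2 - ell_F \<phi> k2"
    by (simp add: ell_K_def algebra_simps)
  have F1: "0 \<le> ell_F \<phi> k1" using ell_F_lower[OF k1 \<phi>(1)] \<phi> by linarith
  have F2: "ell_F \<phi> k1 \<le> ell_K k1"
    using ell_F_strict_mono[OF k1, of \<phi> "pi/2"] \<phi> unfolding ell_K_def
    by (metis less_eq_real_def)
  have "ell_F \<phi> k2 * (ell_K k1 - ell_F \<phi> k1) \<le> g \<phi> * ell_F \<phi> k1 * (ell_K k1 - ell_F \<phi> k1)"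
    using a F2 by (intro mult_right_mono) auto
  also have "\<dots> = ell_F \<phi> k1 * (g \<phi> * (ell_K k1 - ell_F \<phi> k1))" by simp
  also have "\<dots> \<le> ell_F \<phi> k1 * (ell_K k2 - ell_F \<phi> k2)"
    using b F1 by (intro mult_left_mono) auto
  finally have "ell_F \<phi> k2 * ell_K k1 \<le> ell_F \<phi> k1 * ell_K k2" by (simp add: algebra_simps)
  then show ?thesis using ell_K_pos[OF k1] ell_K_pos[OF k2] by (simp add: divide_le_eq le_divide_eq mult.commute)
qed

text \<open>This is the divergence of \<open>K\<close> at \<open>k = 1\<close>: with \<open>t = \<pi> / 2 - x\<close>, the integrand is at least
\<open>1 / (t + \<delta>)\<close> because \<open>cos x \<le> t\<close>.\<close>

lemma ell_K_log_lower:
  assumes \<delta>: "0 < \<delta>" "\<delta> \<le> 1"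
  shows "ln (pi / 2 / \<delta>) \<le> ell_K (sqrt (1 - \<delta>\<^sup>2))"
proof -
  define k where "k = sqrt (1 - \<delta>\<^sup>2)"
  have d2: "\<delta>\<^sup>2 \<le> 1" "0 < \<delta>\<^sup>2" using \<delta> by (auto simp: power_le_one)
  have ksq: "k\<^sup>2 = 1 - \<delta>\<^sup>2" using d2 by (simp add: k_def)
  have k1: "\<bar>k\<bar> < 1" using ksq d2 by (simp add: abs_square_less_1[symmetric])
  have "ell_F 0 k + ln (pi/2 - 0 + \<delta>) \<le> ell_F (pi/2) k + ln (pi/2 - pi/2 + \<delta>)"
  proof (rule DERIV_nonneg_imp_nondecreasing[where a = 0 and b = "pi/2" and f = "\<lambda>x. ell_F x k + ln (pi/2 - x + \<delta>)"], goal_cases)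
    case (2 x)
    define t where "t = pi / 2 - x"
    have t: "0 \<le> t" using 2 by (simp add: t_def)
    have "((\<lambda>x. ell_F x k + ln (pi/2 - x + \<delta>)) has_real_derivative 1 / ell_Delta k x - 1 / (t + \<delta>)) (at x)"
      using 2 \<delta> by (auto intro!: derivative_eq_intros k1 simp: t_def)
    moreover have "1 / ell_Delta k x - 1 / (t + \<delta>) \<ge> 0"
    proof -
      have c: "\<bar>cos x\<bar> \<le> t" using abs_sin_x_le_abs_x[of t] t by (simp add: t_def sin_cos_eq)
      have "1 - k\<^sup>2 * (sin x)\<^sup>2 = (cos x)\<^sup>2 + \<delta>\<^sup>2 * (sin x)\<^sup>2"
        unfolding ksq cos_squared_eq by (simp add: algebra_simps)
      also have "\<dots> \<le> t\<^sup>2 + \<delta>\<^sup>2"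
        using c by (intro add_mono mult_left_le) (auto simp: abs_square_le_1 abs_le_square_iff[symmetric])
      also have "\<dots> \<le> (t + \<delta>)\<^sup>2" using t \<delta> by (simp add: power2_sum)
      finally have "ell_Delta k x \<le> t + \<delta>" using t \<delta> by (intro real_le_lsqrt) auto
      then show ?thesis using ell_Delta_pos[OF k1, of x] by (simp add: frac_le)
    qed
    ultimately show ?case by blast
  qed auto
  then have "ln (pi/2 + \<delta>) - ln \<delta> \<le> ell_K k" by (simp add: ell_K_def)
  moreover have "ln (pi/2 / \<delta>) = ln (pi/2) - ln \<delta>"
    using \<delta> by (subst ln_div) auto
  moreover have "ln (pi/2) \<le> ln (pi/2 + \<delta>)"
    using \<delta> pi_gt_zero by (subst ln_le_cancel_iff) (auto intro: add_pos_pos)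
  ultimately show ?thesis by (simp add: k_def)
qed

section \<open>The caustic with a given rotation number\<close>

lemma caustic_ecc_bounds:
  assumes e: "0 < e" "e < 1" and lam: "0 \<le> lam" "lam < semi_minor e"
  shows "e \<le> caustic_ecc e lam" "caustic_ecc e lam < 1" "e\<^sup>2 < 1 - lam\<^sup>2" "lam < 1"
proof -
  have e2: "e\<^sup>2 < 1" using e by (simp add: power_less_one_iff)
  have "lam\<^sup>2 < (semi_minor e)\<^sup>2" using lam by (intro power_strict_mono) auto
  then show *: "e\<^sup>2 < 1 - lam\<^sup>2" using e2 by (simp add: semi_minor_def)
  then have "lam\<^sup>2 < 1" using zero_le_power2[of e] by linarith
  then show "lam < 1" using lam by (simp add: power_less_one_iff)
  have "e < sqrt (1 - lam\<^sup>2)" using * by (rule real_less_rsqrt)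
  moreover have "sqrt (1 - lam\<^sup>2) \<le> 1" by simp
  ultimately have "0 < sqrt (1 - lam\<^sup>2)" "e < sqrt (1 - lam\<^sup>2)" "sqrt (1 - lam\<^sup>2) \<le> 1"
    using e by linarith+
  then show "e \<le> caustic_ecc e lam" "caustic_ecc e lam < 1"
    using e unfolding caustic_ecc_def by (simp_all add: pos_divide_less_eq pos_le_divide_eq mult_left_le
      del: real_sqrt_gt_0_iff real_sqrt_le_1_iff)
qed

lemma caustic_ecc_strict_mono:
  assumes e: "0 < e" "e < 1" and lam: "0 \<le> lam" "lam < lam'" "lam' < semi_minor e"
  shows "caustic_ecc e lam < caustic_ecc e lam'"
proof -
  have "lam'\<^sup>2 < 1" using caustic_ecc_bounds[OF e, of lam'] lam by (simp add: power_less_one_iff)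
  moreover have "lam\<^sup>2 < lam'\<^sup>2" using lam by (intro power_strict_mono) auto
  ultimately show ?thesis unfolding caustic_ecc_def using e by (intro divide_strict_left_mono) auto
qed

text \<open>In the original formula the amplitude increases with \<open>\<lambda>\<close> while the quotient \<open>F / K\<close> decreases, so
monotonicity is not visible. After passing to the complementary amplitude both effects have the same
sign.\<close>

lemma rotation_number_alt:
  assumes e: "0 < e" "e < 1" and lam: "0 \<le> lam" "lam < semi_minor e"
  shows "rotation_number lam e =
    1 / 2 - ell_F (arcsin (e / caustic_ecc e lam)) (caustic_ecc e lam) / (2 * ell_K (caustic_ecc e lam))"
proof -
  define k where "k = caustic_ecc e lam"
  define b where "b = semi_minor e"
  define \<phi> where "\<phi> = arcsin (lam / b)"
  note kb = caustic_ecc_bounds[OF e lam, folded k_def]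
  have k: "0 \<le> k" "k < 1" using kb e by auto
  have b2: "b\<^sup>2 = 1 - e\<^sup>2" using e by (simp add: b_def semi_minor_def power_le_one)
  have bl: "0 < b" "lam / b < 1" "0 \<le> lam / b" using lam by (auto simp: b_def)
  have s: "sin \<phi> = lam / b" unfolding \<phi>_def using bl by (intro sin_arcsin) auto
  have \<phi>: "0 \<le> \<phi>" "\<phi> \<le> pi / 2" unfolding \<phi>_def by (rule arcsin_unit_interval; use bl in linarith)+
  have l1: "0 < 1 - lam\<^sup>2" using kb zero_le_power2[of e] by linarith
  have k2: "k\<^sup>2 = e\<^sup>2 / (1 - lam\<^sup>2)" using l1 by (simp add: k_def caustic_ecc_def power_divide)
  have bl2: "0 < b\<^sup>2 - lam\<^sup>2" using kb b2 by simp
  have "(1 - k\<^sup>2 * (sin \<phi>)\<^sup>2) * ((1 - lam\<^sup>2) * b\<^sup>2) = (1 - lam\<^sup>2) * b\<^sup>2 - e\<^sup>2 * lam\<^sup>2"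
    unfolding s k2 power_divide using l1 bl by (simp add: field_simps)
  also have "\<dots> = b\<^sup>2 - lam\<^sup>2" unfolding b2 by (simp add: algebra_simps)
  finally have D2: "1 - k\<^sup>2 * (sin \<phi>)\<^sup>2 = (b\<^sup>2 - lam\<^sup>2) / ((1 - lam\<^sup>2) * b\<^sup>2)"
    using l1 bl by (simp add: eq_divide_eq)
  have c2: "(cos \<phi>)\<^sup>2 = (b\<^sup>2 - lam\<^sup>2) / b\<^sup>2"
    unfolding cos_squared_eq s power_divide using bl by (simp add: field_simps)
  have "(cos \<phi> / ell_Delta k \<phi>)\<^sup>2 = (cos \<phi>)\<^sup>2 / (1 - k\<^sup>2 * (sin \<phi>)\<^sup>2)"
    using ell_radicand_pos[of k \<phi>] k by (simp add: power_divide)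
  also have "\<dots> = 1 - lam\<^sup>2"
  proof -
    have "b\<^sup>2 \<noteq> 0" "b\<^sup>2 - lam\<^sup>2 \<noteq> 0" "1 - lam\<^sup>2 \<noteq> 0" using bl bl2 l1 by auto
    then show ?thesis unfolding D2 c2 divide_divide_times_eq by simp
  qed
  finally have "sqrt ((cos \<phi> / ell_Delta k \<phi>)\<^sup>2) = sqrt (1 - lam\<^sup>2)" by simp
  moreover have "0 \<le> cos \<phi> / ell_Delta k \<phi>"
    using \<phi> ell_Delta_pos[of k \<phi>] k by (intro divide_nonneg_pos cos_ge_zero) auto
  ultimately have "cos \<phi> / ell_Delta k \<phi> = sqrt (1 - lam\<^sup>2)" by (simp only: real_sqrt_abs abs_of_nonneg)
  also have "\<dots> = e / k" using e l1 by (simp add: k_def caustic_ecc_def)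
  finally have "ell_F \<phi> k + ell_F (arcsin (e / k)) k = ell_K k"
    using ell_F_complementary[OF k \<phi>] by simp
  moreover have "0 < ell_K k" using k by (intro ell_K_pos) auto
  moreover have "rotation_number lam e = ell_F \<phi> k / (2 * ell_K k)"
    by (simp add: rotation_number_def k_def \<phi>_def b_def)
  ultimately show ?thesis unfolding k_def[symmetric] by (simp add: field_simps)
qed

lemma rotation_number_strict_mono:
  assumes e: "0 < e" "e < 1" and lam: "0 \<le> lam" "lam < lam'" "lam' < semi_minor e"
  shows "rotation_number lam e < rotation_number lam' e"
proof -
  define k where "k = caustic_ecc e lam"
  define k' where "k' = caustic_ecc e lam'"
  note kb = caustic_ecc_bounds[OF e, of lam, folded k_def]
  note kb' = caustic_ecc_bounds[OF e, of lam', folded k'_def]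
  have kk: "k < k'" using caustic_ecc_strict_mono[OF e lam] by (simp add: k_def k'_def)
  have k: "0 < k" "k < 1" "e \<le> k" "k' < 1" "e \<le> k'" using kb kb' e lam by auto
  define \<psi> where "\<psi> = arcsin (e / k)"
  define \<psi>' where "\<psi>' = arcsin (e / k')"
  have lt: "e / k' < e / k" using kk k e by (intro divide_strict_left_mono) auto
  have ek: "e / k \<le> 1" "0 < e / k'" using k e kk by auto
  have psi: "\<psi>' < \<psi>" unfolding \<psi>_def \<psi>'_def using lt ek by (intro arcsin_less_arcsin) auto
  have psi0: "0 \<le> \<psi>'" "\<psi>' \<le> pi / 2" unfolding \<psi>'_def
    by (rule arcsin_unit_interval; use ek lt in linarith)+
  have "ell_F \<psi>' k' / ell_K k' \<le> ell_F \<psi>' k / ell_K k"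
    using k kk psi0 by (intro ell_F_div_K_antimono) auto
  also have "\<dots> < ell_F \<psi> k / ell_K k"
    using psi k by (intro divide_strict_right_mono ell_F_strict_mono ell_K_pos) auto
  finally show ?thesis
    unfolding rotation_number_alt[OF e lam(1) less_trans[OF lam(2,3)]]
      rotation_number_alt[OF e less_imp_le[OF le_less_trans[OF lam(1,2)]] lam(3)]
    by (simp add: k_def k'_def \<psi>_def \<psi>'_def)
qed

text \<open>Rescaling to the fixed interval \<open>[0, 1]\<close> moves the upper limit of integration into the integrand;
this is what makes joint continuity in both arguments available.\<close>

lemma ell_F_eq_integral:
  assumes k: "\<bar>k\<bar> < 1" 
  shows "ell_F \<phi> k = integral {0..1} (\<lambda>s. \<phi> / ell_Delta k (\<phi> * s))"
proof -
  have "((\<lambda>s. \<phi> / ell_Delta k (\<phi> * s)) has_integral (ell_F (\<phi> * 1) k - ell_F (\<phi> * 0) k)) {0..1}"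
    by (rule fundamental_theorem_of_calculus)
       (auto intro!: derivative_eq_intros k simp: has_real_derivative_iff_has_vector_derivative[symmetric])
  then show ?thesis by (simp add: integral_unique)
qed

lemma continuous_on_ell_F2:
  fixes f h :: "'a::t2_space \<Rightarrow> real"
  assumes "continuous_on S f" "continuous_on S h" "\<And>x. x \<in> S \<Longrightarrow> \<bar>h x\<bar> < (1::real)"
  shows "continuous_on S (\<lambda>x. ell_F (f x) (h x))"
proof -
  have "continuous_on S (\<lambda>x. integral (cbox 0 1) (\<lambda>s. f x / ell_Delta (h x) (f x * s)))"
  proof (rule integral_continuous_on_param)
    have "continuous_on (S \<times> cbox 0 1) (\<lambda>z. f (fst z) / ell_Delta (h (fst z)) (f (fst z) * snd z))"
    proof -
      have "continuous_on (S \<times> cbox 0 1) (\<lambda>z::'a \<times> real. f (fst z))"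
        by (rule continuous_on_compose2[OF assms(1)]) (auto intro: continuous_intros)
      moreover have "continuous_on (S \<times> cbox 0 1) (\<lambda>z::'a \<times> real. h (fst z))"
        by (rule continuous_on_compose2[OF assms(2)]) (auto intro: continuous_intros)
      ultimately show ?thesis
        using ell_radicand_pos[OF assms(3)] by (intro continuous_intros) (auto simp: less_imp_neq)
    qed
    then show "continuous_on (S \<times> cbox 0 1) (\<lambda>(x, s). f x / ell_Delta (h x) (f x * s))"
      by (simp add: case_prod_beta)
  qed
  then show ?thesis
    by (rule continuous_on_eq) (simp add: ell_F_eq_integral[OF assms(3)])
qed

text \<open>As \<open>\<lambda>\<close> approaches the semi-minor axis, \<open>k\<close> tends to \<open>1\<close>. The complementary integral
\<open>F(\<psi>, k)\<close> is at most \<open>\<pi> / (2 b)\<close>, since \<open>\<Delta>(\<psi>) = b\<close> when \<open>sin \<psi> = e / k\<close>, whereas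
\<open>K(k)\<close> is unbounded.\<close>

lemma ex_rotation_number_gt:
  assumes e: "0 < e" "e < 1" and r: "r < 1 / 2"
  shows "\<exists>lam. 0 < lam \<and> lam < semi_minor e \<and> r < rotation_number lam e"
proof -
  define b where "b = semi_minor e"
  have e2: "e\<^sup>2 < 1" using e by (simp add: power_less_one_iff)
  have b2: "0 < b" "b\<^sup>2 = 1 - e\<^sup>2" "b < 1" using e2 e by (auto simp: b_def semi_minor_def)
  \<comment> \<open>The modulus is chosen so close to \<open>1\<close> that \<open>K(k)\<close> exceeds \<open>M\<close>.\<close>
  define M where "M = (pi / 2 / b) / (1 - 2 * r)"
  have c: "0 < 1 - 2 * r" using r by simp
  define \<delta> where "\<delta> = min (b / 2) (pi / 2 * exp (- (M + 1)))"
  have \<delta>: "0 < \<delta>" "\<delta> < b" "\<delta> \<le> pi / 2 * exp (- (M + 1))" using b2 by (auto simp: \<delta>_def)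
  have "exp (M + 1) \<le> pi / 2 / \<delta>" using \<delta>
    by (simp add: exp_minus divide_simps del: minus_add_distrib) (simp add: ac_simps)
  then have "M + 1 \<le> ln (pi / 2 / \<delta>)" using \<delta> by (subst ln_ge_iff) auto
  define k where "k = sqrt (1 - \<delta>\<^sup>2)"
  have "M < ell_K k" using ell_K_log_lower[of \<delta>] \<delta> b2 \<open>M + 1 \<le> _\<close> by (simp add: k_def)
  have d2: "0 < \<delta>\<^sup>2" "\<delta>\<^sup>2 < b\<^sup>2" using \<delta> by (auto intro: power_strict_mono)
  have k2: "k\<^sup>2 = 1 - \<delta>\<^sup>2" unfolding k_def using d2 b2 zero_le_power2[of e] by (intro real_sqrt_pow2) linarith
  have kk: "e\<^sup>2 < k\<^sup>2" "k\<^sup>2 < 1" "0 \<le> k" using k2 d2 b2 by (auto simp: k_def)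
  have k: "e < k" "k < 1" using kk by (auto intro: power2_less_imp_less simp: power_less_one_iff)
  define lam where "lam = sqrt (1 - e\<^sup>2 / k\<^sup>2)"
  have ek: "e\<^sup>2 / k\<^sup>2 < 1" "e\<^sup>2 < e\<^sup>2 / k\<^sup>2" using kk k e by (auto simp: divide_less_eq less_divide_eq)
  have lam: "0 < lam" "lam < semi_minor e" using ek by (auto simp: lam_def semi_minor_def)
  have lam2: "lam\<^sup>2 = 1 - e\<^sup>2 / k\<^sup>2" using ek by (simp add: lam_def)
  have ke: "caustic_ecc e lam = k" using e k by (simp add: caustic_ecc_def lam2 real_sqrt_divide)
  define \<psi> where "\<psi> = arcsin (e / k)"
  have ek1: "0 < e / k" "e / k < 1" using e k by auto
  have psi: "0 \<le> \<psi>" "\<psi> \<le> pi / 2" "sin \<psi> = e / k" unfolding \<psi>_def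
    by (rule arcsin_unit_interval; use ek1 in linarith)+
  have "ell_F \<psi> k \<le> \<psi> / ell_Delta k \<psi>"
    using psi k e by (intro ell_F_upper) auto
  also have "ell_Delta k \<psi> = b" using psi k e by (simp add: power_divide b_def semi_minor_def)
  also have "\<psi> / b \<le> pi / 2 / b" using psi b2 by (intro divide_right_mono) auto
  also have "\<dots> = M * (1 - 2 * r)" using c by (simp add: M_def)
  also have "\<dots> < ell_K k * (1 - 2 * r)" using \<open>M < ell_K k\<close> c by simp
  finally have "ell_F \<psi> k / ell_K k < 1 - 2 * r"
    using ell_K_pos[of k] k e by (simp add: divide_less_eq mult.commute)
  then have "r < rotation_number lam e"
    unfolding rotation_number_alt[OF e less_imp_le[OF lam(1)] lam(2)] ke \<psi>_def by simp
  then show ?thesis using lam by blast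
qed

lemma ex1_caustic_param:
  assumes e: "0 < e" "e < 1" and r: "0 < r" "r < 1 / 2"
  shows "\<exists>!lam. 0 < lam \<and> lam < semi_minor e \<and> rotation_number lam e = r"
proof -
  obtain l1 where l1: "0 < l1" "l1 < semi_minor e" "r < rotation_number l1 e"
    using ex_rotation_number_gt[OF e r(2)] by blast
  have cont: "continuous_on {0..l1} (\<lambda>lam. rotation_number lam e)"
  proof -
    have l2: "0 < 1 - x\<^sup>2" if "x \<in> {0..l1}" for x
      using caustic_ecc_bounds(4)[OF e, of x] that l1 by (simp add: power_less_one_iff)
    have ce: "continuous_on {0..l1} (caustic_ecc e)"
      unfolding caustic_ecc_def[abs_def] using l2
      by (intro continuous_intros) (auto simp: less_imp_neq[symmetric])
    have k1: "\<bar>caustic_ecc e x\<bar> < 1" if "x \<in> {0..l1}" for x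
      using caustic_ecc_bounds[OF e, of x] that l1 e by simp
    have b: "- 1 \<le> x / semi_minor e" "x / semi_minor e \<le> 1" if "x \<in> {0..l1}" for x
      using that l1 by (auto simp: le_divide_eq divide_le_eq)
    show ?thesis
      unfolding rotation_number_def ell_K_def
    proof (rule continuous_on_divide; (intro continuous_on_mult continuous_on_const continuous_on_ell_F2 ce k1 ballI)?)
      show "continuous_on {0..l1} (\<lambda>x. arcsin (x / semi_minor e))"
        using l1 b by (intro continuous_intros continuous_on_arcsin) auto
      show "2 * ell_F (pi / 2) (caustic_ecc e x) \<noteq> 0" if "x \<in> {0..l1}" for x
        using ell_K_pos[OF k1[OF that]] by (simp add: ell_K_def)
    qed
  qed
  have "rotation_number 0 e = 0" by (simp add: rotation_number_def)
  then have "\<exists>x\<ge>0. x \<le> l1 \<and> rotation_number x e = r"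
    using l1 r by (intro IVT' cont) auto
  then obtain x where x: "0 \<le> x" "x \<le> l1" "rotation_number x e = r" by blast
  then have "x \<noteq> 0" using \<open>rotation_number 0 e = 0\<close> r by auto
  show ?thesis
  proof (rule ex1I[of _ x])
    show "0 < x \<and> x < semi_minor e \<and> rotation_number x e = r" using x l1 \<open>x \<noteq> 0\<close> by auto
    fix z assume z: "0 < z \<and> z < semi_minor e \<and> rotation_number z e = r"
    show "z = x"
      using rotation_number_strict_mono[OF e, of z x] rotation_number_strict_mono[OF e, of x z] z x l1
      by (cases z x rule: linorder_cases) auto
  qed
qed

lemma rational_ecc_props:
  assumes e: "0 < e" "e < 1" and pq: "0 < p" "real p / real q < 1 / 2" "0 < q"
  defines "k \<equiv> rational_ecc p q e" and "\<psi> \<equiv> arcsin (e / rational_ecc p q e)"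
  shows "e \<le> k" "k < 1" "ell_F \<psi> k = (1 - 2 * (real p / real q)) * ell_K k"
proof -
  define r where "r = real p / real q"
  define lam where "lam = caustic_param r e"
  have r: "0 < r" "r < 1 / 2" using pq by (auto simp: r_def)
  have "0 < lam \<and> lam < semi_minor e \<and> rotation_number lam e = r"
    unfolding lam_def caustic_param_def by (rule theI'[OF ex1_caustic_param[OF e r]])
  then have lam: "0 \<le> lam" "lam < semi_minor e" "rotation_number lam e = r" by auto
  have k: "k = caustic_ecc e lam" by (simp add: k_def rational_ecc_def lam_def r_def)
  show "e \<le> k" "k < 1" using caustic_ecc_bounds[OF e lam(1,2)] by (auto simp: k)
  then have "0 < ell_K k" using e by (intro ell_K_pos) auto
  moreover have "r = 1 / 2 - ell_F \<psi> k / (2 * ell_K k)"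
    using rotation_number_alt[OF e lam(1,2)] lam(3) by (simp add: k[symmetric] \<psi>_def k_def[symmetric])
  ultimately show "ell_F \<psi> k = (1 - 2 * (real p / real q)) * ell_K k"
    unfolding r_def[symmetric] by (simp add: field_simps)
qed

text \<open>The equation \<open>F(\<psi>, k) = c' K(k)\<close> with \<open>sin \<psi> = e / k\<close> and \<open>c' = 1 - 2 p / q\<close> is compared with
its limit \<open>\<psi> = c' \<pi> / 2\<close> at \<open>k = 0\<close>. Antitonicity of \<open>F / K\<close> gives \<open>\<psi> \<ge> c' \<pi> / 2\<close>, and
\<open>\<psi> \<le> F(\<psi>, k)\<close> together with the upper bound for \<open>K\<close> gives an estimate in the other direction.\<close>

lemma rational_ecc_bounds:
  assumes e: "0 < e" "e < 1" and pq: "0 < p" "real p / real q < 1 / 2" "0 < q"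
  shows "cos (pi * real p / real q) * rational_ecc p q e \<le> e"
    and "e \<le> rational_ecc p q e * (cos (pi * real p / real q) + pi * (1 / sqrt (1 - (rational_ecc p q e)\<^sup>2) - 1))"
proof -
  define k where "k = rational_ecc p q e"
  define r where "r = real p / real q"
  define \<psi> where "\<psi> = arcsin (e / k)"
  define c where "c = (1 - 2 * r) * (pi / 2)"
  note P = rational_ecc_props[OF e pq, folded k_def, folded \<psi>_def r_def]
  have k: "0 < k" "\<bar>k\<bar> < 1" using P e by auto
  have r: "0 < r" "r < 1 / 2" using pq by (auto simp: r_def)
  have ek: "0 < e / k" "e / k \<le> 1" using P e by auto
  have psi: "0 \<le> \<psi>" "\<psi> \<le> pi / 2" "sin \<psi> = e / k" unfolding \<psi>_def
    by (rule arcsin_unit_interval; use ek in linarith)+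
  have cc: "sin c = cos (pi * r)"
    unfolding c_def by (simp add: sin_cos_eq algebra_simps)
  have cb: "0 \<le> c" "c \<le> pi / 2" using r by (auto simp: c_def mult_left_le_one_le)
  have "1 - 2 * r = ell_F \<psi> k / ell_K k" using P(3) ell_K_pos[OF k(2)] by simp
  also have "\<dots> \<le> ell_F \<psi> 0 / ell_K 0" using k psi by (intro ell_F_div_K_antimono) auto
  also have "ell_F \<psi> 0 = \<psi>" using ell_F_lower[of 0 \<psi>] ell_F_upper[of 0 \<psi> \<psi>] psi by simp
  also have "ell_K 0 = pi / 2" using ell_F_lower[of 0 "pi/2"] ell_F_upper[of 0 "pi/2" "pi/2"] by (simp add: ell_K_def)
  finally have "c \<le> \<psi>" unfolding c_def by (simp add: le_divide_eq)
  then have "sin c \<le> sin \<psi>" using cb psi by (intro sin_monotone_2pi_le) auto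
  then show "cos (pi * real p / real q) * rational_ecc p q e \<le> e"
    using k unfolding psi cc r_def k_def[symmetric] by (simp add: le_divide_eq)
  define d where "d = 1 / sqrt (1 - k\<^sup>2) - 1"
  have ksq: "0 < 1 - k\<^sup>2" using k by (simp add: abs_square_less_1)
  have d: "0 \<le> d" using ksq by (simp add: d_def)
  have "\<psi> \<le> ell_F \<psi> k" by (rule ell_F_lower[OF k(2) psi(1)])
  also have "\<dots> \<le> (1 - 2 * r) * (pi / 2 / sqrt (1 - k\<^sup>2))"
    unfolding P(3) using ell_K_upper[OF k(2)] r by (intro mult_left_mono) auto
  also have "\<dots> = c + c * d" using ksq by (simp add: c_def d_def field_simps)
  also have "\<dots> \<le> c + pi * d" using cb d pi_gt_zero by (intro add_left_mono mult_right_mono) linarith+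
  finally have "\<psi> - c \<le> pi * d" by simp
  moreover have "sin \<psi> - sin c \<le> \<psi> - c"
  proof -
    have "c - sin c \<le> \<psi> - sin \<psi>"
    proof (rule DERIV_nonneg_imp_nondecreasing[OF \<open>c \<le> \<psi>\<close>])
      fix x show "\<exists>y. ((\<lambda>x. x - sin x) has_real_derivative y) (at x) \<and> 0 \<le> y"
        by (rule exI[of _ "1 - cos x"]) (auto intro!: derivative_eq_intros)
    qed
    then show ?thesis by simp
  qed
  ultimately have "e / k \<le> cos (pi * r) + pi * d" unfolding psi cc[symmetric] by simp
  then show "e \<le> rational_ecc p q e * (cos (pi * real p / real q) + pi * (1 / sqrt (1 - (rational_ecc p q e)\<^sup>2) - 1))"
    unfolding k_def[symmetric] r_def d_def[symmetric] using k by (simp add: divide_le_eq mult.commute)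
qed

section \<open>Passage to the elliptic amplitude as integration variable\<close>

text \<open>The inverse of the amplitude function \<open>\<phi>(\<theta>)\<close>, normalised to fix multiples of \<open>\<pi>\<close>.\<close>

definition ell_time :: "real \<Rightarrow> real \<Rightarrow> real" where
  "ell_time k \<phi> = pi / (2 * ell_K k) * ell_F \<phi> k"

lemma DERIV_ell_time:
  assumes "\<bar>k\<bar> < 1"
  shows "(ell_time k has_real_derivative pi / (2 * ell_K k) / ell_Delta k x) (at x)"
  unfolding ell_time_def[abs_def] using DERIV_cmult[OF DERIV_ell_F[OF assms], of "pi / (2 * ell_K k)"] by simp

lemma ell_time_0 [simp]: "ell_time k 0 = 0"
  by (simp add: ell_time_def)

lemma ell_time_add_pi:
  assumes "\<bar>k\<bar> < 1"
  shows "ell_time k (\<phi> + pi) = ell_time k \<phi> + pi"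
  using ell_K_pos[OF assms] by (simp add: ell_time_def ell_F_add_pi[OF assms] distrib_left)

lemma ell_time_2pi:
  assumes "\<bar>k\<bar> < 1"
  shows "ell_time k (2 * pi) = 2 * pi"
  using ell_time_add_pi[OF assms, of pi] ell_time_add_pi[OF assms, of 0] by simp

lemma continuous_on_ell_time:
  assumes "\<bar>k\<bar> < 1"
  shows "continuous_on S (ell_time k)"
  using DERIV_ell_time[OF assms] by (intro DERIV_continuous_on) (auto intro: has_field_derivative_at_within)

text \<open>Substituting \<open>\<theta> = \<theta>(\<phi>)\<close> leaves the integrand
\<open>cos (j \<phi>) cos (q \<theta>(\<phi>)) \<theta>'(\<phi>)\<close>. Its difference from \<open>(j / q) sin (j \<phi>) sin (q \<theta>(\<phi>))\<close> is
the derivative of \<open>cos (j \<phi>) sin (q \<theta>(\<phi>)) / q\<close>, which vanishes at both ends of the period.\<close>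

lemma A_coeff_eq_integral:
  assumes k: "\<bar>rational_ecc p q e\<bar> < 1" and q: "0 < q"
  shows "A_coeff p q j e = real j / real q *
    (1 / pi * integral {0..2 * pi} (\<lambda>\<phi>. sin (real j * \<phi>) * sin (real q * ell_time (rational_ecc p q e) \<phi>)))"
proof -
  define k where "k = rational_ecc p q e"
  define T where "T = ell_time k"
  define g where "g = (\<lambda>x. pi / (2 * ell_K k) / ell_Delta k x)"
  have k1: "\<bar>k\<bar> < 1" using k by (simp add: k_def)
  have dT: "(T has_real_derivative g x) (at x within S)" for x S
    unfolding T_def g_def by (rule has_field_derivative_at_within[OF DERIV_ell_time[OF k1]])
  have cT: "continuous_on S T" for S unfolding T_def by (rule continuous_on_ell_time[OF k1])
  have cg: "continuous_on S g" for S
    unfolding g_def using ell_radicand_pos[OF k1] ell_K_pos[OF k1]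
    by (intro continuous_intros) (auto simp: less_imp_neq[symmetric])
  have inv: "ell_angle p q e (T \<phi>) = \<phi>" for \<phi>
    unfolding ell_angle_def k_def[symmetric]
    by (rule am_eqI[OF k1]) (use ell_K_pos[OF k1] in \<open>simp add: T_def ell_time_def\<close>)
  define f where "f = (\<lambda>\<theta>. cos (real j * ell_angle p q e \<theta>) * cos (real q * \<theta>))"
  have cf: "continuous_on (T ` {0..2 * pi}) f"
  proof -
    have "continuous_on (T ` {0..2 * pi}) (ell_angle p q e)"
      by (rule continuous_on_inv[OF cT]) (auto simp: inv)
    then show ?thesis unfolding f_def by (intro continuous_intros)
  qed
  have "(LBINT \<theta>=ereal 0..ereal (2 * pi). f \<theta>) = (LBINT \<theta>=T 0..T (2 * pi). f \<theta>)"
    by (simp add: T_def ell_time_2pi[OF k1])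
  also have "\<dots> = (LBINT x=ereal 0..ereal (2 * pi). g x *\<^sub>R f (T x))"
    by (rule interval_integral_substitution_finite[symmetric]) (use dT cf cg in auto)
  also have "\<dots> = integral {0..2 * pi} (\<lambda>x. g x *\<^sub>R f (T x))"
  proof (rule interval_integral_eq_integral)
    have "continuous_on {0..2 * pi} (\<lambda>x. g x *\<^sub>R f (T x))"
      by (intro continuous_intros cg continuous_on_compose2[OF cf cT]) auto
    then show "set_integrable lborel {0..2 * pi} (\<lambda>x. g x *\<^sub>R f (T x))"
      by (rule borel_integrable_atLeastAtMost')
  qed simp
  also have "\<dots> = real j / real q * integral {0..2 * pi} (\<lambda>x. sin (real j * x) * sin (real q * T x))"
  proof -
    define h where "h = (\<lambda>x. g x *\<^sub>R f (T x) - real j / real q * (sin (real j * x) * sin (real q * T x)))"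
    have "(h has_integral (cos (real j * (2 * pi)) * sin (real q * T (2 * pi)) / real q
            - cos (real j * 0) * sin (real q * T 0) / real q)) {0..2 * pi}"
    proof (rule fundamental_theorem_of_calculus)
      fix x
      have "((\<lambda>x. cos (real j * x) * sin (real q * T x) / real q) has_real_derivative h x) (at x within {0..2*pi})"
        using q by (auto intro!: derivative_eq_intros dT simp: h_def f_def inv field_simps)
      then show "((\<lambda>x. cos (real j * x) * sin (real q * T x) / real q) has_vector_derivative h x) (at x within {0..2*pi})"
        by (simp add: has_real_derivative_iff_has_vector_derivative)
    qed simp
    moreover have "sin (real q * T (2 * pi)) = 0" "T 0 = 0"
      using sin_npi2[of "2 * q"] unfolding T_def ell_time_2pi[OF k1] by (simp_all add: mult_ac)
    ultimately have "(h has_integral 0) {0..2 * pi}" by simp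
    moreover have "(\<lambda>x. g x *\<^sub>R f (T x)) integrable_on {0..2 * pi}"
      by (intro integrable_continuous_interval continuous_intros cg continuous_on_compose2[OF cf cT]) auto
    moreover have "(\<lambda>x. real j / real q * (sin (real j * x) * sin (real q * T x))) integrable_on {0..2 * pi}"
      by (intro integrable_continuous_interval continuous_intros cT)
    ultimately have "integral {0..2 * pi} (\<lambda>x. g x *\<^sub>R f (T x)) - integral {0..2 * pi} (\<lambda>x. real j / real q * (sin (real j * x) * sin (real q * T x))) = 0"
      by (subst integral_diff[symmetric]) (auto simp: h_def integral_unique)
    then show ?thesis by simp
  qed
  finally show ?thesis
    unfolding A_coeff_def f_def[symmetric] by (simp add: zero_ereal_def T_def k_def)
qed

text \<open>The shift \<open>\<phi> \<mapsto> \<phi> + \<pi>\<close> multiplies the integrand of the preceding lemma by \<open>(- 1) ^ (j + q)\<close>, so the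
two halves of the period cancel.\<close>

lemma A_coeff_odd_parity:
  assumes k: "\<bar>rational_ecc p q e\<bar> < 1" and q: "0 < q" and par: "even j \<longleftrightarrow> odd q"
  shows "A_coeff p q j e = 0"
proof -
  define k where "k = rational_ecc p q e"
  have k1: "\<bar>k\<bar> < 1" using k by (simp add: k_def)
  define h where "h = (\<lambda>\<phi>. sin (real j * \<phi>) * sin (real q * ell_time k \<phi>))"
  have shift_sin: "sin (real n * (x + pi)) = (-1) ^ n * sin (real n * x)" for n x
    by (simp add: distrib_left sin_add)
  have shift: "h (\<phi> + pi) = - h \<phi>" for \<phi>
    using par unfolding h_def ell_time_add_pi[OF k1] shift_sin by (cases "even j") auto
  have int: "h integrable_on S" if "S = {a..b}" for S a b
    unfolding that h_def by (intro integrable_continuous_interval continuous_intros continuous_on_ell_time k1)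
  have "integral {0..2 * pi} h = integral {0..pi} h + integral {pi..2 * pi} h"
    by (rule Henstock_Kurzweil_Integration.integral_combine[symmetric]) (auto intro: int)
  also have "integral {pi..2 * pi} h = integral {0..pi} (\<lambda>x. h (x + pi))"
    using integral_shift_real_ivl[of pi 0 "2 * pi" h] integral_shift_real_ivl[of pi pi "2 * pi" h] by simp
  also have "\<dots> = - integral {0..pi} h" by (simp add: shift)
  finally show ?thesis using A_coeff_eq_integral[OF k q, of j] by (simp add: h_def k_def)
qed

section \<open>Exponentials of power series\<close>

text \<open>The coefficients of the power series of \<open>1 / sqrt (1 - t)\<close>.\<close>

definition half_binom :: "nat \<Rightarrow> real" where
  "half_binom n = pochhammer (1 / 2) n / fact n"

lemma half_binom_0 [simp]: "half_binom 0 = 1"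
  by (simp add: half_binom_def)

lemma half_binom_Suc: "real (Suc n) * half_binom (Suc n) = (real n + 1 / 2) * half_binom n"
  by (simp add: half_binom_def pochhammer_Suc field_simps del: of_nat_Suc)

lemma half_binom_pos: "0 < half_binom n"
  by (simp add: half_binom_def pochhammer_pos)

lemma half_binom_decseq: "decseq half_binom"
proof (rule decseq_SucI)
  fix n
  have "real (Suc n) * half_binom (Suc n) \<le> real (Suc n) * half_binom n"
    unfolding half_binom_Suc using half_binom_pos[of n] by (intro mult_right_mono) auto
  then show "half_binom (Suc n) \<le> half_binom n" by (rule mult_left_le_imp_le) simp
qed

lemma half_binom_le_1: "half_binom n \<le> 1"
  using decseqD[OF half_binom_decseq, of 0 n] by simp

definition half_binom_fps :: "complex fps" where
  "half_binom_fps = Abs_fps (\<lambda>n. of_real (half_binom n))"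

text \<open>The differential equation replaces the binomial theorem: it shows that the square of the series
times \<open>1 - t\<close> has derivative zero.\<close>

lemma half_binom_fps_ode: "(1 - fps_X) * (2 * fps_deriv half_binom_fps) = half_binom_fps"
proof (rule fps_ext)
  fix n
  have *: "of_nat (Suc m) * of_real (half_binom (Suc m)) = (of_nat m + 1 / 2) * (of_real (half_binom m) :: complex)" for m
    using arg_cong[OF half_binom_Suc[of m], of "of_real :: real \<Rightarrow> complex"] by (simp del: of_nat_Suc)
  show "fps_nth ((1 - fps_X) * (2 * fps_deriv half_binom_fps)) n = fps_nth half_binom_fps n"
    by (cases n) (use *[of n] *[of "n - 1"] in \<open>simp_all add: half_binom_fps_def left_diff_distrib fps_X_mult_nth
       fps_mult_numeral_left algebra_simps del: of_nat_Suc\<close>)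
qed

lemma half_binom_fps_sq: "half_binom_fps ^ 2 * (1 - fps_X) = 1"
proof -
  let ?A = half_binom_fps
  have "fps_deriv (?A ^ 2 * (1 - fps_X)) = ?A * ((1 - fps_X) * (2 * fps_deriv ?A)) - ?A ^ 2"
    by (simp add: fps_deriv_power power2_eq_square algebra_simps)
  also have "\<dots> = 0" unfolding half_binom_fps_ode by (simp add: power2_eq_square)
  finally have "?A ^ 2 * (1 - fps_X) = fps_const (fps_nth (?A ^ 2 * (1 - fps_X)) 0)"
    by (simp only: fps_deriv_eq_0_iff)
  also have "fps_nth (?A ^ 2 * (1 - fps_X)) 0 = 1"
    by (simp add: power2_eq_square half_binom_fps_def)
  finally show ?thesis by simp
qed

lemma fps_exp_compose_deriv:
  fixes G :: "complex fps"
  assumes "fps_nth G 0 = 0"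
  shows "fps_deriv (fps_exp s oo G) = fps_const s * (fps_exp s oo G) * fps_deriv G"
  by (simp only: fps_compose_deriv[OF assms] fps_exp_deriv fps_compose_mult_distrib[OF assms] fps_const_compose)

lemma fps_exp_compose_rec:
  fixes G :: "complex fps" and s :: complex
  assumes "fps_nth G 0 = 0"
  defines "f \<equiv> fps_exp s oo G"
  shows "of_nat n * fps_nth f n = s * (\<Sum>i<n. fps_nth f i * (of_nat (n - i) * fps_nth G (n - i)))"
proof (cases n)
  case (Suc m)
  have "of_nat n * fps_nth f n = fps_nth (fps_deriv f) m" by (simp add: Suc)
  also have "\<dots> = s * (\<Sum>i=0..m. fps_nth f i * fps_nth (fps_deriv G) (m - i))"
    unfolding f_def fps_exp_compose_deriv[OF assms(1)]
    by (simp only: mult.assoc fps_mult_left_const_nth fps_mult_nth[of _ "fps_deriv G"])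
  also have "(\<Sum>i=0..m. fps_nth f i * fps_nth (fps_deriv G) (m - i)) =
      (\<Sum>i<n. fps_nth f i * (of_nat (n - i) * fps_nth G (n - i)))"
    by (rule sum.cong) (auto simp: Suc Suc_diff_le)
  finally show ?thesis .
qed simp

text \<open>The hypothesis says that \<open>G\<close> is dominated by \<open>\<Sum>n. t ^ n / n = - log (1 - t)\<close>, so the exponential
is dominated by \<open>(1 - t)\<close> to the power \<open>- q\<close>. In the recurrence this comparison becomes the hockey
stick identity for binomial coefficients.\<close>

lemma fps_exp_compose_norm_le:
  fixes G :: "complex fps"
  assumes G0: "fps_nth G 0 = 0" and G: "\<And>n. norm (of_nat n * fps_nth G n) \<le> 1"
    and s: "norm s \<le> real q" and q: "0 < q"
  shows "norm (fps_nth (fps_exp s oo G) n) \<le> real ((n + q - 1) choose n)"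
proof (induction n rule: less_induct)
  case (less n)
  show ?case
  proof (cases n)
    case 0 then show ?thesis by simp
  next
    case (Suc m)
    let ?f = "fps_exp s oo G"
    have "real n * norm (fps_nth ?f n) = norm (of_nat n * fps_nth ?f n)"
      by (simp add: norm_mult)
    also have "\<dots> = norm s * norm (\<Sum>i<n. fps_nth ?f i * (of_nat (n - i) * fps_nth G (n - i)))"
      unfolding fps_exp_compose_rec[OF G0] by (simp add: norm_mult)
    also have "\<dots> \<le> real q * (\<Sum>i<n. real ((i + q - 1) choose i) * 1)"
    proof (rule mult_mono[OF s])
      show "norm (\<Sum>i<n. fps_nth ?f i * (of_nat (n - i) * fps_nth G (n - i)))
          \<le> (\<Sum>i<n. real ((i + q - 1) choose i) * 1)"
        unfolding norm_mult[of "fps_nth ?f _" "_ * _"]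
        by (rule sum_norm_le, subst norm_mult, rule mult_mono) (use less.IH G in \<open>auto simp del: of_nat_diff\<close>)
    qed auto
    also have "(\<Sum>i<n. real ((i + q - 1) choose i) * 1) = real (\<Sum>i\<le>m. (q - 1 + i) choose i)"
      using q by (simp add: Suc lessThan_Suc_atMost add.commute)
    also have "(\<Sum>i\<le>m. (q - 1 + i) choose i) = Suc (q - 1 + m) choose m"
      by (rule sum_choose_lower)
    also have "Suc (q - 1 + m) choose m = (n + q - 1) choose m" using q by (simp add: Suc add.commute)
    also have "real q * real ((n + q - 1) choose m) = real n * real ((n + q - 1) choose n)"
    proof -
      have "Suc m * (Suc (m + q - 1) choose Suc m) = (Suc (m + q - 1) - m) * (Suc (m + q - 1) choose m)"
        using binomial_absorption[of m "Suc (m + q - 1)"] binomial_absorb_comp[of "Suc (m + q - 1)" m]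
        by (simp only: diff_Suc_1)
      then have "n * ((n + q - 1) choose n) = q * ((n + q - 1) choose m)"
        using q by (simp add: Suc Suc_diff_le)
      then show ?thesis by (metis of_nat_mult)
    qed
    finally show ?thesis using Suc by simp
  qed
qed

lemma fps_exp_compose_norm_le_power:
  fixes G :: "complex fps"
  assumes "fps_nth G 0 = 0" and "\<And>n. norm (of_nat n * fps_nth G n) \<le> 1"
    and "norm s \<le> real q" and "0 < q"
  shows "norm (fps_nth (fps_exp s oo G) n) \<le> 2 ^ (n + q)"
proof -
  have "(n + q - 1) choose n \<le> 2 ^ (n + q - 1)" by (rule binomial_le_pow2)
  also have "\<dots> \<le> 2 ^ (n + q)" by (intro power_increasing) auto
  finally have "real ((n + q - 1) choose n) \<le> 2 ^ (n + q)" by (metis of_nat_le_iff of_nat_numeral of_nat_power)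
  then show ?thesis using fps_exp_compose_norm_le[OF assms, of n] by linarith
qed

lemma fps_conv_radius_ge_of_bound:
  fixes f :: "complex fps"
  assumes "\<And>n. norm (fps_nth f n) \<le> C * R ^ n" "0 < R"
  shows "fps_conv_radius f \<ge> ereal (1 / R)"
  unfolding fps_conv_radius_def
proof (rule conv_radius_geI_ex')
  fix r :: real assume r: "0 < r" "ereal r < ereal (1 / R)"
  have "summable (\<lambda>n. C * (R * r) ^ n)"
    using r assms(2) by (intro summable_mult summable_geometric) (simp add: field_simps)
  then show "summable (\<lambda>n. fps_nth f n * of_real r ^ n)"
  proof (rule summable_comparison_test')
    fix n show "norm (fps_nth f n * of_real r ^ n) \<le> C * (R * r) ^ n"
      using mult_right_mono[OF assms(1)[of n], of "r ^ n"] r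
      by (simp add: norm_mult norm_power power_mult_distrib mult.assoc)
  qed
qed

text \<open>The formal composition also holds for values: by the formal differential equation
\<open>f' = s G' f\<close>, the function \<open>f exp (- s G)\<close> has derivative zero on the disc where the coefficient
bound \<open>2 ^ (n + q)\<close> gives convergence.\<close>

lemma eval_fps_exp_compose:
  fixes G :: "complex fps"
  assumes G0: "fps_nth G 0 = 0" and G: "\<And>n. norm (of_nat n * fps_nth G n) \<le> 1"
    and s: "norm s \<le> real q" and q: "0 < q" and z: "norm z < 1 / 2"
  shows "eval_fps (fps_exp s oo G) z = exp (s * eval_fps G z)"
proof -
  define f where "f = fps_exp s oo G"
  have rf: "ereal (1 / 2) \<le> fps_conv_radius f"
    by (rule fps_conv_radius_ge_of_bound[where C = "2 ^ q"])
       (use fps_exp_compose_norm_le_power[OF G0 G s q] in \<open>auto simp: f_def power_add mult.commute\<close>)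
  have "norm (fps_nth G n) \<le> 1 * 1 ^ n" for n
  proof (cases n)
    case (Suc m)
    have "norm (fps_nth G n) \<le> real n * norm (fps_nth G n)" using Suc by (intro mult_le_cancel_right1[THEN iffD2]) auto
    then show ?thesis using G[of n] by (simp add: norm_mult)
  qed (use G0 in simp)
  then have "ereal (1 / 1) \<le> fps_conv_radius G" by (rule fps_conv_radius_ge_of_bound) simp
  then have rG: "ereal (1 / 2) \<le> fps_conv_radius G" by (rule order_trans[rotated]) simp
  define h where "h = (\<lambda>z. eval_fps f z * exp (- (s * eval_fps G z)))"
  have in_f: "w \<in> eball 0 (fps_conv_radius f)" "w \<in> eball 0 (fps_conv_radius G)" "ereal (norm w) < fps_conv_radius f"
       "ereal (norm w) < fps_conv_radius G" if "norm w < 1 / 2" for w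
    using that less_le_trans[OF _ rf, of "ereal (norm w)"] less_le_trans[OF _ rG, of "ereal (norm w)"] by auto
  have dh: "(h has_field_derivative 0) (at w within S)" if w: "norm w < 1 / 2" for w S
  proof -
    have "eval_fps (fps_deriv f) w = s * eval_fps f w * eval_fps (fps_deriv G) w"
    proof -
      have r1: "ereal (norm w) < fps_conv_radius (fps_deriv G)"
        using in_f[OF w] fps_conv_radius_deriv[of G] by (auto intro: less_le_trans)
      have r2: "ereal (norm w) < fps_conv_radius (f * fps_deriv G)"
        using r1 in_f(3)[OF w] by (intro less_le_trans[OF _ fps_conv_radius_mult]) simp
      have "fps_deriv f = fps_const s * (f * fps_deriv G)"
        unfolding f_def fps_exp_compose_deriv[OF G0] by (rule mult.assoc)
      then show ?thesis using r1 r2 in_f(3)[OF w] by (simp add: eval_fps_mult)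
    qed
    then show ?thesis
      unfolding h_def by (auto intro!: derivative_eq_intros has_field_derivative_eval_fps in_f w simp: algebra_simps)
  qed
  have "\<exists>c. \<forall>x\<in>ball 0 (1 / 2). h x = c"
    by (rule has_field_derivative_zero_constant) (auto intro: dh)
  then have "h z = h 0" using z by auto
  also have "h 0 = 1" using G0 by (simp add: h_def eval_fps_at_0 f_def)
  finally show ?thesis unfolding h_def f_def[symmetric] by (simp add: exp_minus field_simps)
qed

section \<open>The phase series and its leading coefficients\<close>

text \<open>Up to the factor \<open>(- \<rho>) ^ n\<close>, these are the Fourier coefficients of
\<open>1 / \<bar>1 + \<rho> w\<bar>\<close> on the unit circle, that is, of the elliptic integrand.\<close>

definition half_lag :: "real \<Rightarrow> nat \<Rightarrow> real" where
  "half_lag \<rho> n = (\<Sum>m. half_binom (m + n) * half_binom m * (\<rho>\<^sup>2) ^ m)"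

text \<open>The series \<open>G\<close> with \<open>2 i (\<theta> - \<phi>) = G(- \<rho> w) - G(- \<rho> / w)\<close>. Keeping the powers of \<open>- \<rho>\<close> in the
argument leaves coefficients that are bounded and continuous at \<open>\<rho> = 0\<close>. The constant term is zero
because of the division by \<open>real 0\<close>.\<close>

definition lag_fps :: "real \<Rightarrow> complex fps" where
  "lag_fps \<rho> = Abs_fps (\<lambda>n. of_real (half_lag \<rho> n / (half_lag \<rho> 0 * real n)))"

lemma half_lag_term_le: "half_binom (m + n) * half_binom m * (\<rho>\<^sup>2) ^ m \<le> (\<rho>\<^sup>2) ^ m"
proof -
  have "half_binom (m + n) * half_binom m \<le> 1"
    using mult_mono[OF half_binom_le_1[of "m + n"] half_binom_le_1[of m]] half_binom_pos[of m] by simp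
  then show ?thesis by (simp add: mult_left_le_one_le half_binom_pos less_imp_le)
qed

lemma summable_half_lag:
  assumes "\<bar>\<rho>\<bar> < 1"
  shows "summable (\<lambda>m. half_binom (m + n) * half_binom m * (\<rho>\<^sup>2) ^ m)"
proof (rule summable_comparison_test')
  show "summable (\<lambda>m. (\<rho>\<^sup>2) ^ m)"
    using assms by (intro summable_geometric) (simp add: abs_square_less_1)
  show "norm (half_binom (m + n) * half_binom m * (\<rho>\<^sup>2) ^ m) \<le> (\<rho>\<^sup>2) ^ m" for m
    using half_lag_term_le[of m n \<rho>] half_binom_pos[of m] half_binom_pos[of "m + n"] by (simp add: abs_mult)
qed

lemma half_lag_nonneg: "\<bar>\<rho>\<bar> < 1 \<Longrightarrow> 0 \<le> half_lag \<rho> n"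
  unfolding half_lag_def using half_binom_pos
  by (intro suminf_nonneg summable_half_lag) (auto simp: less_imp_le)

lemma half_lag_le_0: "\<bar>\<rho>\<bar> < 1 \<Longrightarrow> half_lag \<rho> n \<le> half_lag \<rho> 0"
  unfolding half_lag_def using half_binom_pos
  by (intro suminf_le summable_half_lag mult_right_mono)
     (auto simp: less_imp_le intro!: decseqD[OF half_binom_decseq])

lemma half_lag_near:
  assumes "\<bar>\<rho>\<bar> \<le> 1 / 2"
  shows "\<bar>half_lag \<rho> n - half_binom n\<bar> \<le> 2 * \<rho>\<^sup>2"
proof -
  have r: "\<bar>\<rho>\<bar> < 1" using assms by simp
  have r2: "\<rho>\<^sup>2 \<le> 1 / 2"
    using power_mono[OF assms, of 2] by (simp add: power2_eq_square)
  have "half_lag \<rho> n = half_binom n + (\<Sum>m. half_binom (Suc m + n) * half_binom (Suc m) * (\<rho>\<^sup>2) ^ Suc m)"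
    unfolding half_lag_def using suminf_split_head[OF summable_half_lag[OF r, of n]] by simp
  moreover have "0 \<le> (\<Sum>m. half_binom (Suc m + n) * half_binom (Suc m) * (\<rho>\<^sup>2) ^ Suc m)"
    using half_binom_pos by (intro suminf_nonneg) (auto simp: less_imp_le summable_Suc_iff[of "\<lambda>m. half_binom (m + n) * half_binom m * (\<rho>\<^sup>2) ^ m"]
       intro: summable_half_lag[OF r] simp del: power_Suc add_Suc)
  moreover have "(\<Sum>m. half_binom (Suc m + n) * half_binom (Suc m) * (\<rho>\<^sup>2) ^ Suc m) \<le> (\<Sum>m. \<rho>\<^sup>2 * (\<rho>\<^sup>2) ^ m)"
  proof (rule suminf_le)
    show "half_binom (Suc m + n) * half_binom (Suc m) * (\<rho>\<^sup>2) ^ Suc m \<le> \<rho>\<^sup>2 * (\<rho>\<^sup>2) ^ m" for m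
      using half_lag_term_le[of "Suc m" n \<rho>] by simp
    show "summable (\<lambda>m. half_binom (Suc m + n) * half_binom (Suc m) * (\<rho>\<^sup>2) ^ Suc m)"
      using summable_half_lag[OF r, of n] by (subst summable_Suc_iff[of "\<lambda>m. half_binom (m + n) * half_binom m * (\<rho>\<^sup>2) ^ m"])
    show "summable (\<lambda>m. \<rho>\<^sup>2 * (\<rho>\<^sup>2) ^ m)" using r by (intro summable_mult summable_geometric) (simp add: abs_square_less_1)
  qed
  moreover have "(\<Sum>m. \<rho>\<^sup>2 * (\<rho>\<^sup>2) ^ m) = \<rho>\<^sup>2 / (1 - \<rho>\<^sup>2)"
    using r by (subst suminf_mult, intro summable_geometric)
      (auto simp: abs_square_less_1 suminf_geometric field_simps)
  moreover have "\<rho>\<^sup>2 / (1 - \<rho>\<^sup>2) \<le> 2 * \<rho>\<^sup>2"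
    using r2 mult_left_mono[OF r2, of "\<rho>\<^sup>2"] by (simp add: divide_le_eq algebra_simps)
  ultimately show ?thesis by linarith
qed

lemma half_lag_0_ge_1:
  assumes "\<bar>\<rho>\<bar> < 1"
  shows "1 \<le> half_lag \<rho> 0"
  using sum_le_suminf[OF summable_half_lag[OF assms, of 0], of "{0}"] half_binom_pos
  by (auto simp: half_lag_def less_imp_le)

lemma lag_fps_nth_0 [simp]: "fps_nth (lag_fps \<rho>) 0 = 0"
  by (simp add: lag_fps_def)

lemma lag_fps_nth: "0 < n \<Longrightarrow> of_nat n * fps_nth (lag_fps \<rho>) n = of_real (half_lag \<rho> n / half_lag \<rho> 0)"
  by (simp add: lag_fps_def)

lemma lag_fps_norm_le:
  assumes "\<bar>\<rho>\<bar> < 1"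
  shows "norm (of_nat n * fps_nth (lag_fps \<rho>) n) \<le> 1"
proof (cases "n = 0")
  case False
  have "norm (of_nat n * fps_nth (lag_fps \<rho>) n) = \<bar>half_lag \<rho> n / half_lag \<rho> 0\<bar>"
    using False by (simp only: lag_fps_nth norm_of_real)
  also have "\<dots> \<le> 1"
    using half_lag_nonneg[OF assms, of n] half_lag_le_0[OF assms, of n] half_lag_0_ge_1[OF assms] by simp
  finally show ?thesis .
qed simp

lemma half_lag_zero: "half_lag 0 n = half_binom n"
  using half_lag_near[of 0 n] by simp

lemma lag_fps_near:
  assumes "\<bar>\<rho>\<bar> \<le> 1 / 2"
  shows "norm (of_nat n * fps_nth (lag_fps \<rho>) n - of_nat n * fps_nth (lag_fps 0) n) \<le> 2 * \<bar>\<rho>\<bar>"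
proof (cases "n = 0")
  case False
  have r: "\<bar>\<rho>\<bar> < 1" using assms by simp
  define d where "d = half_lag \<rho> 0"
  have d: "1 \<le> d" "\<bar>d - 1\<bar> \<le> 2 * \<rho>\<^sup>2"
    using half_lag_0_ge_1[OF r] half_lag_near[OF assms, of 0] by (auto simp: d_def)
  have "\<bar>half_binom n * (d - 1)\<bar> \<le> 1 * (2 * \<rho>\<^sup>2)"
    unfolding abs_mult using d half_binom_le_1[of n] half_binom_pos[of n] by (intro mult_mono) auto
  then have "\<bar>half_lag \<rho> n - half_binom n * d\<bar> \<le> 4 * \<rho>\<^sup>2"
    using half_lag_near[OF assms, of n] by (simp add: algebra_simps)
  moreover have "4 * \<rho>\<^sup>2 \<le> 2 * \<bar>\<rho>\<bar>"
    using mult_left_mono[OF assms, of "\<bar>\<rho>\<bar>"] by (simp add: power2_eq_square abs_mult_self_eq)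
  moreover have "2 * \<bar>\<rho>\<bar> \<le> 2 * \<bar>\<rho>\<bar> * d" using d(1) by (simp add: mult_le_cancel_left1)
  ultimately have "\<bar>half_lag \<rho> n - half_binom n * d\<bar> / d \<le> 2 * \<bar>\<rho>\<bar>"
    using d(1) by (simp add: divide_le_eq)
  moreover have "\<bar>half_lag \<rho> n - half_binom n * d\<bar> / d = \<bar>half_lag \<rho> n / d - half_binom n\<bar>"
    using d(1) by (simp add: diff_divide_distrib[symmetric] abs_divide[symmetric] divide_diff_eq_iff)
  moreover have "norm (of_nat n * fps_nth (lag_fps \<rho>) n - of_nat n * fps_nth (lag_fps 0) n)
      = \<bar>half_lag \<rho> n / d - half_binom n\<bar>"
    using False by (simp only: lag_fps_nth of_real_diff[symmetric] norm_of_real half_lag_zero d_def)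
       (simp add: half_lag_zero)
  ultimately show ?thesis by simp
qed simp

text \<open>By the recurrence for exponentials, the \<open>n\<close>-th coefficient is a fixed polynomial in the first \<open>n\<close>
coefficients of \<open>G\<close>, which are Lipschitz at \<open>\<rho> = 0\<close>; the constant is allowed to depend on \<open>n\<close>.\<close>

lemma fps_exp_lag_near:
  fixes s :: complex
  assumes s: "norm s \<le> real q" "0 < q"
  shows "\<exists>K\<ge>0. \<forall>\<rho>. \<bar>\<rho>\<bar> \<le> 1 / 2 \<longrightarrow>
    norm (fps_nth (fps_exp s oo lag_fps \<rho>) n - fps_nth (fps_exp s oo lag_fps 0) n) \<le> K * \<bar>\<rho>\<bar>"
proof (induction n rule: less_induct)
  case (less n)
  let ?f = "\<lambda>\<rho>. fps_nth (fps_exp s oo lag_fps \<rho>)"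
  let ?g = "\<lambda>\<rho> n. of_nat n * fps_nth (lag_fps \<rho>) n"
  have "\<forall>i. \<exists>K. i < n \<longrightarrow> 0 \<le> K \<and> (\<forall>\<rho>. \<bar>\<rho>\<bar> \<le> 1 / 2 \<longrightarrow> norm (?f \<rho> i - ?f 0 i) \<le> K * \<bar>\<rho>\<bar>)"
    using less by blast
  then obtain K where K': "\<forall>i. i < n \<longrightarrow> 0 \<le> K i \<and> (\<forall>\<rho>. \<bar>\<rho>\<bar> \<le> 1 / 2 \<longrightarrow> norm (?f \<rho> i - ?f 0 i) \<le> K i * \<bar>\<rho>\<bar>)"
    by (rule choice[THEN exE])
  have K: "0 \<le> K i" "\<bar>\<rho>\<bar> \<le> 1 / 2 \<Longrightarrow> norm (?f \<rho> i - ?f 0 i) \<le> K i * \<bar>\<rho>\<bar>" if "i < n" for i \<rho>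
    using K' that by blast+
  show ?case
  proof (cases "n = 0")
    case False
    define L where "L = real q * (\<Sum>i<n. K i + 2 ^ (i + q) * 2)"
    have "norm (?f \<rho> n - ?f 0 n) \<le> L * \<bar>\<rho>\<bar>" if r: "\<bar>\<rho>\<bar> \<le> 1 / 2" for \<rho>
    proof -
      have r1: "\<bar>\<rho>\<bar> < 1" "\<bar>0\<bar> < (1::real)" using r by auto
      have "of_nat n * (?f \<rho> n - ?f 0 n) =
          s * (\<Sum>i<n. (?f \<rho> i - ?f 0 i) * ?g \<rho> (n - i) + ?f 0 i * (?g \<rho> (n - i) - ?g 0 (n - i)))"
        unfolding right_diff_distrib[of "of_nat n"] fps_exp_compose_rec[OF lag_fps_nth_0]
          right_diff_distrib[of s, symmetric] sum_subtractf[symmetric]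
        by (intro arg_cong[where f = "(*) s"] sum.cong refl) (simp only: left_diff_distrib right_diff_distrib, simp)
      then have "real n * norm (?f \<rho> n - ?f 0 n) =
          norm s * norm (\<Sum>i<n. (?f \<rho> i - ?f 0 i) * ?g \<rho> (n - i) + ?f 0 i * (?g \<rho> (n - i) - ?g 0 (n - i)))"
        by (drule_tac arg_cong[where f = norm]) (simp only: norm_mult norm_of_nat)
      also have "\<dots> \<le> real q * (\<Sum>i<n. K i * \<bar>\<rho>\<bar> * 1 + 2 ^ (i + q) * (2 * \<bar>\<rho>\<bar>))"
      proof (rule mult_mono[OF s(1)])
        show "norm (\<Sum>i<n. (?f \<rho> i - ?f 0 i) * ?g \<rho> (n - i) + ?f 0 i * (?g \<rho> (n - i) - ?g 0 (n - i)))
             \<le> (\<Sum>i<n. K i * \<bar>\<rho>\<bar> * 1 + 2 ^ (i + q) * (2 * \<bar>\<rho>\<bar>))"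
        proof (rule sum_norm_le)
          fix i assume i: "i \<in> {..<n}"
          have a: "norm ((?f \<rho> i - ?f 0 i) * ?g \<rho> (n - i)) \<le> K i * \<bar>\<rho>\<bar> * 1"
            unfolding norm_mult[of "_ - _"] using i K r lag_fps_norm_le[OF r1(1), of "n - i"] by (intro mult_mono) auto
          have b: "norm (?f 0 i * (?g \<rho> (n - i) - ?g 0 (n - i))) \<le> 2 ^ (i + q) * (2 * \<bar>\<rho>\<bar>)"
            unfolding norm_mult[of "?f 0 i"]
            using fps_exp_compose_norm_le_power[OF lag_fps_nth_0 lag_fps_norm_le[OF r1(2)] s, of i]
              lag_fps_near[OF r, of "n - i"] by (intro mult_mono) auto
          show "norm ((?f \<rho> i - ?f 0 i) * ?g \<rho> (n - i) + ?f 0 i * (?g \<rho> (n - i) - ?g 0 (n - i)))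
            \<le> K i * \<bar>\<rho>\<bar> * 1 + 2 ^ (i + q) * (2 * \<bar>\<rho>\<bar>)"
            by (rule order_trans[OF norm_triangle_ineq add_mono[OF a b]])
        qed
      qed auto
      also have "\<dots> = L * \<bar>\<rho>\<bar>"
        unfolding L_def mult.assoc[of "real q"] sum_distrib_right
        by (intro arg_cong[where f = "(*) (real q)"] sum.cong refl) (simp add: distrib_right)
      finally have "real n * norm (?f \<rho> n - ?f 0 n) \<le> L * \<bar>\<rho>\<bar>" .
      moreover have "1 * norm (?f \<rho> n - ?f 0 n) \<le> real n * norm (?f \<rho> n - ?f 0 n)"
        using False by (intro mult_right_mono) auto
      ultimately show ?thesis by linarith
    qed
    moreover have "0 \<le> L" unfolding L_def using K(1) by (intro mult_nonneg_nonneg sum_nonneg) auto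
    ultimately show ?thesis by blast
  qed (auto intro!: exI[of _ 0])
qed

text \<open>Let \<open>A\<close> be the series of \<open>1 / sqrt (1 - t)\<close> and \<open>D = t d/dt\<close>. For \<open>\<rho> = 0\<close> one has
\<open>D G = A - 1\<close>, hence \<open>(2 D + s) f = s f A\<close>. Applying \<open>2 D + s\<close> once more and eliminating \<open>A\<close>
with \<open>A\<^sup>2 (1 - t) = 1\<close> leaves \<open>(1 - t) (2 D + s)\<^sup>2 f = s\<^sup>2 f + t (2 D + s) f\<close>, whose
coefficients are the claim.\<close>

lemma fps_exp_lag_0_rec:
  fixes s :: complex
  defines "f \<equiv> fps_exp (s / 2) oo lag_fps 0"
  shows "4 * of_nat (Suc n) * (of_nat (Suc n) + s) * fps_nth f (Suc n) =
    (2 * of_nat n + s) * (2 * of_nat n + s + 1) * fps_nth f n"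
proof -
  let ?A = half_binom_fps and ?X = "fps_X :: complex fps"
  define c where "c = fps_const s"
  define D where "D = (\<lambda>u::complex fps. ?X * fps_deriv u)"
  have G: "D (lag_fps 0) = ?A - 1"
    by (rule fps_ext)
       (simp add: D_def half_binom_fps_def lag_fps_nth half_lag_zero fps_mult_numeral_left del: of_nat_Suc)
  have "2 * fps_deriv f = c * f * fps_deriv (lag_fps 0)"
  proof -
    have "2 * fps_const (s / 2) = c"
      by (simp add: c_def numeral_fps_const)
    then show ?thesis
      unfolding f_def fps_exp_compose_deriv[OF lag_fps_nth_0]
      by (simp only: mult.assoc[symmetric])
  qed
  then have "2 * D f = c * f * D (lag_fps 0)"
    unfolding D_def by (metis mult.assoc mult.left_commute)
  then have f2: "2 * D f + c * f = c * f * ?A"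
    unfolding G by (simp add: algebra_simps)
  define g where "g = c * f * ?A"
  have Dg: "(1 - ?X) * (2 * D g + c * g) = c * c * f + ?X * g"
  proof -
    have "D g = c * (D f * ?A + f * D ?A)"
      unfolding g_def D_def c_def by (simp add: algebra_simps)
    then have "(1 - ?X) * (2 * D g + c * g) = c * (1 - ?X) * ((2 * D f + c * f) * ?A) + c * f * (?X * ((1 - ?X) * (2 * fps_deriv ?A)))"
      unfolding g_def D_def by (simp add: algebra_simps)
    also have "\<dots> = c * c * f * (?A ^ 2 * (1 - ?X)) + ?X * g"
      unfolding f2 half_binom_fps_ode g_def by (simp add: algebra_simps power2_eq_square)
    finally show ?thesis by (simp add: half_binom_fps_sq)
  qed
  have gn: "fps_nth g m = (2 * of_nat m + s) * fps_nth f m" for m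
  proof -
    have "fps_nth (D f) m = of_nat m * fps_nth f m" by (cases m) (auto simp: D_def)
    then show ?thesis
      unfolding g_def f2[symmetric] by (simp add: c_def fps_mult_numeral_left) (simp add: algebra_simps)
  qed
  have Dgn: "fps_nth (2 * D g + c * g) m = (2 * of_nat m + s) * fps_nth g m" for m
  proof -
    have "fps_nth (D g) m = of_nat m * fps_nth g m" by (cases m) (auto simp: D_def)
    then show ?thesis by (simp add: c_def fps_mult_numeral_left) (simp add: algebra_simps)
  qed
  have "fps_nth ((1 - ?X) * (2 * D g + c * g)) (Suc n) = fps_nth (c * c * f + ?X * g) (Suc n)"
    by (simp only: Dg)
  then have "(2 * of_nat (Suc n) + s) * fps_nth g (Suc n) - (2 * of_nat n + s) * fps_nth g n
      = s * s * fps_nth f (Suc n) + fps_nth g n"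
    unfolding left_diff_distrib mult_1_left fps_sub_nth Dgn fps_X_mult_nth
    by (simp add: c_def mult.assoc Dgn[unfolded fps_add_nth] del: of_nat_Suc)
  then show ?thesis unfolding gn by (simp add: algebra_simps)
qed

text \<open>The solution of the recurrence is \<open>q (q + 2 n - 1)! / (n! (q + n)! 4 ^ n)\<close>, the coefficient of a power
of the generating function of the Catalan numbers.\<close>

lemma fps_exp_lag_0_pos:
  assumes q: "0 < q"
  shows "of_nat (q + 2 * n) * fps_nth (fps_exp (of_nat q / 2) oo lag_fps 0) n * 4 ^ n =
     (of_nat q * of_nat ((q + 2 * n) choose n) :: complex)"
proof -
  let ?f = "fps_nth (fps_exp (of_nat q / 2) oo lag_fps 0)"
  have "?f n * 4 ^ n * (fact n * fact (n + q)) = of_nat q * fact (2 * n + q - 1)"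
  proof (induction n)
    case 0
    then show ?case using q by (simp add: fact_reduce)
  next
    case (Suc n)
    have "?f (Suc n) * 4 ^ Suc n * (fact (Suc n) * fact (Suc n + q)) =
       (4 * of_nat (Suc n) * (of_nat (Suc n) + of_nat q) * ?f (Suc n)) * (4 ^ n * (fact n * fact (n + q)))"
      by (simp add: algebra_simps)
    also have "\<dots> = (2 * of_nat n + of_nat q) * (2 * of_nat n + of_nat q + 1) * (?f n * 4 ^ n * (fact n * fact (n + q)))"
      unfolding fps_exp_lag_0_rec by (simp only: mult_ac)
    also have "\<dots> = of_nat q * ((2 * of_nat n + of_nat q + 1) * ((2 * of_nat n + of_nat q) * fact (2 * n + q - 1)))"
      unfolding Suc.IH by (simp only: mult_ac)
    also have "(2 * of_nat n + of_nat q) * fact (2 * n + q - 1) = (fact (2 * n + q) :: complex)"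
      using q by (subst (2) fact_reduce) auto
    also have "(2 * of_nat n + of_nat q + 1) * fact (2 * n + q) = (fact (2 * Suc n + q - 1) :: complex)"
      by (simp add: algebra_simps)
    finally show ?case .
  qed
  then have "of_nat (q + 2 * n) * ?f n * 4 ^ n * (fact n * fact (n + q)) = of_nat q * (of_nat (2 * n + q) * fact (2 * n + q - 1))"
    by (simp add: mult_ac add.commute)
  also have "of_nat (2 * n + q) * fact (2 * n + q - 1) = (fact (q + 2 * n) :: complex)"
    using q by (subst (2) fact_reduce) (auto simp: add.commute)
  also have "of_nat q * fact (q + 2 * n) = of_nat q * of_nat ((q + 2 * n) choose n) * (fact n * fact (n + q) :: complex)"
    by (simp add: binomial_fact add.commute)
  finally show ?thesis by (rule mult_right_cancel[THEN iffD1, rotated]) simp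
qed

text \<open>For the negative exponent the recurrence degenerates when its index reaches \<open>q\<close>. Here
\<open>q = j + 2 n\<close> with \<open>j > 0\<close>, so the index stays below \<open>q / 2\<close> and the factor to be divided by is
nonzero.\<close>

lemma fps_exp_lag_0_neg:
  assumes j: "0 < j"
  shows "of_nat j * fps_nth (fps_exp (- of_nat (j + 2 * n) / 2) oo lag_fps 0) n * 4 ^ n =
     ((- 1) ^ n * of_nat (j + 2 * n) * of_nat ((j + n - 1) choose n) :: complex)"
proof -
  define q where "q = j + 2 * n"
  let ?f = "fps_nth (fps_exp (- of_nat q / 2) oo lag_fps 0)"
  have main: "?f m * 4 ^ m * (fact m * fact (q - 2 * m)) = (- 1) ^ m * of_nat q * fact (q - m - 1)" if "2 * m < q" for m
    using that
  proof (induction m)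
    case 0
    then show ?case by (simp add: fact_reduce)
  next
    case (Suc m)
    \<comment> \<open>Writing \<open>q = r + 2 m + 2\<close> turns the truncated differences in the factorials into sums.\<close>
    define r where "r = q - 2 * m - 2"
    have r: "q = r + 2 * m + 2" "0 < r" using Suc.prems by (auto simp: r_def)
    have IH: "?f m * 4 ^ m * (fact m * fact (r + 2)) = (- 1) ^ m * of_nat q * fact (r + m + 1)"
    proof -
      have "2 * m < q" "q - 2 * m = r + 2" "q - m - 1 = r + m + 1" using r by auto
      then show ?thesis using Suc.IH by (simp only:)
    qed
    have "?f (Suc m) * 4 ^ Suc m * (fact (Suc m) * fact r) * (of_nat (Suc m) + (- of_nat q)) =
       (4 * of_nat (Suc m) * (of_nat (Suc m) + (- of_nat q)) * ?f (Suc m)) * (4 ^ m * (fact m * fact r))"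
      by (simp add: algebra_simps)
    also have "\<dots> = ((2 * of_nat m + (- of_nat q)) * (2 * of_nat m + (- of_nat q) + 1) * fact r) * (?f m * 4 ^ m * fact m)"
      unfolding fps_exp_lag_0_rec by (simp only: mult_ac)
    also have "(2 * of_nat m + (- of_nat q)) * (2 * of_nat m + (- of_nat q) + 1) * fact r = (fact (r + 2) :: complex)"
      unfolding r(1) by (simp add: algebra_simps)
    also have "fact (r + 2) * (?f m * 4 ^ m * fact m) = (- 1) ^ m * of_nat q * fact (r + m + 1)"
      using IH by (simp only: mult_ac)
    also have "\<dots> = (- 1) ^ Suc m * of_nat q * fact (r + m) * (of_nat (Suc m) + (- of_nat q))"
      unfolding r(1) by (simp add: algebra_simps)
    finally have "?f (Suc m) * 4 ^ Suc m * (fact (Suc m) * fact r) * (of_nat (Suc m) + (- of_nat q)) =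
      (- 1) ^ Suc m * of_nat q * fact (r + m) * (of_nat (Suc m) + (- of_nat q))" .
    moreover have "of_nat (Suc m) + (- of_nat q) \<noteq> (0 :: complex)"
    proof -
      have "of_nat (Suc m) + (- of_nat q) = (- of_nat (r + m + 1) :: complex)" unfolding r(1) by simp
      then show ?thesis by (simp del: of_nat_add of_nat_Suc)
    qed
    ultimately have "?f (Suc m) * 4 ^ Suc m * (fact (Suc m) * fact r) = (- 1) ^ Suc m * of_nat q * fact (r + m)"
      by (rule mult_right_cancel[THEN iffD1, rotated])
    moreover have "q - 2 * Suc m = r" "q - Suc m - 1 = r + m" using r by auto
    ultimately show ?case by (simp only:)
  qed
  have "?f n * 4 ^ n * (fact n * fact j) = (- 1) ^ n * of_nat q * fact (j + n - 1)"
  proof -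
    have "2 * n < q" "q - 2 * n = j" "q - n - 1 = j + n - 1" using j by (auto simp: q_def)
    then show ?thesis using main[of n] by (simp only:)
  qed
  moreover have "fact j = (of_nat j * fact (j - 1) :: complex)" using j by (simp add: fact_reduce)
  moreover have "(fact (j + n - 1) :: complex) = of_nat ((j + n - 1) choose n) * (fact n * fact (j - 1))"
    using j by (subst binomial_fact) auto
  ultimately have "of_nat j * ?f n * 4 ^ n * (fact n * fact (j - 1)) =
     (- 1) ^ n * of_nat q * of_nat ((j + n - 1) choose n) * (fact n * fact (j - 1))"
    by (simp only: mult_ac)
  then have "of_nat j * ?f n * 4 ^ n = (- 1) ^ n * of_nat q * of_nat ((j + n - 1) choose n)"
    by (rule mult_right_cancel[THEN iffD1, rotated]) simp
  then show ?thesis by (simp only: q_def)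
qed

section \<open>Products of absolutely convergent series on the circle\<close>

lemma has_vector_derivative_cis_mult:
  "((\<lambda>x. cis (c * x)) has_vector_derivative \<i> * of_real c * cis (c * x)) (at x within S)"
proof -
  have "(\<lambda>x. cis (c * x)) = (\<lambda>x. exp (x *\<^sub>R (\<i> * of_real c)))"
    by (simp add: cis_conv_exp scaleR_conv_of_real mult_ac)
  then show ?thesis
    using exp_scaleR_has_vector_derivative_right[of "\<i> * of_real c" x S]
    by (simp add: cis_conv_exp scaleR_conv_of_real mult_ac)
qed

lemma has_integral_cis_int:
  "((\<lambda>x. cis (of_int l * x)) has_integral (if l = 0 then 2 * of_real pi else 0)) {0..2 * pi}"
proof (cases "l = 0")
  case True
  then show ?thesis using has_integral_const_real[of "1::complex" 0 "2 * pi"]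
    by (simp add: scaleR_conv_of_real)
next
  case False
  let ?F = "\<lambda>x. cis (of_int l * x) / (\<i> * of_int l)"
  have "((\<lambda>x. cis (of_int l * x)) has_integral (?F (2 * pi) - ?F 0)) {0..2 * pi}"
  proof (rule fundamental_theorem_of_calculus)
    fix x
    show "(?F has_vector_derivative cis (of_int l * x)) (at x within {0..2 * pi})"
      using has_vector_derivative_divide[OF has_vector_derivative_cis_mult[of "of_int l" x "{0..2 * pi}"], of "\<i> * of_int l"] False
      by simp
  qed simp
  moreover have "cis (of_int l * (2 * pi)) = 1"
    using cis_multiple_2pi[of "of_int l"] by (simp add: mult_ac)
  ultimately show ?thesis using False by simp
qed

lemma summable_on_product_nonneg:
  fixes x y :: "nat \<Rightarrow> real"
  assumes "summable x" "summable y" "\<And>n. 0 \<le> x n" "\<And>n. 0 \<le> y n"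
  shows "(\<lambda>(m, n). x m * y n) summable_on UNIV \<times> UNIV"
proof (rule summable_on_SigmaI)
  have "(y has_sum suminf y) UNIV" using assms by (intro sums_nonneg_imp_has_sum summable_sums)
  then show "((\<lambda>n. case (m, n) of (m, n) \<Rightarrow> x m * y n) has_sum x m * suminf y) UNIV" for m
    by (simp add: has_sum_cmult_right)
  have "(x has_sum suminf x) UNIV" using assms by (intro sums_nonneg_imp_has_sum summable_sums)
  then show "(\<lambda>m. x m * suminf y) summable_on UNIV"
    by (intro summable_on_cmult_left) (auto simp: summable_on_def)
qed (use assms in auto)

lemma has_sum_product:
  fixes P Q :: "nat \<Rightarrow> complex"
  assumes "summable (\<lambda>n. norm (P n))" "summable (\<lambda>n. norm (Q n))"
  shows "((\<lambda>(m, n). P m * Q n) has_sum suminf P * suminf Q) (UNIV \<times> UNIV)"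
proof (rule has_sum_SigmaI)
  have Q: "(Q has_sum suminf Q) UNIV"
    by (intro norm_summable_imp_has_sum assms summable_sums summable_norm_cancel[OF assms(2)])
  show "((\<lambda>n. case (m, n) of (m, n) \<Rightarrow> P m * Q n) has_sum P m * suminf Q) UNIV" for m
    using Q by (simp add: has_sum_cmult_right)
  have "(P has_sum suminf P) UNIV"
    by (intro norm_summable_imp_has_sum assms summable_sums summable_norm_cancel[OF assms(1)])
  then show "((\<lambda>m. P m * suminf Q) has_sum suminf P * suminf Q) UNIV"
    by (rule has_sum_cmult_left)
  have "(\<lambda>x. norm ((\<lambda>(m, n). P m * Q n) x)) summable_on UNIV \<times> UNIV"
    using summable_on_product_nonneg[OF assms] by (simp add: case_prod_unfold norm_mult)
  then show "(\<lambda>(m, n). P m * Q n) summable_on UNIV \<times> UNIV"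
    by (rule abs_summable_summable)
qed

lemma summable_shifted_product:
  fixes P Q :: "nat \<Rightarrow> complex"
  assumes "summable (\<lambda>n. norm (P n))" "summable (\<lambda>n. norm (Q n))"
  shows "summable (\<lambda>n. norm (P (n + k) * Q n))"
proof -
  have "bounded (range P)"
    using summable_LIMSEQ_zero[OF summable_norm_cancel[OF assms(1)]] convergent_imp_bounded by blast
  then obtain M where M: "norm (P n) \<le> M" for n unfolding bounded_iff by auto
  show ?thesis
  proof (rule summable_comparison_test')
    show "summable (\<lambda>n. M * norm (Q n))" by (intro summable_mult assms)
    show "norm (norm (P (n + k) * Q n)) \<le> M * norm (Q n)" for n
      using M by (simp add: norm_mult mult_right_mono)
  qed
qed

text \<open>The pairs of exponents \<open>(m, n)\<close> are sorted by \<open>m - n\<close>: the images of \<open>h1\<close> and \<open>h2\<close> are the pairs with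
\<open>m \<ge> n\<close> and \<open>m < n\<close>, and absolute summability permits the rearrangement.\<close>

lemma circle_product_expansion:
  fixes b :: "nat \<Rightarrow> complex" and w v :: complex
  assumes b: "summable (\<lambda>n. norm (b n))" and wv: "w * v = 1" "norm w = 1" "norm v = 1"
  defines "D \<equiv> \<lambda>k. \<Sum>n. b (n + k) * b n"
  shows "(\<lambda>k. D (Suc k) * (w ^ Suc k + v ^ Suc k)) sums
    ((\<Sum>n. b n * w ^ n) * (\<Sum>n. b n * v ^ n) - D 0)"
proof -
  define u where "u = (\<lambda>(m, n). (b m * w ^ m) * (b n * v ^ n))"
  have u: "(u has_sum (\<Sum>n. b n * w ^ n) * (\<Sum>n. b n * v ^ n)) UNIV"
    unfolding u_def using has_sum_product[of "\<lambda>n. b n * w ^ n" "\<lambda>n. b n * v ^ n"] b wv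
    by (simp add: norm_mult norm_power)
  have wvn: "w ^ n * v ^ n = 1" for n by (metis wv(1) power_mult_distrib power_one)
  have sumD: "((\<lambda>n. b (n + k) * b n * c) has_sum D k * c) UNIV" for k c
  proof (rule has_sum_cmult_left)
    show "((\<lambda>n. b (n + k) * b n) has_sum D k) UNIV"
      unfolding D_def
      by (rule norm_summable_imp_has_sum[OF summable_shifted_product[OF b b]
            summable_sums[OF summable_norm_cancel[OF summable_shifted_product[OF b b]]]])
  qed
  have sub: "u summable_on A" for A
    by (rule summable_on_subset_banach[OF has_sum_imp_summable[OF u]]) simp
  define h1 :: "nat \<times> nat \<Rightarrow> nat \<times> nat" where "h1 = (\<lambda>(k, n). (n + k, n))"
  define h2 :: "nat \<times> nat \<Rightarrow> nat \<times> nat" where "h2 = (\<lambda>(k, n). (n, n + Suc k))"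
  have inj: "inj h1" "inj h2" by (auto simp: h1_def h2_def inj_def)
  have disj: "range h1 \<inter> range h2 = {}" by (auto simp: h1_def h2_def)
  have un: "range h1 \<union> range h2 = UNIV"
  proof -
    have "(m, n) \<in> range h1 \<union> range h2" for m n
    proof (cases "n \<le> m")
      case True
      then have "(m, n) = h1 (m - n, n)" by (simp add: h1_def)
      then show ?thesis by blast
    next
      case False
      then have "(m, n) = h2 (n - m - 1, m)" by (simp add: h2_def)
      then show ?thesis by blast
    qed
    then show ?thesis by auto
  qed
  have "((u \<circ> h1) has_sum infsum u (range h1)) (UNIV \<times> UNIV)"
    using has_sum_infsum[OF sub[of "range h1"]] has_sum_reindex[OF inj(1), of u] by simp
  then have s1: "((\<lambda>k. D k * w ^ k) has_sum infsum u (range h1)) UNIV"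
  proof (rule has_sum_SigmaD)
    fix k
    have "(\<lambda>n. (u \<circ> h1) (k, n)) = (\<lambda>n. b (n + k) * b n * w ^ k)"
    proof
      fix n
      have "(u \<circ> h1) (k, n) = b (n + k) * b n * w ^ k * (w ^ n * v ^ n)"
        by (simp add: u_def h1_def power_add mult_ac)
      then show "(u \<circ> h1) (k, n) = b (n + k) * b n * w ^ k" by (simp add: wvn)
    qed
    then show "((\<lambda>n. (u \<circ> h1) (k, n)) has_sum D k * w ^ k) UNIV" using sumD by simp
  qed
  have "((u \<circ> h2) has_sum infsum u (range h2)) (UNIV \<times> UNIV)"
    using has_sum_infsum[OF sub[of "range h2"]] has_sum_reindex[OF inj(2), of u] by simp
  then have s2: "((\<lambda>k. D (Suc k) * v ^ Suc k) has_sum infsum u (range h2)) UNIV"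
  proof (rule has_sum_SigmaD)
    fix k
    have "(\<lambda>n. (u \<circ> h2) (k, n)) = (\<lambda>n. b (n + Suc k) * b n * v ^ Suc k)"
    proof
      fix n
      have "(u \<circ> h2) (k, n) = b (n + Suc k) * b n * v ^ Suc k * (w ^ n * v ^ n)"
        by (simp add: u_def h2_def power_add mult_ac)
      then show "(u \<circ> h2) (k, n) = b (n + Suc k) * b n * v ^ Suc k" by (simp only: wvn mult_1_right)
    qed
    then show "((\<lambda>n. (u \<circ> h2) (k, n)) has_sum D (Suc k) * v ^ Suc k) UNIV" using sumD[of "Suc k" "v ^ Suc k"] by (simp only:)
  qed
  have "(u has_sum (infsum u (range h1) + infsum u (range h2))) UNIV"
    using has_sum_Un_disjoint[OF has_sum_infsum[OF sub] has_sum_infsum[OF sub] disj] un by simp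
  then have eq: "infsum u (range h1) + infsum u (range h2) = (\<Sum>n. b n * w ^ n) * (\<Sum>n. b n * v ^ n)"
    using u has_sum_unique by blast
  have "(\<lambda>k. D (Suc k) * w ^ Suc k) sums (infsum u (range h1) - D 0)"
    using has_sum_imp_sums[OF s1] by (subst sums_Suc_iff) simp
  from sums_add[OF this has_sum_imp_sums[OF s2]] show ?thesis
    unfolding eq[symmetric] by (simp add: algebra_simps)
qed

text \<open>Only the terms of frequency zero, those with first index \<open>n + N\<close> and second index \<open>n\<close>, survive
integration over the period, and the double series converges uniformly. The nonzero integer
\<open>\<sigma>\<close> allows either orientation of the circle.\<close>

lemma has_integral_circle_product:
  fixes P Q :: "nat \<Rightarrow> complex" and \<sigma> :: int
  assumes P: "summable (\<lambda>n. norm (P n))" and Q: "summable (\<lambda>n. norm (Q n))" and \<sigma>: "\<sigma> \<noteq> 0"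
  defines "w \<equiv> \<lambda>x. cis (of_int (2 * \<sigma>) * x)" and "v \<equiv> \<lambda>x. cis (- of_int (2 * \<sigma>) * x)"
  shows "((\<lambda>x. v x ^ N * ((\<Sum>n. P n * w x ^ n) * (\<Sum>n. Q n * v x ^ n)))
    has_integral 2 * of_real pi * (\<Sum>n. P (n + N) * Q n)) {0..2 * pi}"
proof -
  \<comment> \<open>The frequency of the term with indices \<open>m\<close> and \<open>n\<close>.\<close>
  define l :: "nat \<times> nat \<Rightarrow> int" where "l = (\<lambda>(m, n). 2 * \<sigma> * (int m - int n - int N))"
  define f where "f = (\<lambda>(z :: nat \<times> nat) x. P (fst z) * Q (snd z) * cis (of_int (l z) * x))"
  define g where "g = (\<lambda>x. v x ^ N * ((\<Sum>n. P n * w x ^ n) * (\<Sum>n. Q n * v x ^ n)))"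
  have nw: "norm (w x) = 1" "norm (v x) = 1" for x by (auto simp: w_def v_def)
  have f_eq: "f (m, n) x = v x ^ N * ((P m * w x ^ m) * (Q n * v x ^ n))" for m n x
  proof -
    have "v x ^ N * (w x ^ m * v x ^ n) = cis (of_int (l (m, n)) * x)"
      unfolding w_def v_def l_def Complex.DeMoivre cis_mult by (simp add: algebra_simps)
    then show ?thesis by (simp add: f_def mult_ac)
  qed
  have hs: "((\<lambda>z. f z x) has_sum g x) UNIV" for x
  proof -
    have "((\<lambda>z. v x ^ N * (case z of (m, n) \<Rightarrow> (P m * w x ^ m) * (Q n * v x ^ n))) has_sum g x) UNIV"
      unfolding g_def using has_sum_product[of "\<lambda>n. P n * w x ^ n" "\<lambda>n. Q n * v x ^ n"] P Q nw
      by (intro has_sum_cmult_right) (simp add: norm_mult norm_power)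
    then show ?thesis
      by (rule has_sum_cong[THEN iffD1, rotated]) (auto simp: f_eq)
  qed
  have ul: "uniform_limit {0..2 * pi} (\<lambda>X x. \<Sum>z\<in>X. f z x) g (finite_subsets_at_top UNIV)"
  proof (rule Weierstrass_m_test_general')
    show "norm (f z x) \<le> (case z of (m, n) \<Rightarrow> norm (P m) * norm (Q n))" for z x
      by (simp add: f_def case_prod_beta norm_mult)
    show "(\<lambda>(m, n). norm (P m) * norm (Q n)) summable_on UNIV"
      using summable_on_product_nonneg[OF P Q] by simp
  qed (use hs in auto)
  have cf: "continuous_on {0..2 * pi} (\<lambda>x. \<Sum>z\<in>X. f z x)" for X
    unfolding f_def by (intro continuous_intros)
  obtain I J where IJ: "\<And>X. ((\<lambda>x. \<Sum>z\<in>X. f z x) has_integral I X) {0..2 * pi}"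
      "(g has_integral J) {0..2 * pi}" "(I \<longlongrightarrow> J) (finite_subsets_at_top UNIV)"
    using uniform_limit_integral[OF ul cf] by auto
  define c where "c = (\<lambda>z. P (fst z) * Q (snd z) * (if l z = 0 then 2 * of_real pi else 0))"
  have "I X = sum c X" if "finite X" for X
  proof -
    have "((\<lambda>x. \<Sum>z\<in>X. f z x) has_integral (\<Sum>z\<in>X. c z)) {0..2 * pi}"
      unfolding f_def c_def by (intro has_integral_sum that has_integral_mult_right has_integral_cis_int)
    then show ?thesis using IJ(1) has_integral_unique by blast
  qed
  then have "(c has_sum J) UNIV"
    unfolding has_sum_def using IJ(3)
    by (subst tendsto_cong[of _ I]) (auto intro!: eventually_finite_subsets_at_top_weakI)
  define h :: "nat \<Rightarrow> nat \<times> nat" where "h = (\<lambda>n. (n + N, n))"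
  have l0: "l z = 0 \<longleftrightarrow> z \<in> range h" for z
  proof -
    obtain m n where z: "z = (m, n)" by (cases z)
    have "l z = 0 \<longleftrightarrow> m = n + N" using \<sigma> by (auto simp: l_def z)
    then show ?thesis by (auto simp: z h_def image_iff)
  qed
  have "(c has_sum J) (range h)"
    using \<open>(c has_sum J) UNIV\<close> by (rule has_sum_cong_neutral[THEN iffD1, rotated -1]) (auto simp: c_def l0)
  then have "((c \<circ> h) has_sum J) UNIV"
    by (subst (asm) has_sum_reindex) (auto simp: h_def inj_def)
  moreover have "c \<circ> h = (\<lambda>n. P (n + N) * Q n * (2 * of_real pi))"
    by (auto simp: c_def l0) (auto simp: h_def)
  ultimately have "(\<lambda>n. P (n + N) * Q n * (2 * of_real pi)) sums J"
    by (simp add: has_sum_imp_sums)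
  moreover have "(\<lambda>n. P (n + N) * Q n * (2 * of_real pi)) sums ((\<Sum>n. P (n + N) * Q n) * (2 * of_real pi))"
    by (rule sums_mult2[OF summable_sums[OF summable_norm_cancel[OF summable_shifted_product[OF P Q]]]])
  ultimately have "J = 2 * of_real pi * (\<Sum>n. P (n + N) * Q n)"
    by (metis sums_unique2 mult.commute)
  then show ?thesis using IJ(2) by (simp add: g_def)
qed

section \<open>Fourier expansion of the phase\<close>

text \<open>The modulus of the descending Landen transformation; it is the number \<open>\<rho>\<close> for which
\<open>1 - k\<^sup>2 sin\<^sup>2 x\<close> is a constant multiple of \<open>\<bar>1 + \<rho> exp (2 i x)\<bar>\<^sup>2\<close>.\<close>

definition landen_modulus :: "real \<Rightarrow> real" where
  "landen_modulus k = (1 - sqrt (1 - k\<^sup>2)) / (1 + sqrt (1 - k\<^sup>2))"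

lemma landen_modulus_bounds:
  assumes "\<bar>k\<bar> < 1"
  shows "0 \<le> landen_modulus k" "landen_modulus k \<le> k\<^sup>2" "landen_modulus k = k\<^sup>2 / (1 + sqrt (1 - k\<^sup>2))\<^sup>2" "landen_modulus k < 1"
proof -
  define c where "c = sqrt (1 - k\<^sup>2)"
  have k2: "k\<^sup>2 < 1" using assms by (simp add: abs_square_less_1)
  have c: "0 < c" "c \<le> 1" "c\<^sup>2 = 1 - k\<^sup>2" using k2 by (auto simp: c_def)
  have "k\<^sup>2 = (1 - c) * (1 + c)" using c(3) by (simp add: power2_eq_square algebra_simps)
  then have *: "landen_modulus k = k\<^sup>2 / (1 + c)\<^sup>2"
    unfolding landen_modulus_def c_def[symmetric] using c(1) by (simp add: power2_eq_square)
  then show "landen_modulus k = k\<^sup>2 / (1 + sqrt (1 - k\<^sup>2))\<^sup>2" by (simp add: c_def)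
  show "0 \<le> landen_modulus k" unfolding * by simp
  have "1 \<le> (1 + c)\<^sup>2" using c by (intro one_le_power) auto
  then have "k\<^sup>2 / (1 + c)\<^sup>2 \<le> k\<^sup>2 / 1" by (intro divide_left_mono) auto
  then show "landen_modulus k \<le> k\<^sup>2" unfolding * by simp
  then show "landen_modulus k < 1" using k2 by linarith
qed

lemma landen_radicand:
  assumes "\<bar>k\<bar> < 1"
  shows "1 - k\<^sup>2 * (sin x)\<^sup>2 = ((1 + sqrt (1 - k\<^sup>2)) / 2 * norm (1 + of_real (landen_modulus k) * cis (2 * x)))\<^sup>2"
proof -
  define c where "c = sqrt (1 - k\<^sup>2)"
  define r where "r = landen_modulus k"
  have k2: "k\<^sup>2 < 1" using assms by (simp add: abs_square_less_1)
  have c: "0 < c" "k\<^sup>2 = 1 - c\<^sup>2" using k2 by (auto simp: c_def)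
  have r: "(1 + c) * r = 1 - c" using c by (simp add: r_def landen_modulus_def c_def[symmetric])
  have "(norm (1 + of_real r * cis (2 * x)))\<^sup>2 = (1 + r * cos (2 * x))\<^sup>2 + (r * sin (2 * x))\<^sup>2"
    by (simp add: cmod_power2)
  also have "\<dots> = 1 + 2 * r * cos (2 * x) + r\<^sup>2 * ((cos (2 * x))\<^sup>2 + (sin (2 * x))\<^sup>2)"
  proof -
    have "(1 + r * C)\<^sup>2 + (r * S)\<^sup>2 = 1 + 2 * r * C + r\<^sup>2 * (C\<^sup>2 + S\<^sup>2)" for C S
      by (simp add: power2_eq_square algebra_simps)
    then show ?thesis .
  qed
  also have "(cos (2 * x))\<^sup>2 + (sin (2 * x))\<^sup>2 = 1" by simp
  also have "1 + 2 * r * cos (2 * x) + r\<^sup>2 * 1 = (1 + r)\<^sup>2 - 4 * r * (sin x)\<^sup>2"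
    unfolding cos_double_sin by (simp add: power2_eq_square algebra_simps)
  finally have "((1 + c) / 2 * norm (1 + of_real r * cis (2 * x)))\<^sup>2 =
      ((1 + c) / 2)\<^sup>2 * ((1 + r)\<^sup>2 - 4 * r * (sin x)\<^sup>2)"
    by (simp only: power_mult_distrib)
  also have "\<dots> = (((1 + c) + (1 + c) * r) / 2)\<^sup>2 - (1 + c) * ((1 + c) * r) * (sin x)\<^sup>2"
    by (simp add: power2_eq_square field_simps)
  also have "\<dots> = 1 - k\<^sup>2 * (sin x)\<^sup>2"
    unfolding r c(2) by (simp add: power2_eq_square algebra_simps)
  finally show ?thesis by (simp add: c_def r_def)
qed

lemma fps_conv_radius_half_binom: "1 \<le> fps_conv_radius half_binom_fps"
  using fps_conv_radius_ge_of_bound[of half_binom_fps 1 1] half_binom_le_1 half_binom_pos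
  by (simp add: half_binom_fps_def less_imp_le one_ereal_def)

text \<open>For the function \<open>B\<close> with the coefficients \<open>half_binom\<close>, \<open>B(t)\<^sup>2 (1 - t) = 1\<close> determines the modulus
of \<open>B(t)\<close>, and as the coefficients are real the product on the left is \<open>\<bar>B(t)\<bar>\<^sup>2\<close>. Working with
moduli avoids any choice of a branch of the square root.\<close>

lemma half_binom_eval_norm:
  fixes t :: complex
  assumes "norm t < 1"
  shows "(\<Sum>n. of_real (half_binom n) * t ^ n) * (\<Sum>n. of_real (half_binom n) * cnj t ^ n) = of_real (1 / norm (1 - t))"
proof -
  let ?B = "eval_fps half_binom_fps"
  have r: "ereal (norm t) < fps_conv_radius half_binom_fps"
    using assms by (intro less_le_trans[OF _ fps_conv_radius_half_binom]) (simp add: one_ereal_def)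
  have B: "?B t = (\<Sum>n. of_real (half_binom n) * t ^ n)" for t
    by (simp add: eval_fps_def half_binom_fps_def)
  have c: "?B (cnj t) = cnj (?B t)"
  proof -
    have "(\<lambda>n. of_real (half_binom n) * t ^ n) sums ?B t"
      using sums_eval_fps[OF r] by (simp add: half_binom_fps_def)
    then have "(\<lambda>n. cnj (of_real (half_binom n) * t ^ n)) sums cnj (?B t)" by (simp only: sums_cnj)
    then show ?thesis unfolding B by (simp add: sums_iff)
  qed
  have r1: "ereal (norm t) < fps_conv_radius (1 - fps_X :: complex fps)"
    by (intro less_le_trans[OF _ fps_conv_radius_diff]) simp
  have r2: "ereal (norm t) < fps_conv_radius (half_binom_fps ^ 2)"
    by (intro less_le_trans[OF r fps_conv_radius_power])
  have "eval_fps (half_binom_fps ^ 2 * (1 - fps_X)) t = 1" by (simp add: half_binom_fps_sq)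
  then have "(?B t) ^ 2 * (1 - t) = 1"
    using r r1 r2 by (simp add: eval_fps_mult eval_fps_power eval_fps_diff)
  then have "norm ((?B t) ^ 2) * norm (1 - t) = 1" by (metis norm_mult norm_one)
  then have "(norm (?B t))\<^sup>2 = 1 / norm (1 - t)"
    by (metis eq_divide_eq mult_zero_right norm_power zero_neq_one)
  moreover have "?B t * cnj (?B t) = of_real ((norm (?B t))\<^sup>2)" by (simp only: complex_norm_square)
  ultimately show ?thesis unfolding B[symmetric] c by simp
qed

lemma ell_integrand_eq_product:
  assumes k: "\<bar>k\<bar> < 1"
  defines "b \<equiv> \<lambda>n. of_real (half_binom n) * (- of_real (landen_modulus k)) ^ n :: complex"
  shows "of_real (1 / ell_Delta k x) = of_real (2 / (1 + sqrt (1 - k\<^sup>2))) *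
    ((\<Sum>n. b n * cis (2 * x) ^ n) * (\<Sum>n. b n * cis (- 2 * x) ^ n))"
proof -
  define r where "r = landen_modulus k"
  define c where "c = sqrt (1 - k\<^sup>2)"
  have r: "0 \<le> r" "r < 1" using landen_modulus_bounds[OF k] by (auto simp: r_def)
  have c: "0 \<le> c" unfolding c_def using k by (simp add: abs_square_le_1)
  define t where "t = - of_real r * cis (2 * x)"
  have "cnj t = - of_real r * cis (- 2 * x)" by (simp add: t_def cis_cnj)
  moreover have "norm t < 1" using r by (simp add: t_def norm_mult)
  ultimately have "(\<Sum>n. b n * cis (2 * x) ^ n) * (\<Sum>n. b n * cis (- 2 * x) ^ n) = of_real (1 / norm (1 - t))"
    using half_binom_eval_norm[of t] unfolding b_def t_def r_def[symmetric]
    by (simp only: power_mult_distrib mult.assoc)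
  moreover have "ell_Delta k x = (1 + c) / 2 * norm (1 - t)"
    unfolding landen_radicand[OF k] using c by (simp add: t_def r_def c_def)
  then have "1 / ell_Delta k x = 2 / (1 + c) * (1 / norm (1 - t))" by (simp only:) simp
  ultimately show ?thesis unfolding c_def[symmetric] by (simp only: of_real_mult)
qed

lemma summable_norm_half_binom_power:
  assumes "\<bar>r\<bar> < 1"
  shows "summable (\<lambda>n. norm (of_real (half_binom n) * (- of_real r) ^ n :: complex))"
proof (rule summable_comparison_test')
  show "summable (\<lambda>n. \<bar>r\<bar> ^ n)" using assms by (intro summable_geometric) simp
  show "norm (norm (of_real (half_binom n) * (- of_real r) ^ n :: complex)) \<le> \<bar>r\<bar> ^ n" for n
    using half_binom_le_1[of n] half_binom_pos[of n]
    by (simp add: norm_mult norm_power mult_left_le_one_le)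
qed

lemma half_lag_complex:
  assumes "\<bar>r\<bar> < 1"
  defines "b \<equiv> \<lambda>n. of_real (half_binom n) * (- of_real r) ^ n :: complex"
  shows "(\<Sum>n. b (n + k) * b n) = (- of_real r) ^ k * of_real (half_lag r k)"
proof -
  have "b (n + k) * b n = (- of_real r) ^ k * of_real (half_binom (n + k) * half_binom n * (r\<^sup>2) ^ n)" for n
  proof -
    have "(- of_real r :: complex) ^ n * (- of_real r) ^ n = of_real ((r\<^sup>2) ^ n)"
      by (simp add: power_mult_distrib[symmetric] power2_eq_square)
    then show ?thesis unfolding b_def power_add by (simp add: mult_ac)
  qed
  then show ?thesis
    unfolding half_lag_def using summable_half_lag[OF assms(1), of k]
    by (simp add: suminf_mult summable_of_real suminf_of_real[symmetric] del: of_real_mult of_real_power)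
qed

text \<open>The product formula for the integrand makes \<open>\<theta>'\<close> a constant \<open>\<kappa>\<close> times a Fourier series with
constant term one. The constant needs no evaluation of \<open>K\<close>: the integral of \<open>\<theta>'\<close> over a period is
\<open>2 \<pi>\<close>, which forces \<open>\<kappa> = 1\<close>.\<close>

lemma ell_time_deriv_expansion:
  assumes k: "\<bar>k\<bar> < 1"
  defines "t \<equiv> \<lambda>x. - of_real (landen_modulus k) * cis (2 * x)" and "s \<equiv> \<lambda>x. - of_real (landen_modulus k) * cis (- 2 * x)"
  shows "of_real (pi / (2 * ell_K k) / ell_Delta k x) =
     1 + (t x * eval_fps (fps_deriv (lag_fps (landen_modulus k))) (t x) + s x * eval_fps (fps_deriv (lag_fps (landen_modulus k))) (s x))"
proof -
  define r where "r = landen_modulus k"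
  have r: "\<bar>r\<bar> < 1" using landen_modulus_bounds[OF k] by (auto simp: r_def)
  define \<kappa> where "\<kappa> = of_real (pi / (2 * ell_K k) * (2 / (1 + sqrt (1 - k\<^sup>2)))) * (of_real (half_lag r 0) :: complex)"
  define b where "b = (\<lambda>n. of_real (half_binom n) * (- of_real r) ^ n :: complex)"
  have sb: "summable (\<lambda>n. norm (b n))"
    using summable_norm_half_binom_power[OF r] by (simp only: b_def)
  have lag: "(\<Sum>n. b (n + m) * b n) = (- of_real r) ^ m * of_real (half_lag r m)" for m
    using half_lag_complex[OF r] by (simp only: b_def)
  have d0: "half_lag r 0 \<noteq> 0" using half_lag_0_ge_1[OF r] by simp
  have prod: "of_real (pi / (2 * ell_K k) / ell_Delta k x) = \<kappa> / of_real (half_lag r 0) *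
      ((\<Sum>n. b n * cis (2 * x) ^ n) * (\<Sum>n. b n * cis (- 2 * x) ^ n))" for x
  proof -
    have "of_real (pi / (2 * ell_K k) / ell_Delta k x) = of_real (pi / (2 * ell_K k)) * (of_real (1 / ell_Delta k x) :: complex)"
      by simp
    then show ?thesis
      unfolding ell_integrand_eq_product[OF k] b_def r_def \<kappa>_def using d0 by (simp add: r_def)
  qed
  have "\<kappa> = 1"
  proof -
    have "((\<lambda>x. \<kappa> / of_real (half_lag r 0) * ((\<Sum>n. b n * cis (2 * x) ^ n) * (\<Sum>n. b n * cis (- 2 * x) ^ n)))
       has_integral \<kappa> / of_real (half_lag r 0) * (2 * of_real pi * of_real (half_lag r 0))) {0..2 * pi}"
      using has_integral_circle_product[OF sb sb, of 1 0] lag[of 0]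
      by (intro has_integral_mult_right) simp
    then have "((\<lambda>x. of_real (pi / (2 * ell_K k) / ell_Delta k x)) has_integral \<kappa> * (2 * of_real pi)) {0..2 * pi}"
      unfolding prod[symmetric] using d0 by (simp add: mult_ac)
    moreover have "((\<lambda>x. of_real (pi / (2 * ell_K k) / ell_Delta k x)) has_integral (of_real (2 * pi) :: complex)) {0..2 * pi}"
    proof (rule has_integral_of_real)
      have "((\<lambda>x. pi / (2 * ell_K k) / ell_Delta k x) has_integral (ell_time k (2 * pi) - ell_time k 0)) {0..2 * pi}"
        by (rule fundamental_theorem_of_calculus)
           (use has_field_derivative_at_within[OF DERIV_ell_time[OF k]] in
             \<open>simp_all add: has_real_derivative_iff_has_vector_derivative[symmetric]\<close>)
      then show "((\<lambda>x. pi / (2 * ell_K k) / ell_Delta k x) has_integral 2 * pi) {0..2 * pi}"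
        by (simp add: ell_time_2pi[OF k])
    qed
    ultimately have "\<kappa> * (2 * of_real pi) = of_real (2 * pi)" by (rule has_integral_unique)
    then show ?thesis by simp
  qed
  define D where "D = (\<lambda>k. (- of_real r) ^ k * (of_real (half_lag r k) :: complex))"
  have "(\<lambda>n. D (Suc n) * (cis (2 * x) ^ Suc n + cis (- 2 * x) ^ Suc n)) sums
      ((\<Sum>n. b n * cis (2 * x) ^ n) * (\<Sum>n. b n * cis (- 2 * x) ^ n) - D 0)"
    using circle_product_expansion[OF sb, of "cis (2 * x)" "cis (- 2 * x)"] unfolding lag D_def
    by (simp add: cis_mult)
  then have "(\<lambda>n. 1 / of_real (half_lag r 0) * (D (Suc n) * (cis (2 * x) ^ Suc n + cis (- 2 * x) ^ Suc n))) sums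
     (1 / of_real (half_lag r 0) * ((\<Sum>n. b n * cis (2 * x) ^ n) * (\<Sum>n. b n * cis (- 2 * x) ^ n) - D 0))"
    by (rule sums_mult)
  also have "1 / of_real (half_lag r 0) * ((\<Sum>n. b n * cis (2 * x) ^ n) * (\<Sum>n. b n * cis (- 2 * x) ^ n) - D 0)
      = of_real (pi / (2 * ell_K k) / ell_Delta k x) - 1"
    unfolding prod \<open>\<kappa> = 1\<close> using d0 by (simp add: D_def right_diff_distrib)
  finally have S1: "(\<lambda>n. 1 / of_real (half_lag r 0) * (D (Suc n) * (cis (2 * x) ^ Suc n + cis (- 2 * x) ^ Suc n))) sums
     (of_real (pi / (2 * ell_K k) / ell_Delta k x) - 1)" .
  have G: "(\<lambda>n. of_real (half_lag r (Suc n) / half_lag r 0) * z ^ Suc n) sums (z * eval_fps (fps_deriv (lag_fps r)) z)"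
    if "norm z = \<bar>r\<bar>" for z
  proof -
    have "fps_conv_radius (fps_deriv (lag_fps r)) \<ge> ereal (1 / 1)"
    proof (rule fps_conv_radius_ge_of_bound)
      show "norm (fps_nth (fps_deriv (lag_fps r)) n) \<le> 1 * 1 ^ n" for n
        using lag_fps_norm_le[OF r, of "Suc n"] by simp
    qed simp
    then have "ereal (norm z) < fps_conv_radius (fps_deriv (lag_fps r))"
      by (rule less_le_trans[of _ "ereal (1 / 1)", rotated]) (use that r in simp)
    from sums_mult[OF sums_eval_fps[OF this], of z]
    have "(\<lambda>n. z * (of_nat (Suc n) * fps_nth (lag_fps r) (Suc n) * z ^ n)) sums (z * eval_fps (fps_deriv (lag_fps r)) z)"
      by (simp del: of_nat_Suc)
    then show ?thesis by (simp add: lag_fps_nth mult_ac del: of_nat_Suc)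
  qed
  have "norm (t x) = \<bar>r\<bar>" "norm (s x) = \<bar>r\<bar>" by (auto simp: t_def s_def norm_mult r_def)
  from sums_add[OF G[OF this(1)] G[OF this(2)]]
  have "(\<lambda>n. 1 / of_real (half_lag r 0) * (D (Suc n) * (cis (2 * x) ^ Suc n + cis (- 2 * x) ^ Suc n))) sums
     (t x * eval_fps (fps_deriv (lag_fps r)) (t x) + s x * eval_fps (fps_deriv (lag_fps r)) (s x))"
    unfolding D_def t_def s_def r_def[symmetric] power_mult_distrib by (simp add: algebra_simps del: power_Suc)
  from sums_unique2[OF S1 this] show ?thesis by (simp add: r_def algebra_simps)
qed

text \<open>Both sides vanish at \<open>x = 0\<close>, and by the chain rule and the preceding lemma they have the same
derivative.\<close>

lemma ell_time_expansion:
  assumes k: "\<bar>k\<bar> < 1"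
  defines "t \<equiv> \<lambda>x. - of_real (landen_modulus k) * cis (2 * x)" and "s \<equiv> \<lambda>x. - of_real (landen_modulus k) * cis (- 2 * x)"
  shows "2 * \<i> * of_real (ell_time k x - x) = eval_fps (lag_fps (landen_modulus k)) (t x) - eval_fps (lag_fps (landen_modulus k)) (s x)"
proof -
  define r where "r = landen_modulus k"
  define G where "G = lag_fps r"
  have r: "\<bar>r\<bar> < 1" using landen_modulus_bounds[OF k] by (auto simp: r_def)
  have "norm (fps_nth G n) \<le> 1 * 1 ^ n" for n
  proof (cases n)
    case (Suc m)
    have "norm (fps_nth G n) \<le> real n * norm (fps_nth G n)" using Suc by (intro mult_le_cancel_right1[THEN iffD2]) auto
    then show ?thesis using lag_fps_norm_le[OF r, of n] by (simp add: norm_mult G_def)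
  qed (simp add: G_def)
  then have "ereal (1 / 1) \<le> fps_conv_radius G" by (rule fps_conv_radius_ge_of_bound) simp
  then have rad: "ereal (norm z) < fps_conv_radius G" if "norm z = \<bar>r\<bar>" for z
    by (rule less_le_trans[of _ "ereal (1 / 1)", rotated]) (use that r in simp)
  have nt: "norm (t x) = \<bar>r\<bar>" "norm (s x) = \<bar>r\<bar>" for x by (auto simp: t_def s_def norm_mult r_def)
  have dt: "(t has_vector_derivative 2 * \<i> * t x) (at x)" for x
    unfolding t_def using has_vector_derivative_mult_right[OF has_vector_derivative_cis_mult[of 2 x UNIV], of "- of_real (landen_modulus k)"]
    by (simp add: mult_ac)
  have ds: "(s has_vector_derivative - (2 * \<i> * s x)) (at x)" for x
    unfolding s_def using has_vector_derivative_mult_right[OF has_vector_derivative_cis_mult[of "-2" x UNIV], of "- of_real (landen_modulus k)"]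
    by (simp add: mult_ac)
  have dG: "(eval_fps G has_field_derivative eval_fps (fps_deriv G) z) (at z)" if "norm z = \<bar>r\<bar>" for z
    using rad[OF that] by (intro has_field_derivative_eval_fps) auto
  define h where "h = (\<lambda>x. 2 * \<i> * of_real (ell_time k x - x) - (eval_fps G (t x) - eval_fps G (s x)))"
  have "(h has_vector_derivative 0) (at x within S)" for x S
  proof -
    have 1: "((\<lambda>x. eval_fps G (t x)) has_vector_derivative (2 * \<i> * t x * eval_fps (fps_deriv G) (t x))) (at x)"
      using field_vector_diff_chain_at[OF dt dG[OF nt(1)]] by (simp add: o_def)
    have 2: "((\<lambda>x. eval_fps G (s x)) has_vector_derivative (- (2 * \<i> * s x) * eval_fps (fps_deriv G) (s x))) (at x)"
      using field_vector_diff_chain_at[OF ds dG[OF nt(2)]] by (simp add: o_def)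
    have "((\<lambda>x. ell_time k x - x) has_real_derivative (pi / (2 * ell_K k) / ell_Delta k x - 1)) (at x)"
      by (intro derivative_intros DERIV_ell_time[OF k])
    then have 3: "((\<lambda>x. 2 * \<i> * of_real (ell_time k x - x)) has_vector_derivative
        (2 * \<i> * of_real (pi / (2 * ell_K k) / ell_Delta k x - 1))) (at x)"
      by (intro has_vector_derivative_mult_right has_vector_derivative_of_real)
    have e: "of_real (pi / (2 * ell_K k) / ell_Delta k x - 1) =
       t x * eval_fps (fps_deriv G) (t x) + s x * eval_fps (fps_deriv G) (s x)"
      using ell_time_deriv_expansion[OF k, of x] unfolding t_def s_def G_def r_def by simp
    have "(h has_vector_derivative 2 * \<i> * of_real (pi / (2 * ell_K k) / ell_Delta k x - 1) -
       (2 * \<i> * t x * eval_fps (fps_deriv G) (t x) - (- (2 * \<i> * s x) * eval_fps (fps_deriv G) (s x)))) (at x)"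
      unfolding h_def by (intro has_vector_derivative_diff 1 2 3)
    then have "(h has_vector_derivative 0) (at x)" unfolding e by (simp add: algebra_simps)
    then show ?thesis by (rule has_vector_derivative_at_within)
  qed
  then obtain c where c: "\<And>x. h x = c"
    using has_vector_derivative_zero_constant[of UNIV h] by auto
  have "h x = h 0" using c by simp
  also have "h 0 = 0" by (simp add: h_def t_def s_def)
  finally show ?thesis by (simp add: h_def G_def r_def)
qed

section \<open>The coefficients as correlation sums\<close>

definition half_coeff :: "complex \<Rightarrow> real \<Rightarrow> nat \<Rightarrow> complex" where
  "half_coeff s \<rho> n = fps_nth (fps_exp s oo lag_fps \<rho>) n * (- of_real \<rho>) ^ n"

text \<open>The coefficient of \<open>w ^ N\<close> in the product of the series \<open>exp (s G)\<close> at \<open>- \<rho> w\<close> and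
\<open>exp (- s G)\<close> at \<open>- \<rho> / w\<close>.\<close>

definition half_coeff_corr :: "complex \<Rightarrow> real \<Rightarrow> nat \<Rightarrow> complex" where
  "half_coeff_corr s \<rho> N = (\<Sum>m. half_coeff s \<rho> (m + N) * half_coeff (- s) \<rho> m)"

lemma half_coeff_norm_le:
  assumes "norm s \<le> real q" "0 < q" "0 \<le> \<rho>" "\<rho> < 1"
  shows "norm (half_coeff s \<rho> n) \<le> 2 ^ q * (2 * \<rho>) ^ n"
proof -
  have "norm (fps_nth (fps_exp s oo lag_fps \<rho>) n) \<le> 2 ^ (n + q)"
    by (rule fps_exp_compose_norm_le_power[OF lag_fps_nth_0 lag_fps_norm_le assms(1,2)]) (use assms in simp)
  then have "norm (half_coeff s \<rho> n) \<le> 2 ^ (n + q) * \<rho> ^ n"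
    unfolding half_coeff_def norm_mult norm_power using assms by (intro mult_mono) auto
  then show ?thesis by (simp add: power_add power_mult_distrib mult_ac)
qed

lemma summable_norm_half_coeff:
  assumes "norm s \<le> real q" "0 < q" "0 \<le> \<rho>" "\<rho> < 1 / 2"
  shows "summable (\<lambda>n. norm (half_coeff s \<rho> n))"
proof (rule summable_comparison_test')
  show "summable (\<lambda>n. 2 ^ q * (2 * \<rho>) ^ n)"
    using assms by (intro summable_mult summable_geometric) simp
  show "norm (norm (half_coeff s \<rho> n)) \<le> 2 ^ q * (2 * \<rho>) ^ n" for n
    using half_coeff_norm_le[OF assms(1-3), of n] assms by simp
qed

lemma exp_phase_expansion:
  assumes k: "\<bar>k\<bar> < 1" "landen_modulus k < 1 / 2" and s: "norm s \<le> real q" "0 < q"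
  shows "exp (s * (2 * \<i> * of_real (ell_time k x - x))) =
    (\<Sum>n. half_coeff s (landen_modulus k) n * cis (2 * x) ^ n) * (\<Sum>n. half_coeff (- s) (landen_modulus k) n * cis (- 2 * x) ^ n)"
proof -
  define r where "r = landen_modulus k"
  have r: "0 \<le> r" "r < 1 / 2" "\<bar>r\<bar> < 1" using landen_modulus_bounds(1,4)[OF k(1)] k by (auto simp: r_def)
  have E: "exp (s' * eval_fps (lag_fps r) (- of_real r * cis y)) = (\<Sum>n. half_coeff s' r n * cis y ^ n)"
    if s': "norm s' \<le> real q" for s' y
  proof -
    have "norm (- of_real r * cis y) < 1 / 2" using r by (simp add: norm_mult)
    from eval_fps_exp_compose[OF lag_fps_nth_0 lag_fps_norm_le[OF r(3)] s' s(2) this, symmetric]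
    show ?thesis by (simp only: eval_fps_def half_coeff_def power_mult_distrib mult.assoc)
  qed
  show ?thesis
    unfolding ell_time_expansion[OF k(1)] right_diff_distrib r_def[symmetric]
    using E[of s "2 * x"] E[of "- s" "- 2 * x"] s by (simp add: exp_diff exp_minus field_simps)
qed

lemma has_integral_phase_neg:
  assumes k: "\<bar>k\<bar> < 1" "landen_modulus k < 1 / 2" and s: "norm s \<le> real q" "0 < q"
  shows "((\<lambda>x. cis (- 2 * real N * x) * exp (s * (2 * \<i> * of_real (ell_time k x - x))))
     has_integral 2 * of_real pi * half_coeff_corr s (landen_modulus k) N) {0..2 * pi}"
proof -
  have r: "0 \<le> landen_modulus k" using landen_modulus_bounds[OF k(1)] by simp
  have s': "norm (- s) \<le> real q" using s by simp
  have "cis (- 2 * real N * x) = cis (- 2 * x) ^ N" for x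
    by (simp add: Complex.DeMoivre algebra_simps)
  then show ?thesis
    unfolding exp_phase_expansion[OF k s] half_coeff_corr_def
    using has_integral_circle_product[OF summable_norm_half_coeff[OF s r k(2)] summable_norm_half_coeff[OF s' s(2) r k(2)], of 1 N]
    by simp
qed

lemma has_integral_phase_pos:
  assumes k: "\<bar>k\<bar> < 1" "landen_modulus k < 1 / 2" and s: "norm s \<le> real q" "0 < q"
  shows "((\<lambda>x. cis (2 * real N * x) * exp (s * (2 * \<i> * of_real (ell_time k x - x))))
     has_integral 2 * of_real pi * half_coeff_corr (- s) (landen_modulus k) N) {0..2 * pi}"
proof -
  have r: "0 \<le> landen_modulus k" using landen_modulus_bounds[OF k(1)] by simp
  have s': "norm (- s) \<le> real q" using s by simp
  have "cis (2 * real N * x) = cis (2 * x) ^ N" for x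
    by (simp add: Complex.DeMoivre algebra_simps)
  then show ?thesis
    unfolding exp_phase_expansion[OF k s] half_coeff_corr_def
    using has_integral_circle_product[OF summable_norm_half_coeff[OF s' s(2) r k(2)] summable_norm_half_coeff[OF s r k(2)], of "- 1" N]
    by (simp add: mult.commute[of "suminf _" "suminf _"])
qed

text \<open>The product of sines is half the difference of the real parts of \<open>exp (i (j x - q \<theta>))\<close> and
\<open>exp (i (j x + q \<theta>))\<close>. Extracting \<open>exp (i (j - q) x)\<close> and \<open>exp (i (j + q) x)\<close> leaves
exponentials of multiples of the phase \<open>\<theta> - x\<close>. The sign of \<open>j - q\<close> decides which of the two
exponential series contributes the higher index, and this causes the case distinction in the final
formula.\<close>

lemma A_coeff_eq_corr:
  assumes k: "\<bar>rational_ecc p q e\<bar> < 1" "landen_modulus (rational_ecc p q e) < 1 / 2" and q: "0 < q"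
    and par: "even j \<longleftrightarrow> even q"
  defines "\<rho> \<equiv> landen_modulus (rational_ecc p q e)" and "y \<equiv> half_diff q j"
  shows "A_coeff p q j e = real j / real q *
    (Re (half_coeff_corr (if j \<le> q then - of_nat q / 2 else of_nat q / 2) \<rho> y)
     - Re (half_coeff_corr (- of_nat q / 2) \<rho> ((j + q) div 2)))"
proof -
  define k where "k = rational_ecc p q e"
  have kk: "\<bar>k\<bar> < 1" "landen_modulus k < 1 / 2" "\<rho> = landen_modulus k" using k by (auto simp: k_def \<rho>_def)
  define T where "T = ell_time k"
  define s where "s = (of_nat q / 2 :: complex)"
  define s1 where "s1 = (if j \<le> q then - s else s)"
  have s: "norm s \<le> real q" "norm (- s) \<le> real q" by (auto simp: s_def norm_divide)
  have ex: "exp (s * (2 * \<i> * of_real u)) = cis (real q * u)" "exp (- s * (2 * \<i> * of_real u)) = cis (- real q * u)" for u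
    by (auto simp: s_def cis_conv_exp mult_ac)
  have z: "2 * real ((j + q) div 2) = real j + real q"
    using par by (metis even_add even_two_times_div_two of_nat_add of_nat_mult of_nat_numeral)
  have I1: "((\<lambda>x. cis (real j * x - real q * T x)) has_integral 2 * of_real pi * half_coeff_corr s1 \<rho> y) {0..2 * pi}"
  proof (cases "j \<le> q")
    case True
    then have "nat \<bar>int q - int j\<bar> = q - j" by simp
    then have "2 * y = q - j" using par True by (simp add: y_def half_diff_def)
    then have rq: "real q = real j + 2 * real y" using True by linarith
    have "cis (- 2 * real y * x) * cis (- real q * (T x - x)) = cis (real j * x - real q * T x)" for x
      unfolding cis_mult by (intro arg_cong[where f = cis]) (simp add: rq algebra_simps)
    then show ?thesis
      using has_integral_phase_neg[OF kk(1,2) s(2) q, of y] True unfolding ex T_def by (simp add: s1_def kk(3))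
  next
    case False
    then have "nat \<bar>int q - int j\<bar> = j - q" by simp
    then have "2 * y = j - q" using par False by (simp add: y_def half_diff_def)
    then have rj: "real j = real q + 2 * real y" using False by linarith
    have "cis (2 * real y * x) * cis (- real q * (T x - x)) = cis (real j * x - real q * T x)" for x
      unfolding cis_mult by (intro arg_cong[where f = cis]) (simp add: rj algebra_simps)
    then show ?thesis
      using has_integral_phase_pos[OF kk(1,2) s(2) q, of y] False unfolding ex T_def by (simp add: s1_def kk(3))
  qed
  have I2: "((\<lambda>x. cis (real j * x + real q * T x)) has_integral 2 * of_real pi * half_coeff_corr (- s) \<rho> ((j + q) div 2)) {0..2 * pi}"
  proof -
    have "cis (2 * real ((j + q) div 2) * x) * cis (real q * (T x - x)) = cis (real j * x + real q * T x)" for x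
      unfolding cis_mult z by (intro arg_cong[where f = cis]) (simp add: algebra_simps)
    then show ?thesis
      using has_integral_phase_pos[OF kk(1,2) s(1) q, of "(j + q) div 2"] unfolding ex T_def by (simp only: kk(3))
  qed
  have "((\<lambda>x. Re (cis (real j * x - real q * T x)) - Re (cis (real j * x + real q * T x))) has_integral
     (Re (2 * of_real pi * half_coeff_corr s1 \<rho> y) - Re (2 * of_real pi * half_coeff_corr (- s) \<rho> ((j + q) div 2)))) {0..2 * pi}"
    by (intro has_integral_diff has_integral_Re I1 I2)
  then have "((\<lambda>x. (Re (cis (real j * x - real q * T x)) - Re (cis (real j * x + real q * T x))) / 2) has_integral
     (Re (2 * of_real pi * half_coeff_corr s1 \<rho> y) - Re (2 * of_real pi * half_coeff_corr (- s) \<rho> ((j + q) div 2))) / 2) {0..2 * pi}"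
    by (rule has_integral_divide)
  also have "(\<lambda>x. (Re (cis (real j * x - real q * T x)) - Re (cis (real j * x + real q * T x))) / 2) =
     (\<lambda>x. sin (real j * x) * sin (real q * T x))"
    by (simp add: cos_diff cos_add)
  also have "(Re (2 * of_real pi * half_coeff_corr s1 \<rho> y) - Re (2 * of_real pi * half_coeff_corr (- s) \<rho> ((j + q) div 2))) / 2
     = pi * (Re (half_coeff_corr s1 \<rho> y) - Re (half_coeff_corr (- s) \<rho> ((j + q) div 2)))"
    by (simp add: field_simps)
  finally have "integral {0..2 * pi} (\<lambda>x. sin (real j * x) * sin (real q * T x)) =
     pi * (Re (half_coeff_corr s1 \<rho> y) - Re (half_coeff_corr (- s) \<rho> ((j + q) div 2)))"
    by (rule integral_unique)
  then show ?thesis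
    using A_coeff_eq_integral[OF k(1) q, of j] by (simp add: T_def k_def s1_def s_def)
qed

lemma half_coeff_corr_near_head:
  assumes s: "norm s \<le> real q" "0 < q" and \<rho>: "0 \<le> \<rho>" "\<rho> \<le> 1 / 4"
  shows "norm (half_coeff_corr s \<rho> N - half_coeff s \<rho> N) \<le> 2 * 4 ^ q * (2 * \<rho>) ^ (N + 2)"
proof -
  have s': "norm (- s) \<le> real q" using s by simp
  have \<rho>1: "\<rho> < 1 / 2" "\<rho> < 1" using \<rho> by auto
  define f where "f = (\<lambda>m. half_coeff s \<rho> (m + N) * half_coeff (- s) \<rho> m)"
  have sf: "summable (\<lambda>m. norm (f m))"
    unfolding f_def by (rule summable_shifted_product[OF summable_norm_half_coeff[OF s \<rho>(1) \<rho>1(1)]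
      summable_norm_half_coeff[OF s' s(2) \<rho>(1) \<rho>1(1)]])
  have x: "0 \<le> (2 * \<rho>)\<^sup>2" "(2 * \<rho>)\<^sup>2 \<le> 1 / 4"
    using power_mono[of "2 * \<rho>" "1 / 2" 2] \<rho> by (auto simp: power2_eq_square)
  have fb: "norm (f (Suc m)) \<le> 4 ^ q * (2 * \<rho>) ^ (N + 2) * ((2 * \<rho>)\<^sup>2) ^ m" for m
  proof -
    have "norm (f (Suc m)) \<le> (2 ^ q * (2 * \<rho>) ^ (Suc m + N)) * (2 ^ q * (2 * \<rho>) ^ Suc m)"
      unfolding f_def norm_mult
      by (intro mult_mono half_coeff_norm_le[OF s \<rho>(1) \<rho>1(2)] half_coeff_norm_le[OF s' s(2) \<rho>(1) \<rho>1(2)])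
         (use \<rho> in auto)
    also have "\<dots> = (2 ^ q * 2 ^ q) * (2 * \<rho>) ^ (N + 2) * ((2 * \<rho>)\<^sup>2) ^ m"
    proof -
      have "X ^ (Suc m + N) * X ^ Suc m = X ^ (N + 2) * (X\<^sup>2) ^ m" for X :: real
        by (simp add: power_add power_mult_distrib power2_eq_square)
      then show ?thesis by (simp only: mult_ac)
    qed
    also have "(2 ^ q * 2 ^ q :: real) = 4 ^ q" by (simp add: power_mult_distrib[symmetric])
    finally show ?thesis .
  qed
  have sg: "summable (\<lambda>m. 4 ^ q * (2 * \<rho>) ^ (N + 2) * ((2 * \<rho>)\<^sup>2) ^ m)"
    using x by (intro summable_mult summable_geometric) auto
  have "half_coeff_corr s \<rho> N - half_coeff s \<rho> N = (\<Sum>m. f (Suc m))"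
    using suminf_split_head[OF summable_norm_cancel[OF sf]] by (simp add: half_coeff_corr_def f_def half_coeff_def)
  also have "norm \<dots> \<le> (\<Sum>m. 4 ^ q * (2 * \<rho>) ^ (N + 2) * ((2 * \<rho>)\<^sup>2) ^ m)"
    by (rule norm_suminf_le[OF fb sg]) 
  also have "\<dots> = 4 ^ q * (2 * \<rho>) ^ (N + 2) * (1 / (1 - (2 * \<rho>)\<^sup>2))"
    using x by (subst suminf_mult) (auto intro!: summable_geometric simp: suminf_geometric)
  also have "\<dots> \<le> 4 ^ q * (2 * \<rho>) ^ (N + 2) * 2"
    using x \<rho> by (intro mult_left_mono) (auto simp: divide_le_eq)
  finally show ?thesis by simp
qed

lemma half_coeff_corr_norm_le:
  assumes s: "norm s \<le> real q" "0 < q" and \<rho>: "0 \<le> \<rho>" "\<rho> \<le> 1 / 4"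
  shows "norm (half_coeff_corr s \<rho> N) \<le> 2 * 4 ^ q * (2 * \<rho>) ^ N"
proof -
  have "norm (half_coeff_corr s \<rho> N) \<le> norm (half_coeff s \<rho> N) + norm (half_coeff_corr s \<rho> N - half_coeff s \<rho> N)"
    by (metis add.commute diff_add_cancel norm_triangle_ineq)
  also have "\<dots> \<le> 2 ^ q * (2 * \<rho>) ^ N + 2 * 4 ^ q * (2 * \<rho>) ^ (N + 2)"
    using \<rho> by (intro add_mono half_coeff_norm_le half_coeff_corr_near_head s) auto
  also have "\<dots> \<le> 4 ^ q * (2 * \<rho>) ^ N + 4 ^ q * (2 * \<rho>) ^ N"
  proof (rule add_mono)
    show "2 ^ q * (2 * \<rho>) ^ N \<le> 4 ^ q * (2 * \<rho>) ^ N" using \<rho> by (intro mult_right_mono power_mono) auto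
    have x: "(2 * \<rho>)\<^sup>2 \<le> 1 / 4" using power_mono[of "2 * \<rho>" "1 / 2" 2] \<rho> by (auto simp: power2_eq_square)
    have "2 * 4 ^ q * (2 * \<rho>) ^ (N + 2) = 4 ^ q * (2 * \<rho>) ^ N * (2 * (2 * \<rho>)\<^sup>2)"
      by (simp only: power_add mult_ac)
    also have "\<dots> \<le> 4 ^ q * (2 * \<rho>) ^ N * 1" using x \<rho> by (intro mult_left_mono) auto
    finally show "2 * 4 ^ q * (2 * \<rho>) ^ (N + 2) \<le> 4 ^ q * (2 * \<rho>) ^ N" by simp
  qed
  finally show ?thesis by linarith
qed

lemma half_diff_double:
  assumes "even j \<longleftrightarrow> even q"
  shows "j \<le> q \<Longrightarrow> q = j + 2 * half_diff q j" "q < j \<Longrightarrow> j = q + 2 * half_diff q j"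
proof -
  assume a: "j \<le> q"
  then have "nat \<bar>int q - int j\<bar> = q - j" by simp
  then have "2 * half_diff q j = q - j" using assms a by (simp add: half_diff_def)
  then show "q = j + 2 * half_diff q j" using a by simp
next
  assume a: "q < j"
  then have "nat \<bar>int q - int j\<bar> = j - q" by simp
  then have "2 * half_diff q j = j - q" using assms a by (simp add: half_diff_def)
  then show "j = q + 2 * half_diff q j" using a by simp
qed

lemma half_diff_less_half_sum:
  assumes "even j \<longleftrightarrow> even q" "0 < j" "0 < q"
  shows "half_diff q j + 1 \<le> (j + q) div 2" "q \<le> j + 2 * half_diff q j"
  using half_diff_double[OF assms(1)] assms(2,3) by (cases "j \<le> q"; linarith)+

text \<open>The factor of the leading term that depends on \<open>j\<close> and \<open>q\<close> only, so that both cases of the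
asymptotic formula can be treated at once.\<close>

definition leading_factor :: "nat \<Rightarrow> nat \<Rightarrow> real" where
  "leading_factor q j = (let y = half_diff q j in
     if j \<le> q then real ((j + y - 1) choose y) else (- 1) ^ y * real (j choose y))"

lemma leading_factor_eq:
  assumes par: "even j \<longleftrightarrow> even q" and pos: "0 < j" "0 < q"
  defines "y \<equiv> half_diff q j"
  defines "s \<equiv> if j \<le> q then - of_nat q / 2 else (of_nat q / 2 :: complex)"
  shows "of_nat j / of_nat q * (fps_nth (fps_exp s oo lag_fps 0) y * (- of_real \<rho>) ^ y) =
    of_real (leading_factor q j * (\<rho> / 4) ^ y)"
proof (cases "j \<le> q")
  case True
  have q: "q = j + 2 * y" using half_diff_double(1)[OF par True] by (simp add: y_def)
  define L where "L = fps_nth (fps_exp s oo lag_fps 0) y"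
  have "of_nat j * L * 4 ^ y = (- 1) ^ y * of_nat q * (of_nat ((j + y - 1) choose y) :: complex)"
    using fps_exp_lag_0_neg[OF pos(1), of y] True unfolding L_def s_def q[symmetric] by (simp only: if_True simp_thms)
  then have "of_nat j * L = (- 1) ^ y * of_nat q * of_nat ((j + y - 1) choose y) / 4 ^ y"
    by (simp add: eq_divide_eq)
  then have "of_nat j / of_nat q * L = (- 1) ^ y * of_nat ((j + y - 1) choose y) / 4 ^ y"
    using pos(2) by (simp add: divide_eq_eq)
  then have "of_nat j / of_nat q * (L * (- of_real \<rho>) ^ y) = of_nat ((j + y - 1) choose y) / 4 ^ y * ((- 1) ^ y * (- of_real \<rho>) ^ y)"
    by (simp add: mult.assoc[symmetric])
  also have "(- 1) ^ y * (- of_real \<rho>) ^ y = (of_real \<rho> ^ y :: complex)"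
    by (simp add: power_mult_distrib[symmetric])
  finally show ?thesis
    using True by (simp add: leading_factor_def Let_def y_def[symmetric] L_def power_divide)
next
  case False
  have j: "j = q + 2 * y" using half_diff_double(2)[OF par] False by (simp add: y_def)
  define L where "L = fps_nth (fps_exp s oo lag_fps 0) y"
  have "of_nat j * L * 4 ^ y = of_nat q * (of_nat (j choose y) :: complex)"
    using fps_exp_lag_0_pos[OF pos(2), of y] False unfolding L_def s_def j[symmetric] by (simp only: if_False)
  then have "of_nat j * L = of_nat q * of_nat (j choose y) / 4 ^ y"
    by (simp add: eq_divide_eq)
  then have "of_nat j / of_nat q * L = of_nat (j choose y) / 4 ^ y"
    using pos(2) by (simp add: divide_eq_eq)
  then have "of_nat j / of_nat q * (L * (- of_real \<rho>) ^ y) = of_nat (j choose y) / 4 ^ y * (- of_real \<rho>) ^ y"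
    by (simp add: mult.assoc[symmetric])
  also have "\<dots> = of_real (leading_factor q j * (\<rho> / 4) ^ y)"
    using False power_minus[of "of_real \<rho> :: complex" y]
    by (simp add: leading_factor_def Let_def y_def[symmetric] power_divide)
  finally show ?thesis by (simp only: L_def)
qed

text \<open>There are three sources of error: the terms \<open>m > 0\<close> of the first correlation sum, the dependence of
its first term on \<open>\<rho>\<close> beyond the power \<open>\<rho> ^ y\<close>, and the second correlation sum, whose order
\<open>(j + q) / 2\<close> exceeds \<open>y\<close>. The constant depends on \<open>j\<close> and \<open>q\<close> but not on \<open>p\<close> or \<open>e\<close>.\<close>

lemma A_coeff_near_lead:
  assumes par: "even j \<longleftrightarrow> even q" and pos: "0 < j" "0 < q"
  defines "y \<equiv> half_diff q j"
  shows "\<exists>M\<ge>0. \<forall>p e. \<bar>rational_ecc p q e\<bar> < 1 \<longrightarrow> landen_modulus (rational_ecc p q e) \<le> 1 / 4 \<longrightarrow>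
    \<bar>A_coeff p q j e - leading_factor q j * (landen_modulus (rational_ecc p q e) / 4) ^ y\<bar>
      \<le> M * landen_modulus (rational_ecc p q e) ^ (y + 1)"
proof -
  define s where "s = (if j \<le> q then - of_nat q / 2 else (of_nat q / 2 :: complex))"
  define z where "z = (j + q) div 2"
  have yz: "y + 1 \<le> z" using half_diff_less_half_sum(1)[OF par pos] by (simp add: y_def z_def)
  have s: "norm s \<le> real q" "norm (- of_nat q / 2 :: complex) \<le> real q" by (auto simp: s_def norm_divide)
  obtain K where K: "K \<ge> 0" "\<And>\<rho>. \<bar>\<rho>\<bar> \<le> 1 / 2 \<Longrightarrow>
    norm (fps_nth (fps_exp s oo lag_fps \<rho>) y - fps_nth (fps_exp s oo lag_fps 0) y) \<le> K * \<bar>\<rho>\<bar>"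
    using fps_exp_lag_near[OF s(1) pos(2), of y] by blast
  define c where "c = real j / real q"
  have c0: "0 \<le> c" by (simp add: c_def)
  define M where "M = c * (K + 2 * 4 ^ q * 2 ^ (y + 2) + 2 * 4 ^ q * 2 ^ (y + 1))"
  have "\<bar>A_coeff p q j e - leading_factor q j * (\<rho> / 4) ^ y\<bar> \<le> M * \<rho> ^ (y + 1)"
    if k: "\<bar>rational_ecc p q e\<bar> < 1" and \<rho>: "\<rho> = landen_modulus (rational_ecc p q e)" "\<rho> \<le> 1 / 4" for p e \<rho>
  proof -
    have \<rho>0: "0 \<le> \<rho>" using landen_modulus_bounds[OF k] by (simp add: \<rho>)
    define S1 where "S1 = half_coeff_corr s \<rho> y"
    define S2 where "S2 = half_coeff_corr (- of_nat q / 2) \<rho> z"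
    define L where "L = fps_nth (fps_exp s oo lag_fps 0) y * (- of_real \<rho>) ^ y"
    have A: "A_coeff p q j e = c * (Re S1 - Re S2)"
      using A_coeff_eq_corr[OF k _ pos(2) par] \<rho> by (simp add: S1_def S2_def c_def s_def z_def y_def)
    have lead: "leading_factor q j * (\<rho> / 4) ^ y = c * Re L"
    proof -
      have "of_real c * L = of_real (leading_factor q j * (\<rho> / 4) ^ y)"
        using leading_factor_eq[OF par pos, of \<rho>] by (simp add: c_def L_def s_def y_def)
      then have "Re (of_real c * L) = leading_factor q j * (\<rho> / 4) ^ y" by (simp only: Re_complex_of_real)
      then show ?thesis by simp
    qed
    have b1: "norm (half_coeff s \<rho> y - L) \<le> K * \<rho> ^ (y + 1)"
    proof -
      have "half_coeff s \<rho> y - L = (fps_nth (fps_exp s oo lag_fps \<rho>) y - fps_nth (fps_exp s oo lag_fps 0) y) * (- of_real \<rho>) ^ y"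
        by (simp add: half_coeff_def L_def left_diff_distrib)
      also have "norm \<dots> \<le> K * \<bar>\<rho>\<bar> * \<rho> ^ y"
        unfolding norm_mult norm_power using K(1) K(2)[of \<rho>] \<rho>0 \<rho>(2) by (intro mult_mono) auto
      finally show ?thesis using \<rho>0 by simp
    qed
    have b2: "norm (S1 - half_coeff s \<rho> y) \<le> 2 * 4 ^ q * 2 ^ (y + 2) * \<rho> ^ (y + 1)"
    proof -
      have "norm (S1 - half_coeff s \<rho> y) \<le> 2 * 4 ^ q * (2 * \<rho>) ^ (y + 2)"
        unfolding S1_def by (rule half_coeff_corr_near_head[OF s(1) pos(2) \<rho>0 \<rho>(2)])
      also have "\<dots> = 2 * 4 ^ q * 2 ^ (y + 2) * (\<rho> ^ (y + 1) * \<rho>)" by (simp add: power_mult_distrib)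
      also have "\<dots> \<le> 2 * 4 ^ q * 2 ^ (y + 2) * (\<rho> ^ (y + 1) * 1)"
        using \<rho>0 \<rho>(2) by (intro mult_left_mono) auto
      finally show ?thesis by simp
    qed
    have b3: "norm S2 \<le> 2 * 4 ^ q * 2 ^ (y + 1) * \<rho> ^ (y + 1)"
    proof -
      have "norm S2 \<le> 2 * 4 ^ q * (2 * \<rho>) ^ z"
        unfolding S2_def by (rule half_coeff_corr_norm_le[OF s(2) pos(2) \<rho>0 \<rho>(2)])
      also have "\<dots> \<le> 2 * 4 ^ q * (2 * \<rho>) ^ (y + 1)"
        using yz \<rho>0 \<rho>(2) by (intro mult_left_mono power_decreasing) auto
      finally show ?thesis by (simp add: power_mult_distrib mult_ac)
    qed
    have "A_coeff p q j e - leading_factor q j * (\<rho> / 4) ^ y = c * Re ((S1 - half_coeff s \<rho> y) + (half_coeff s \<rho> y - L) - S2)"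
      unfolding A lead by (simp add: algebra_simps)
    also have "\<bar>\<dots>\<bar> \<le> c * norm ((S1 - half_coeff s \<rho> y) + (half_coeff s \<rho> y - L) - S2)"
      unfolding abs_mult using c0 by (intro mult_mono abs_Re_le_cmod) auto
    also have "\<dots> \<le> c * (norm (S1 - half_coeff s \<rho> y) + norm (half_coeff s \<rho> y - L) + norm S2)"
      using c0 norm_triangle_ineq4[of "(S1 - half_coeff s \<rho> y) + (half_coeff s \<rho> y - L)" S2]
        norm_triangle_ineq[of "S1 - half_coeff s \<rho> y" "half_coeff s \<rho> y - L"]
      by (intro mult_left_mono) linarith+
    also have "\<dots> \<le> c * (2 * 4 ^ q * 2 ^ (y + 2) * \<rho> ^ (y + 1) + K * \<rho> ^ (y + 1) + 2 * 4 ^ q * 2 ^ (y + 1) * \<rho> ^ (y + 1))"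
      using c0 by (intro mult_left_mono add_mono b1 b2 b3)
    also have "\<dots> = M * \<rho> ^ (y + 1)" by (simp only: M_def ring_distribs mult_ac add_ac)
    finally show ?thesis .
  qed
  moreover have "0 \<le> M" using c0 K(1) by (simp add: M_def)
  ultimately show ?thesis by blast
qed

lemma A_coeff_abs_le:
  assumes par: "even j \<longleftrightarrow> even q" and pos: "0 < j" "0 < q"
    and k: "\<bar>rational_ecc p q e\<bar> < 1" and \<rho>: "\<rho> = landen_modulus (rational_ecc p q e)" "\<rho> \<le> 1 / 4"
  shows "\<bar>A_coeff p q j e\<bar> \<le> 4 * real j * 4 ^ q * (2 * \<rho>) ^ half_diff q j"
proof -
  define y where "y = half_diff q j"
  define s where "s = (if j \<le> q then - of_nat q / 2 else (of_nat q / 2 :: complex))"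
  define z where "z = (j + q) div 2"
  have yz: "y + 1 \<le> z" using half_diff_less_half_sum(1)[OF par pos] by (simp add: y_def z_def)
  have s: "norm s \<le> real q" "norm (- of_nat q / 2 :: complex) \<le> real q" by (auto simp: s_def norm_divide)
  have \<rho>0: "0 \<le> \<rho>" using landen_modulus_bounds[OF k] by (simp add: \<rho>)
  define S1 where "S1 = half_coeff_corr s \<rho> y"
  define S2 where "S2 = half_coeff_corr (- of_nat q / 2) \<rho> z"
  have A: "A_coeff p q j e = real j / real q * (Re S1 - Re S2)"
    using A_coeff_eq_corr[OF k _ pos(2) par] \<rho> by (simp add: S1_def S2_def s_def z_def y_def)
  have b1: "norm S1 \<le> 2 * 4 ^ q * (2 * \<rho>) ^ y"
    unfolding S1_def by (rule half_coeff_corr_norm_le[OF s(1) pos(2) \<rho>0 \<rho>(2)])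
  have "norm S2 \<le> 2 * 4 ^ q * (2 * \<rho>) ^ z"
    unfolding S2_def by (rule half_coeff_corr_norm_le[OF s(2) pos(2) \<rho>0 \<rho>(2)])
  also have "\<dots> \<le> 2 * 4 ^ q * (2 * \<rho>) ^ y"
    using yz \<rho>0 \<rho>(2) by (intro mult_left_mono power_decreasing) auto
  finally have b2: "norm S2 \<le> 2 * 4 ^ q * (2 * \<rho>) ^ y" .
  have "\<bar>Re S1 - Re S2\<bar> \<le> 4 * (4 ^ q * (2 * \<rho>) ^ y)"
    using b1 b2 abs_Re_le_cmod[of S1] abs_Re_le_cmod[of S2] by linarith
  moreover have "real j / real q \<le> real j" using pos by (simp add: divide_le_eq mult_le_cancel_left1)
  ultimately have "\<bar>A_coeff p q j e\<bar> \<le> real j * (4 * (4 ^ q * (2 * \<rho>) ^ y))"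
    unfolding A abs_mult by (intro mult_mono) auto
  then show ?thesis by (simp add: y_def mult_ac)
qed

section \<open>Asymptotics for small eccentricity\<close>

lemma landen_near_quarter:
  assumes "\<bar>k\<bar> < 1"
  shows "\<bar>landen_modulus k / 4 - k\<^sup>2 / 16\<bar> \<le> k ^ 4 / 4"
proof -
  define c where "c = sqrt (1 - k\<^sup>2)"
  have k2: "k\<^sup>2 < 1" using assms by (simp add: abs_square_less_1)
  have c: "0 \<le> c" "c \<le> 1" "c\<^sup>2 = 1 - k\<^sup>2" using k2 by (auto simp: c_def)
  have p: "1 \<le> (1 + c)\<^sup>2" using c by (intro one_le_power) auto
  have "c\<^sup>2 \<le> c" using mult_left_mono[OF c(2,1)] by (simp add: power2_eq_square)
  then have d: "1 - c \<le> k\<^sup>2" using c(3) by linarith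
  have e: "4 - (1 + c)\<^sup>2 = (1 - c) * (3 + c)" by (simp add: power2_eq_square algebra_simps)
  have n: "0 \<le> 4 - (1 + c)\<^sup>2" "4 - (1 + c)\<^sup>2 \<le> 4 * k\<^sup>2"
    unfolding e using c mult_mono[OF d, of "3 + c" 4] by (auto simp: mult.commute)
  have "landen_modulus k / 4 - k\<^sup>2 / 16 = k\<^sup>2 * (4 - (1 + c)\<^sup>2) / (16 * (1 + c)\<^sup>2)"
  proof -
    have "x / P / 4 - x / 16 = x * (4 - P) / (16 * P)" if "P \<noteq> 0" for x P :: real
      using that by (simp add: field_simps)
    moreover have "(1 + c)\<^sup>2 \<noteq> 0" using p by linarith
    ultimately show ?thesis unfolding landen_modulus_bounds(3)[OF assms] c_def[symmetric] by blast
  qed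
  moreover have "0 \<le> k\<^sup>2 * (4 - (1 + c)\<^sup>2) / (16 * (1 + c)\<^sup>2)" using n by simp
  moreover have "k\<^sup>2 * (4 - (1 + c)\<^sup>2) / (16 * (1 + c)\<^sup>2) \<le> k\<^sup>2 * (4 * k\<^sup>2) / (16 * 1)"
    using n p by (intro frac_le mult_left_mono) auto
  moreover have "k\<^sup>2 * (4 * k\<^sup>2) / (16 * 1) = k ^ 4 / 4" by (simp add: power_add[symmetric])
  ultimately show ?thesis by simp
qed

text \<open>For \<open>e < \<kappa> / 2\<close> the inequality \<open>k \<le> e / \<kappa>\<close> keeps \<open>k\<close> below \<open>1 / 2\<close>, and then
\<open>e / \<kappa> - k\<close> is of third order. The constants in the last estimate come from
\<open>\<rho> / 4 - k\<^sup>2 / 16\<close> and \<open>k\<^sup>2 / 16 - e\<^sup>2 / (16 \<kappa>\<^sup>2)\<close>, respectively.\<close>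

lemma rational_ecc_near:
  assumes e: "0 < e" and pq: "0 < p" "real p / real q < 1 / 2" "0 < q"
  defines "\<kappa> \<equiv> cos (pi * real p / real q)" and "k \<equiv> rational_ecc p q e"
  assumes small: "e < \<kappa> / 2"
  shows "0 < k" "k \<le> e / \<kappa>" "k < 1 / 2" "landen_modulus k \<le> (e / \<kappa>)\<^sup>2" "landen_modulus k \<le> 1 / 4"
    "\<bar>landen_modulus k / 4 - e\<^sup>2 / (16 * \<kappa>\<^sup>2)\<bar> \<le> (1 / (4 * \<kappa> ^ 4) + pi / (4 * \<kappa> ^ 5)) * e ^ 4"
proof -
  have ka: "0 < \<kappa>" using e small by linarith
  have "\<kappa> \<le> 1" by (simp add: \<kappa>_def)
  then have e1: "e < 1" using small by linarith
  have k0: "0 < k" using rational_ecc_props(1)[OF e e1 pq] e by (simp add: k_def)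
  then show "0 < k" .
  note U = rational_ecc_bounds[OF e e1 pq, folded k_def \<kappa>_def]
  show ke: "k \<le> e / \<kappa>" using U(1) ka by (simp add: pos_le_divide_eq mult.commute)
  have "e / \<kappa> < 1 / 2" using small ka by (simp add: divide_less_eq)
  with ke show kh: "k < 1 / 2" by linarith
  have k1: "\<bar>k\<bar> < 1" using k0 kh by simp
  have k2: "k\<^sup>2 \<le> (e / \<kappa>)\<^sup>2" using ke k0 by (intro power_mono) auto
  show "landen_modulus k \<le> (e / \<kappa>)\<^sup>2" using landen_modulus_bounds(2)[OF k1] k2 by linarith
  have k4: "k\<^sup>2 \<le> 1 / 4" using power_mono[of k "1 / 2" 2] kh k0 by (simp add: power2_eq_square)
  then show "landen_modulus k \<le> 1 / 4" using landen_modulus_bounds(2)[OF k1] by linarith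
  have "1 / sqrt (1 - k\<^sup>2) \<le> 1 / (1 - k\<^sup>2)"
  proof (rule divide_left_mono)
    show "1 - k\<^sup>2 \<le> sqrt (1 - k\<^sup>2)"
      using k4 by (intro real_le_rsqrt) (simp add: power2_eq_square mult_left_le)
  qed (use k4 in auto)
  also have "\<dots> \<le> 1 + 2 * k\<^sup>2"
  proof -
    have "1 / (1 - x) \<le> 1 + 2 * x" if "0 \<le> x" "x \<le> 1 / 4" for x :: real
      using that mult_nonneg_nonneg[of x "1 - 2 * x"] by (simp add: divide_le_eq algebra_simps)
    then show ?thesis using k4 by simp
  qed
  finally have d: "1 / sqrt (1 - k\<^sup>2) - 1 \<le> 2 * k\<^sup>2" by simp
  have "e \<le> k * (\<kappa> + pi * (1 / sqrt (1 - k\<^sup>2) - 1))" by (rule U(2))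
  also have "\<dots> \<le> k * (\<kappa> + pi * (2 * k\<^sup>2))" using d k0 by (intro mult_left_mono add_left_mono) auto
  finally have "e - \<kappa> * k \<le> 2 * pi * k ^ 3" by (simp add: algebra_simps power2_eq_square power3_eq_cube)
  then have "(e - \<kappa> * k) / \<kappa> \<le> 2 * pi * k ^ 3 / \<kappa>" using ka by (intro divide_right_mono) auto
  then have "e / \<kappa> - k \<le> 2 * pi * k ^ 3 / \<kappa>" using ka by (simp add: diff_divide_distrib)
  also have "\<dots> \<le> 2 * pi * (e / \<kappa>) ^ 3 / \<kappa>"
    using ke k0 ka by (intro divide_right_mono mult_left_mono power_mono) auto
  finally have diff: "e / \<kappa> - k \<le> 2 * pi * (e / \<kappa>) ^ 3 / \<kappa>" .
  have "(e / \<kappa>)\<^sup>2 - k\<^sup>2 = (e / \<kappa> - k) * (e / \<kappa> + k)" by (simp add: power2_eq_square algebra_simps)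
  also have "\<dots> \<le> (2 * pi * (e / \<kappa>) ^ 3 / \<kappa>) * (2 * (e / \<kappa>))"
    using diff ke k0 e ka by (intro mult_mono) auto
  also have "\<dots> = 4 * pi / \<kappa> ^ 5 * e ^ 4"
    using ka by (simp add: field_simps eval_nat_numeral)
  also have "\<dots> = 16 * (pi / (4 * \<kappa> ^ 5) * e ^ 4)" by simp
  finally have "(e / \<kappa>)\<^sup>2 - k\<^sup>2 \<le> 16 * (pi / (4 * \<kappa> ^ 5) * e ^ 4)" .
  moreover have "e\<^sup>2 / (16 * \<kappa>\<^sup>2) = (e / \<kappa>)\<^sup>2 / 16" by (simp add: power_divide)
  ultimately have "\<bar>k\<^sup>2 / 16 - e\<^sup>2 / (16 * \<kappa>\<^sup>2)\<bar> \<le> pi / (4 * \<kappa> ^ 5) * e ^ 4"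
    using k2 by linarith
  moreover have "\<bar>landen_modulus k / 4 - k\<^sup>2 / 16\<bar> \<le> 1 / (4 * \<kappa> ^ 4) * e ^ 4"
  proof -
    have "k ^ 4 \<le> (e / \<kappa>) ^ 4" using ke k0 by (intro power_mono) auto
    then show ?thesis using landen_near_quarter[OF k1] by (simp add: power_divide)
  qed
  ultimately show "\<bar>landen_modulus k / 4 - e\<^sup>2 / (16 * \<kappa>\<^sup>2)\<bar> \<le> (1 / (4 * \<kappa> ^ 4) + pi / (4 * \<kappa> ^ 5)) * e ^ 4"
    by (simp only: distrib_right)
qed

lemma abs_power_diff_le:
  fixes a b B :: real
  assumes "0 \<le> a" "a \<le> B" "0 \<le> b" "b \<le> B" "0 < B"
  shows "\<bar>a ^ n - b ^ n\<bar> \<le> real n * B ^ n / B * \<bar>a - b\<bar>"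
proof -
  have "norm ((a / B) ^ n - (b / B) ^ n) \<le> real n * norm (a / B - b / B)"
    by (rule norm_power_diff) (use assms in auto)
  then have "B ^ n * \<bar>(a / B) ^ n - (b / B) ^ n\<bar> \<le> B ^ n * (real n * \<bar>a / B - b / B\<bar>)"
    using assms by (intro mult_left_mono) auto
  moreover have "B ^ n * \<bar>(a / B) ^ n - (b / B) ^ n\<bar> = \<bar>a ^ n - b ^ n\<bar>"
    using assms by (simp add: power_divide diff_divide_distrib[symmetric] abs_divide)
  moreover have "B ^ n * (real n * \<bar>a / B - b / B\<bar>) = real n * B ^ n / B * \<bar>a - b\<bar>"
    using assms by (simp add: diff_divide_distrib[symmetric] abs_divide)
  ultimately show ?thesis by simp
qed

lemma cos_rotation_pos:
  assumes "0 < p" "real p / real q < 1 / 2"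
  shows "0 < cos (pi * real p / real q)"
proof (rule cos_gt_zero_pi)
  have "pi * (real p / real q) < pi * (1 / 2)" using assms by (intro mult_strict_left_mono) auto
  then show "pi * real p / real q < pi / 2" by simp
  have "- (pi / 2) < (0::real)" by simp
  also have "0 \<le> pi * real p / real q" by simp
  finally show "- (pi / 2) < pi * real p / real q" .
qed

lemma A_coeff_asymptotics:
  assumes pq: "0 < p" "real p / real q < 1 / 2" "0 < q" and j: "0 < j" and par: "even j \<longleftrightarrow> even q"
  defines "y \<equiv> half_diff q j"
  shows "(\<lambda>e. A_coeff p q j e - leading_factor q j * (e ^ (2 * y) / (2 ^ (4 * y) * cos (pi * real p / real q) ^ (2 * y))))
    \<in> O[at_right 0](\<lambda>e. e ^ (2 * y + 2))"
proof -
  define \<kappa> where "\<kappa> = cos (pi * real p / real q)"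
  have ka: "0 < \<kappa>" unfolding \<kappa>_def by (rule cos_rotation_pos[OF pq(1,2)])
  define c where "c = leading_factor q j"
  obtain M where M: "0 \<le> M" "\<And>p e. \<bar>rational_ecc p q e\<bar> < 1 \<Longrightarrow> landen_modulus (rational_ecc p q e) \<le> 1 / 4 \<Longrightarrow>
    \<bar>A_coeff p q j e - c * (landen_modulus (rational_ecc p q e) / 4) ^ y\<bar> \<le> M * landen_modulus (rational_ecc p q e) ^ (y + 1)"
    using A_coeff_near_lead[OF par j pq(3)] unfolding c_def y_def by blast
  define N where "N = 1 / (4 * \<kappa> ^ 4) + pi / (4 * \<kappa> ^ 5)"
  define B where "B = 1 / (4 * \<kappa>\<^sup>2)"
  define C where "C = M / \<kappa> ^ (2 * y + 2) + \<bar>c\<bar> * (real y * B ^ y / B * N)"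
  have B: "0 < B" using ka by (simp add: B_def)
  have "\<forall>\<^sub>F e in at_right 0. norm (A_coeff p q j e - c * (e ^ (2 * y) / (2 ^ (4 * y) * \<kappa> ^ (2 * y)))) \<le> C * norm (e ^ (2 * y + 2))"
  proof (rule eventually_mono)
    show "\<forall>\<^sub>F e in at_right 0. e \<in> {0<..<\<kappa> / 2}"
      using ka by (intro eventually_at_right_real) simp
    fix e assume "e \<in> {0<..<\<kappa> / 2}"
    then have e: "0 < e" "e < \<kappa> / 2" by auto
    define k where "k = rational_ecc p q e"
    note R = rational_ecc_near[OF e(1) pq, folded \<kappa>_def k_def, OF e(2)]
    define X where "X = e\<^sup>2 / (16 * \<kappa>\<^sup>2)"
    have k1: "\<bar>k\<bar> < 1" using R(1,3) by simp
    have rho0: "0 \<le> landen_modulus k" using landen_modulus_bounds[OF k1] by simp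
    have 1: "\<bar>A_coeff p q j e - c * (landen_modulus k / 4) ^ y\<bar> \<le> M / \<kappa> ^ (2 * y + 2) * e ^ (2 * y + 2)"
    proof -
      have "\<bar>A_coeff p q j e - c * (landen_modulus k / 4) ^ y\<bar> \<le> M * landen_modulus k ^ (y + 1)"
        using M(2)[of p e] k1 R(5) by (simp add: k_def)
      also have "\<dots> \<le> M * ((e / \<kappa>)\<^sup>2) ^ (y + 1)"
        using M(1) R(4) rho0 by (intro mult_left_mono power_mono)
      also have "((e / \<kappa>)\<^sup>2) ^ (y + 1) = e ^ (2 * y + 2) / \<kappa> ^ (2 * y + 2)"
        by (simp only: power_mult[symmetric] power_divide) simp
      finally show ?thesis by simp
    qed
    have "\<bar>(landen_modulus k / 4) ^ y - X ^ y\<bar> \<le> real y * (e\<^sup>2 * B) ^ y / (e\<^sup>2 * B) * \<bar>landen_modulus k / 4 - X\<bar>"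
    proof (rule abs_power_diff_le)
      show "landen_modulus k / 4 \<le> e\<^sup>2 * B" using R(4) by (simp add: B_def power_divide)
      show "X \<le> e\<^sup>2 * B" using ka by (simp add: B_def X_def divide_left_mono frac_le)
    qed (use rho0 e B in \<open>auto simp: X_def\<close>)
    also have "\<dots> \<le> real y * (e\<^sup>2 * B) ^ y / (e\<^sup>2 * B) * (N * e ^ 4)"
      using R(6) e B by (intro mult_left_mono) (auto simp: N_def X_def)
    also have "\<dots> = real y * B ^ y / B * N * e ^ (2 * y + 2)"
    proof -
      have "(e\<^sup>2) ^ y / e\<^sup>2 * e ^ 4 = e ^ (2 * y + 2)"
        using e by (simp add: power_mult[symmetric] power_add field_simps eval_nat_numeral)
      then have "real y * B ^ y / B * N * ((e\<^sup>2) ^ y / e\<^sup>2 * e ^ 4) = real y * B ^ y / B * N * e ^ (2 * y + 2)" by (simp only:)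
      then show ?thesis by (simp add: power_mult_distrib mult_ac)
    qed
    finally have 2: "\<bar>(landen_modulus k / 4) ^ y - X ^ y\<bar> \<le> real y * B ^ y / B * N * e ^ (2 * y + 2)" .
    have X: "e ^ (2 * y) / (2 ^ (4 * y) * \<kappa> ^ (2 * y)) = X ^ y"
      by (simp add: X_def power_mult power_divide power_mult_distrib)
    have "\<bar>A_coeff p q j e - c * X ^ y\<bar> = \<bar>(A_coeff p q j e - c * (landen_modulus k / 4) ^ y) + c * ((landen_modulus k / 4) ^ y - X ^ y)\<bar>"
      by (simp add: algebra_simps)
    also have "\<dots> \<le> \<bar>A_coeff p q j e - c * (landen_modulus k / 4) ^ y\<bar> + \<bar>c\<bar> * \<bar>(landen_modulus k / 4) ^ y - X ^ y\<bar>"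
      using abs_triangle_ineq[of "A_coeff p q j e - c * (landen_modulus k / 4) ^ y" "c * ((landen_modulus k / 4) ^ y - X ^ y)"]
      by (simp only: abs_mult)
    also have "\<dots> \<le> M / \<kappa> ^ (2 * y + 2) * e ^ (2 * y + 2) + \<bar>c\<bar> * (real y * B ^ y / B * N * e ^ (2 * y + 2))"
      using 1 2 by (intro add_mono mult_left_mono) auto
    also have "\<dots> = C * e ^ (2 * y + 2)" by (simp only: C_def distrib_right mult.assoc)
    finally show "norm (A_coeff p q j e - c * (e ^ (2 * y) / (2 ^ (4 * y) * \<kappa> ^ (2 * y)))) \<le> C * norm (e ^ (2 * y + 2))"
      using e unfolding X by simp
  qed
  then show ?thesis unfolding \<kappa>_def c_def by (rule bigoI)
qed

text \<open>Since \<open>q \<le> j + 2 y\<close>, the bound \<open>4 j 4 ^ q (2 \<rho>) ^ y\<close> is at most exponential in \<open>j\<close> and \<open>y\<close>, apart from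
\<open>\<rho> ^ y\<close>. The dependence on \<open>p\<close> enters only through \<open>cos (\<pi> p / q)\<close>, which is bounded below by
\<open>cos (\<pi> r)\<close>. The maximum with \<open>0\<close> covers negative \<open>r\<close>.\<close>

lemma A_coeff_uniform_bound:
  fixes r :: real
  assumes r: "r < 1 / 2"
  shows "\<exists>C > 0. \<exists>e0 > 0. e0 \<le> 1 \<and>
        (\<forall>p q j :: nat. 0 < p \<longrightarrow> 1 < q \<longrightarrow> 1 < j \<longrightarrow> real p / real q \<le> r \<longrightarrow>
          (even j \<longleftrightarrow> even q) \<longrightarrow>
          (\<forall>e. 0 < e \<and> e < e0 \<longrightarrow>
            \<bar>A_coeff p q j e\<bar> \<le> C ^ (3 * half_diff q j + j + 1) * e ^ (2 * half_diff q j)))"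
proof -
  define r0 where "r0 = max r 0"
  define \<kappa>0 where "\<kappa>0 = cos (pi * r0)"
  have r0: "0 \<le> r0" "r0 < 1 / 2" "r \<le> r0" using r by (auto simp: r0_def)
  have ka0: "0 < \<kappa>0" "\<kappa>0 \<le> 1" unfolding \<kappa>0_def using r0 mult_strict_left_mono[of r0 "1 / 2" pi]
    by (auto intro!: cos_gt_zero_pi intro: less_le_trans[of _ 0])
  \<comment> \<open>The factor \<open>32\<close> is \<open>16 = 4\<^sup>2\<close> from \<open>4 ^ (2 y)\<close> times the \<open>2\<close> in \<open>(2 \<rho>) ^ y\<close>; it also exceeds \<open>8\<close> and \<open>4\<close>.\<close>
  define C where "C = 32 / \<kappa>0\<^sup>2"
  have C: "32 \<le> C" using ka0 by (simp add: C_def le_divide_eq power_le_one)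
  have "\<bar>A_coeff p q j e\<bar> \<le> C ^ (3 * half_diff q j + j + 1) * e ^ (2 * half_diff q j)"
    if pq: "0 < p" "0 < q" "0 < j" "real p / real q \<le> r" and par: "even j \<longleftrightarrow> even q" and e: "0 < e" "e < \<kappa>0 / 2" for p q j e
  proof -
    define \<kappa> where "\<kappa> = cos (pi * real p / real q)"
    define y where "y = half_diff q j"
    have half: "real p / real q < 1 / 2" using pq r by linarith
    have "\<kappa>0 \<le> \<kappa>" unfolding \<kappa>_def \<kappa>0_def
    proof (rule cos_monotone_0_pi_le)
      have "pi * (real p / real q) \<le> pi * r0" using pq(4) r0 by (intro mult_left_mono) auto
      then show "pi * real p / real q \<le> pi * r0" by simp
      show "pi * r0 \<le> pi" using r0 by simp
    qed simp
    then have e': "e < \<kappa> / 2" using e by linarith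
    define k where "k = rational_ecc p q e"
    note R = rational_ecc_near[OF e(1) pq(1) half pq(2), folded \<kappa>_def k_def, OF e']
    have k1: "\<bar>k\<bar> < 1" using R(1,3) by simp
    have rho0: "0 \<le> landen_modulus k" using landen_modulus_bounds[OF k1] by simp
    have "(e / \<kappa>)\<^sup>2 \<le> (e / \<kappa>0)\<^sup>2" using \<open>\<kappa>0 \<le> \<kappa>\<close> ka0 e by (intro power_mono divide_left_mono) auto
    then have rho: "2 * landen_modulus k \<le> 2 / \<kappa>0\<^sup>2 * e\<^sup>2" using R(4) by (simp add: power_divide)
    have "\<bar>A_coeff p q j e\<bar> \<le> 4 * real j * 4 ^ q * (2 * landen_modulus k) ^ y"
      unfolding y_def by (rule A_coeff_abs_le[OF par pq(3,2)]) (use k1 R(5) in \<open>auto simp: k_def\<close>)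
    also have "\<dots> \<le> 4 * 2 ^ j * 4 ^ (j + 2 * y) * (2 / \<kappa>0\<^sup>2 * e\<^sup>2) ^ y"
    proof (intro mult_mono power_mono[OF rho])
      show "real j \<le> 2 ^ j" using less_exp[of j] by (metis less_imp_le of_nat_le_iff of_nat_numeral of_nat_power)
      show "(4::real) ^ q \<le> 4 ^ (j + 2 * y)"
        using half_diff_less_half_sum(2)[OF par pq(3,2)] by (intro power_increasing) (auto simp: y_def)
    qed (use rho0 in auto)
    also have "\<dots> = 4 * 8 ^ j * C ^ y * e ^ (2 * y)"
    proof -
      have "(4::real) ^ (j + 2 * y) = 4 ^ j * 16 ^ y" by (simp add: power_add power_mult)
      moreover have "(2::real) ^ j * 4 ^ j = 8 ^ j" by (simp add: power_mult_distrib[symmetric])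
      moreover have "16 ^ y * (2 / \<kappa>0\<^sup>2 * e\<^sup>2) ^ y = C ^ y * e ^ (2 * y)"
        by (simp add: power_mult power_mult_distrib[symmetric] C_def)
      ultimately show ?thesis by (simp add: mult_ac)
    qed
    also have "\<dots> \<le> C ^ (3 * y + j + 1) * e ^ (2 * y)"
    proof (rule mult_right_mono)
      have "4 * 8 ^ j * C ^ y \<le> C * C ^ j * C ^ (3 * y)"
        using C by (intro mult_mono power_mono power_increasing) auto
      then show "4 * 8 ^ j * C ^ y \<le> C ^ (3 * y + j + 1)" by (simp add: power_add mult_ac)
    qed (use e in auto)
    finally show ?thesis by (simp add: y_def)
  qed
  then show ?thesis using C ka0 by (intro exI[of _ C] conjI exI[of _ "\<kappa>0 / 2"]) auto
qed

theorem theorem4: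
  "(\<forall>p q j :: nat. 0 < p \<longrightarrow> 1 < q \<longrightarrow> 1 < j \<longrightarrow> real p / real q < 1 / 2 \<longrightarrow>
      (even j \<longleftrightarrow> even q) \<longrightarrow>
      (let y = half_diff q j in
        (j \<le> q \<longrightarrow>
          (\<lambda>e. A_coeff p q j e - real ((j + y - 1) choose y) *
                 (e ^ (2 * y) / (2 ^ (4 * y) * cos (pi * real p / real q) ^ (2 * y))))
            \<in> O[at_right 0](\<lambda>e. e ^ (2 * y + 2))) \<and>
        (j > q \<longrightarrow>
          (\<lambda>e. A_coeff p q j e - (- 1) ^ y * real (j choose y) *
                 (e ^ (2 * y) / (2 ^ (4 * y) * cos (pi * real p / real q) ^ (2 * y))))
            \<in> O[at_right 0](\<lambda>e. e ^ (2 * y + 2))))) \<and>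
   (\<forall>r::real. r < 1 / 2 \<longrightarrow>
      (\<exists>C > 0. \<exists>e0 > 0. e0 \<le> 1 \<and>
        (\<forall>p q j :: nat. 0 < p \<longrightarrow> 1 < q \<longrightarrow> 1 < j \<longrightarrow> real p / real q \<le> r \<longrightarrow>
          (even j \<longleftrightarrow> even q) \<longrightarrow>
          (\<forall>e. 0 < e \<and> e < e0 \<longrightarrow>
            \<bar>A_coeff p q j e\<bar> \<le> C ^ (3 * half_diff q j + j + 1) * e ^ (2 * half_diff q j))))) \<and>
   (\<forall>p q j :: nat. 0 < p \<longrightarrow> 1 < q \<longrightarrow> 1 < j \<longrightarrow> real p / real q < 1 / 2 \<longrightarrow>
      (even j \<longleftrightarrow> odd q) \<longrightarrow>
      (\<forall>e. 0 < e \<and> e < 1 \<longrightarrow> A_coeff p q j e = 0))"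
proof (intro conjI allI impI)
  fix p q j :: nat
  assume h: "0 < p" "1 < q" "1 < j" "real p / real q < 1 / 2" "even j \<longleftrightarrow> even q"
  have "0 < q" "0 < j" using h by auto
  note A = A_coeff_asymptotics[OF h(1,4) this h(5)]
  show "let y = half_diff q j in
        (j \<le> q \<longrightarrow>
          (\<lambda>e. A_coeff p q j e - real ((j + y - 1) choose y) *
                 (e ^ (2 * y) / (2 ^ (4 * y) * cos (pi * real p / real q) ^ (2 * y))))
            \<in> O[at_right 0](\<lambda>e. e ^ (2 * y + 2))) \<and>
        (j > q \<longrightarrow>
          (\<lambda>e. A_coeff p q j e - (- 1) ^ y * real (j choose y) *
                 (e ^ (2 * y) / (2 ^ (4 * y) * cos (pi * real p / real q) ^ (2 * y))))
            \<in> O[at_right 0](\<lambda>e. e ^ (2 * y + 2)))"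
    unfolding Let_def
  proof (intro conjI impI, goal_cases)
    case 1
    then show ?case using A by (simp only: leading_factor_def Let_def if_True)
  next
    case 2
    then have "\<not> j \<le> q" by simp
    then show ?case using A by (simp only: leading_factor_def Let_def if_False)
  qed
next
  fix r :: real assume "r < 1 / 2"
  then show "\<exists>C > 0. \<exists>e0 > 0. e0 \<le> 1 \<and>
        (\<forall>p q j :: nat. 0 < p \<longrightarrow> 1 < q \<longrightarrow> 1 < j \<longrightarrow> real p / real q \<le> r \<longrightarrow>
          (even j \<longleftrightarrow> even q) \<longrightarrow>
          (\<forall>e. 0 < e \<and> e < e0 \<longrightarrow>
            \<bar>A_coeff p q j e\<bar> \<le> C ^ (3 * half_diff q j + j + 1) * e ^ (2 * half_diff q j)))"
    by (rule A_coeff_uniform_bound)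
next
  fix p q j :: nat and e :: real
  assume h: "0 < p" "1 < q" "1 < j" "real p / real q < 1 / 2" "even j \<longleftrightarrow> odd q" and e: "0 < e \<and> e < 1"
  have q: "0 < q" using h by simp
  have "e \<le> rational_ecc p q e" "rational_ecc p q e < 1"
    using rational_ecc_props(1,2)[OF _ _ h(1,4) q, of e] e by simp_all
  then have "\<bar>rational_ecc p q e\<bar> < 1" using e by simp
  then show "A_coeff p q j e = 0"
    by (rule A_coeff_odd_parity[OF _ q h(5)])
qed

end
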